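(* Let $0\le k\le n$, and let $w^{\odot}\in S_{n,k}^{\odot}$ have associated positroid $\mathcal{M}$. The following are equivalent: (1) The positroid variety $\Pi_{\mathcal{M}}$ is smooth. (2) For every $J\in\mathcal{M}$, $\#\{I\in\mathcal{M}: |I\cap J|=k-1\}=k(n-k)-\#Alignments(w^{\odot})$. (3) The graph $J(\mathcal{M})$ is regular, and each vertex has degree $k(n-k)-\#Alignments(w^{\odot})$. (4) The decorated permutation $w^{\odot}$ has no crossed alignments. (5) The chord diagram of $w^{\odot}$ is a union of spirographs on a noncrossing partition of $[n]$.
   Context: $[n]=\{1,\dots,n\}$, $\binom{[n]}{k}$ the set of $k$-subsets. $Gr(k,n)$ is the Grassmannian of $k$-dimensional subspaces of $\mathbb{C}^n$; $\Delta_I$ denotes the Plücker coordinate (maximal minor in columns $I$). A decorated permutation on $n$ elements is $w\in S_n$ together with a label "clockwise" or "counterclockwise" on each fixed point. An element $i$ is an anti-exceedance if $i<w^{-1}(i)$ or $i$ is a clockwise fixed point; $S_{n,k}^{\odot}$ is the set of decorated permutations on $n$ elements with exactly $k$ anti-exceedances. For $r\in[n]$ let $<_r$ be the order $r<_r r+1<_r\cdots<_r n<_r 1<_r\cdots<_r r-1$, and $I_r(w)=\{i: i<_r w^{-1}(i)\text{ or } i \text{ a clockwise fixed point}\}$. For $I=\{i_1<_r\dots<_r i_k\}$, $J=\{j_1<_r\dots<_r j_k\}$, $I\preceq_r J$ means $i_h\le_r j_h$ for all $h$. The positroid is $\mathcal{M}=\{I\in\binom{[n]}{k}: I_r(w)\preceq_r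 I\ \forall r\}$, and the positroid variety $\Pi_{\mathcal{M}}$ is the subvariety of $Gr(k,n)$ whose vanishing ideal is generated by $\{\Delta_I: I\notin\mathcal{M}\}$. The chord diagram $D(w^{\odot})$: place $1,\dots,n$ clockwise on a circle and for each $i$ draw a directed arc from $i$ to $w(i)$ inside the circle with a minimal number of crossings between distinct arcs; arcs at fixed points are small loops drawn clockwise or counterclockwise according to the decoration. A pair of arcs $(i\mapsto w(i), j\mapsto w(j))$ is an alignment if they can be drawn as distinct noncrossing arcs oriented in the same direction, a misalignment if they can be drawn as distinct noncrossing arcs oriented in opposite directions, and a crossing if they must cross when both are drawn inside the circle. $Alignments(w^{\odot})$ is the set of alignments. An alignment $(i\mapsto w(i),j\mapsto w(j))$ is a crossed alignment if there is a third arc $h\mapsto w(h)$ forming a crossing with both. A spirograph permutation is one of the form $w(i)=i+t \pmod n$ for a fixed $1\le t\le n$, and its chord diagram is a spirograph; "union of spirographs on a noncrossing partition" means there is a noncrossing partition of $[n]$ whose blocks are each mapped to themselves by $w$, and on each block $B=\{b_1<\dots<b_m\}$ the permutation acts as $b_i\mapsto b_{i+t\pmod m}$ for some fixed $t$ (i.e., after relabeling $B$ as $[m]$ it is a spirograph permutation). The Johnson graph $J(\mathcal{M})$ has vertex set $\mathcal{M}$, with $I,J$ adjacent iff $|I\cap J|=k-1$. *)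

theory Defs
  imports
    Complex_Main
    "HOL-Library.Function_Algebras"
    "HOL-Library.Extended_Nat"
    "HOL-Library.Disjoint_Sets"
    "HOL-Combinatorics.Permutations"
    "Jordan_Normal_Form.Determinant"
begin

section \<open>Decorated permutations and positroids\<close>

definition ksubsets :: "nat \<Rightarrow> nat \<Rightarrow> nat set set" where
  "ksubsets n k = {I. I \<subseteq> {1..n} \<and> card I = k}"

text \<open>A decorated permutation is a pair \<open>(w, C)\<close>, where \<open>C\<close> is the set of fixed points
  labelled clockwise; the remaining fixed points are labelled counterclockwise.\<close>

definition anti_exceedances :: "nat \<Rightarrow> (nat \<Rightarrow> nat) \<Rightarrow> nat set \<Rightarrow> nat set" where
  "anti_exceedances n w C = {i \<in> {1..n}. i < inv_into UNIV w i \<or> i \<in> C}"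

definition decorated_perms :: "nat \<Rightarrow> nat \<Rightarrow> ((nat \<Rightarrow> nat) \<times> nat set) set" where
  "decorated_perms n k =
     {(w, C). w permutes {1..n} \<and> C \<subseteq> {i \<in> {1..n}. w i = i} \<and> card (anti_exceedances n w C) = k}"

text \<open>\<open>cyc_pos n r i\<close> is the number of elements of \<open>{1..n}\<close> preceding \<open>i\<close> in the order
  \<open>r <\<^sub>r r+1 <\<^sub>r \<dots> <\<^sub>r n <\<^sub>r 1 <\<^sub>r \<dots> <\<^sub>r r-1\<close>, so \<open>i <\<^sub>r j\<close> iff \<open>cyc_pos n r i < cyc_pos n r j\<close>.\<close>

definition cyc_pos :: "nat \<Rightarrow> nat \<Rightarrow> nat \<Rightarrow> nat" where
  "cyc_pos n r i = (i + n - r) mod n"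

definition shifted_anti_exceedances ::
    "nat \<Rightarrow> (nat \<Rightarrow> nat) \<Rightarrow> nat set \<Rightarrow> nat \<Rightarrow> nat set" where
  "shifted_anti_exceedances n w C r =
     {i \<in> {1..n}. cyc_pos n r i < cyc_pos n r (inv_into UNIV w i) \<or> i \<in> C}"

definition gale_le :: "nat \<Rightarrow> nat \<Rightarrow> nat set \<Rightarrow> nat set \<Rightarrow> bool" where
  "gale_le n r I J \<longleftrightarrow>
     list_all2 (\<lambda>i j. cyc_pos n r i \<le> cyc_pos n r j)
       (sorted_key_list_of_set (cyc_pos n r) I) (sorted_key_list_of_set (cyc_pos n r) J)"

definition positroid :: "nat \<Rightarrow> nat \<Rightarrow> (nat \<Rightarrow> nat) \<Rightarrow> nat set \<Rightarrow> nat set set" where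
  "positroid n k w C =
     {I \<in> ksubsets n k. \<forall>r\<in>{1..n}. gale_le n r (shifted_anti_exceedances n w C r) I}"


section \<open>Chord diagrams\<close>

text \<open>The arcs are drawn as chords of a circle with marked points at integer positions, in
  clockwise order.  The vertex \<open>i\<close> sits at position \<open>3 * i\<close>, and the loop at a fixed point is
  replaced by a short chord with the same orientation: a loop inside the circle that runs clockwise
  returns to \<open>i\<close> from the counterclockwise side of \<open>i\<close>, and vice versa.\<close>

definition arc_tail :: "nat \<Rightarrow> nat" where
  "arc_tail i = 3 * i"

definition arc_head :: "(nat \<Rightarrow> nat) \<Rightarrow> nat set \<Rightarrow> nat \<Rightarrow> nat" where
  "arc_head w C i =
     (if w i = i then (if i \<in> C then 3 * i - 1 else 3 * i + 1) else 3 * w i)"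

definition clockwise :: "nat \<Rightarrow> nat \<Rightarrow> nat \<Rightarrow> bool" where
  "clockwise a b c \<longleftrightarrow> a < b \<and> b < c \<or> b < c \<and> c < a \<or> c < a \<and> a < b"

text \<open>A point \<open>x\<close> lies strictly to the left of the directed chord from \<open>a\<close> to \<open>b\<close> iff it is met when
  travelling clockwise from \<open>a\<close> to \<open>b\<close>.\<close>

definition left_of :: "(nat \<Rightarrow> nat) \<Rightarrow> nat set \<Rightarrow> nat \<Rightarrow> nat \<Rightarrow> bool" where
  "left_of w C i x \<longleftrightarrow> clockwise (arc_tail i) x (arc_head w C i)"

text \<open>Two arcs cross if they cannot be drawn disjointly in the closed disc, so arcs sharing a vertex
  (meeting on the circle) count as crossing.\<close>

definition crossing :: "(nat \<Rightarrow> nat) \<Rightarrow> nat set \<Rightarrow> nat \<Rightarrow> nat \<Rightarrow> bool" where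
  "crossing w C i j \<longleftrightarrow> i \<noteq> j \<and>
     ({arc_tail i, arc_head w C i} \<inter> {arc_tail j, arc_head w C j} \<noteq> {} \<or>
      left_of w C i (arc_tail j) \<noteq> left_of w C i (arc_head w C j))"

text \<open>Noncrossing chords point in the same direction iff exactly one of them lies to the left of the
  other.\<close>

definition alignment :: "(nat \<Rightarrow> nat) \<Rightarrow> nat set \<Rightarrow> nat \<Rightarrow> nat \<Rightarrow> bool" where
  "alignment w C i j \<longleftrightarrow> i \<noteq> j \<and> \<not> crossing w C i j \<and>
     left_of w C i (arc_tail j) \<noteq> left_of w C j (arc_tail i)"

definition alignments :: "nat \<Rightarrow> (nat \<Rightarrow> nat) \<Rightarrow> nat set \<Rightarrow> nat set set" where
  "alignments n w C = {{i, j} | i j. i \<in> {1..n} \<and> j \<in> {1..n} \<and> alignment w C i j}"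

definition crossed_alignment :: "nat \<Rightarrow> (nat \<Rightarrow> nat) \<Rightarrow> nat set \<Rightarrow> nat \<Rightarrow> nat \<Rightarrow> bool" where
  "crossed_alignment n w C i j \<longleftrightarrow>
     alignment w C i j \<and> (\<exists>h\<in>{1..n}. crossing w C h i \<and> crossing w C h j)"

definition noncrossing :: "nat set set \<Rightarrow> bool" where
  "noncrossing P \<longleftrightarrow>
     (\<forall>A\<in>P. \<forall>B\<in>P. A \<noteq> B \<longrightarrow>
        \<not> (\<exists>a b c d. a < b \<and> b < c \<and> c < d \<and> a \<in> A \<and> c \<in> A \<and> b \<in> B \<and> d \<in> B))"

definition spirograph_on :: "(nat \<Rightarrow> nat) \<Rightarrow> nat set \<Rightarrow> bool" where
  "spirograph_on w B \<longleftrightarrow>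
     (\<exists>t\<in>{1..card B}. \<forall>i<card B.
        w (sorted_list_of_set B ! i) = sorted_list_of_set B ! ((i + t) mod card B))"

definition union_of_spirographs :: "nat \<Rightarrow> (nat \<Rightarrow> nat) \<Rightarrow> bool" where
  "union_of_spirographs n w \<longleftrightarrow>
     (\<exists>P. partition_on {1..n} P \<and> noncrossing P \<and>
        (\<forall>B\<in>P. w ` B = B \<and> spirograph_on w B))"


section \<open>The Johnson graph\<close>

text \<open>Graphs are pairs of a vertex set and a set of two-element edges.  The condition
  \<open>|I \<inter> J| = k - 1\<close> is written without the truncated subtraction, which would be wrong for
  \<open>k = 0\<close>.\<close>

definition johnson_graph :: "nat \<Rightarrow> nat set set \<Rightarrow> nat set set \<times> nat set set set" where
  "johnson_graph k M = (M, {{I, J} | I J. I \<in> M \<and> J \<in> M \<and> card (I \<inter> J) + 1 = k})"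

definition degree_in :: "'a set \<times> 'a set set \<Rightarrow> 'a \<Rightarrow> nat" where
  "degree_in G v = card {e \<in> snd G. v \<in> e}"

definition regular_graph :: "'a set \<times> 'a set set \<Rightarrow> bool" where
  "regular_graph G \<longleftrightarrow> (\<exists>d. \<forall>v\<in>fst G. degree_in G v = d)"


section \<open>Affine algebraic sets over the complex numbers\<close>

text \<open>The affine space with coordinates indexed by \<open>S\<close> is the set of functions supported on \<open>S\<close>.\<close>

definition cscale :: "complex \<Rightarrow> ('v \<Rightarrow> complex) \<Rightarrow> 'v \<Rightarrow> complex" where
  "cscale c v = (\<lambda>i. c * v i)"

interpretation cfun: vector_space "cscale :: complex \<Rightarrow> ('v \<Rightarrow> complex) \<Rightarrow> 'v \<Rightarrow> complex"
  by unfold_locales (auto simp: cscale_def fun_eq_iff algebra_simps)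

definition affine_space :: "'v set \<Rightarrow> ('v \<Rightarrow> complex) set" where
  "affine_space S = {x. \<forall>i. i \<notin> S \<longrightarrow> x i = 0}"

inductive_set poly_funs :: "'v set \<Rightarrow> (('v \<Rightarrow> complex) \<Rightarrow> complex) set" for S :: "'v set" where
  const: "(\<lambda>x. c) \<in> poly_funs S"
| coord: "i \<in> S \<Longrightarrow> (\<lambda>x. x i) \<in> poly_funs S"
| add: "f \<in> poly_funs S \<Longrightarrow> g \<in> poly_funs S \<Longrightarrow> (\<lambda>x. f x + g x) \<in> poly_funs S"
| mult: "f \<in> poly_funs S \<Longrightarrow> g \<in> poly_funs S \<Longrightarrow> (\<lambda>x. f x * g x) \<in> poly_funs S"

definition zariski_closed :: "'v set \<Rightarrow> ('v \<Rightarrow> complex) set \<Rightarrow> bool" where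
  "zariski_closed S Z \<longleftrightarrow>
     (\<exists>F. F \<subseteq> poly_funs S \<and> Z = {x \<in> affine_space S. \<forall>f\<in>F. f x = 0})"

definition vanishing_ideal ::
    "'v set \<Rightarrow> ('v \<Rightarrow> complex) set \<Rightarrow> (('v \<Rightarrow> complex) \<Rightarrow> complex) set" where
  "vanishing_ideal S X = {f \<in> poly_funs S. \<forall>x\<in>X. f x = 0}"

definition irreducible_closed :: "'v set \<Rightarrow> ('v \<Rightarrow> complex) set \<Rightarrow> bool" where
  "irreducible_closed S Z \<longleftrightarrow> zariski_closed S Z \<and> Z \<noteq> {} \<and>
     (\<forall>A B. zariski_closed S A \<and> zariski_closed S B \<and> Z \<subseteq> A \<union> B \<longrightarrow> Z \<subseteq> A \<or> Z \<subseteq> B)"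

text \<open>The dimension of \<open>X\<close> at \<open>p\<close>, i.e. the Krull dimension of the local ring at \<open>p\<close>.\<close>

definition local_dim :: "'v set \<Rightarrow> ('v \<Rightarrow> complex) set \<Rightarrow> ('v \<Rightarrow> complex) \<Rightarrow> enat" where
  "local_dim S X p =
     (SUP d \<in> {d. \<exists>Z. (\<forall>i\<le>d. irreducible_closed S (Z i) \<and> p \<in> Z i \<and> Z i \<subseteq> X) \<and>
                      (\<forall>i<d. Z i \<subset> Z (Suc i))}. enat d)"

text \<open>The Zariski tangent space: the common kernel of the differentials at \<open>p\<close> of all elements of the
  vanishing ideal.\<close>

definition tangent_space ::
    "'v set \<Rightarrow> ('v \<Rightarrow> complex) set \<Rightarrow> ('v \<Rightarrow> complex) \<Rightarrow> ('v \<Rightarrow> complex) set" where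
  "tangent_space S X p =
     {v \<in> affine_space S. \<forall>f \<in> vanishing_ideal S X.
        ((\<lambda>t. f (\<lambda>i. p i + t * v i)) has_field_derivative 0) (at 0)}"

definition smooth_affine :: "'v set \<Rightarrow> ('v \<Rightarrow> complex) set \<Rightarrow> bool" where
  "smooth_affine S X \<longleftrightarrow> (\<forall>p\<in>X. enat (cfun.dim (tangent_space S X p)) = local_dim S X p)"


section \<open>The Grassmannian and positroid varieties\<close>

definition grassmannian :: "nat \<Rightarrow> nat \<Rightarrow> (nat \<Rightarrow> complex) set set" where
  "grassmannian n k = {V. cfun.subspace V \<and> V \<subseteq> affine_space {1..n} \<and> cfun.dim V = k}"

text \<open>\<open>plucker k A I\<close> is the minor in columns \<open>I\<close> of the matrix with rows \<open>A 0, \<dots>, A (k - 1)\<close>.\<close>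

definition plucker :: "nat \<Rightarrow> (nat \<Rightarrow> nat \<Rightarrow> complex) \<Rightarrow> nat set \<Rightarrow> complex" where
  "plucker k A I = det (mat k k (\<lambda>(r, c). A r (sorted_list_of_set I ! c)))"

text \<open>The vanishing of a Pluecker coordinate at \<open>V\<close> does not depend on the matrix with row span
  \<open>V\<close>.\<close>

definition positroid_variety :: "nat \<Rightarrow> nat \<Rightarrow> nat set set \<Rightarrow> (nat \<Rightarrow> complex) set set" where
  "positroid_variety n k M =
     {V \<in> grassmannian n k. \<forall>I \<in> ksubsets n k - M.
        \<forall>A. cfun.span (A ` {..<k}) = V \<longrightarrow> plucker k A I = 0}"

text \<open>The standard affine chart \<open>\<Delta>\<^sub>J \<noteq> 0\<close>: the row span of the matrix, with rows indexed by \<open>J\<close>, that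
  is the identity in the columns \<open>J\<close> and has entries \<open>x (i, j)\<close> in the columns \<open>j \<notin> J\<close>.\<close>

definition chart_index :: "nat \<Rightarrow> nat set \<Rightarrow> (nat \<times> nat) set" where
  "chart_index n J = J \<times> ({1..n} - J)"

definition chart_point :: "nat set \<Rightarrow> (nat \<times> nat \<Rightarrow> complex) \<Rightarrow> (nat \<Rightarrow> complex) set" where
  "chart_point J x =
     cfun.span ((\<lambda>i j. if j \<in> J then (if j = i then 1 else 0) else x (i, j)) ` J)"

definition smooth_in_grassmannian :: "nat \<Rightarrow> nat \<Rightarrow> (nat \<Rightarrow> complex) set set \<Rightarrow> bool" where
  "smooth_in_grassmannian n k X \<longleftrightarrow>
     (\<forall>J \<in> ksubsets n k. smooth_affine (chart_index n J)
        {x \<in> affine_space (chart_index n J). chart_point J x \<in> X})"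

end

theory Submission
  imports Defs
begin

text \<open>
  In the affine chart around the coordinate subspace of a basis \<open>J\<close>, the positroid variety lies in the
  coordinate space \<open>L\<^sub>J\<close> spanned by the exchanges \<open>J - i + j \<in> M\<close>, and \<open>L\<^sub>J\<close> is its tangent space at the
  origin. A chain of irreducible closed sets in affine \<open>m\<close>-space has length at most \<open>m\<close>, so smoothness
  at the origin forces the variety to be all of \<open>L\<^sub>J\<close>. Evaluating minors at 0/1 points, this says that two
  disjoint exchanges at \<open>J\<close> can always be performed simultaneously. Hence the exchange graph of every
  basis is a union of complete bipartite graphs whose components are constant along exchanges;
  following the Grassmann necklace, \<open>w\<close> preserves these components and acts on each of them as a
  rotation, and a crossing of two components would produce an exchange between them. Conversely,
  spirographs on a noncrossing partition give a direct sum of uniform matroids, and then every chart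
  is a coordinate space.

  A basis \<open>I\<close> belongs to the positroid iff every cyclic interval contains at least as many non-elements
  of \<open>I\<close> as it contains arcs. For a necklace basis, the exchanges blocked by an interval are counted by
  a flow argument: they inject into the alignments, and they are strictly fewer if some alignment is
  crossed. Finally, a permutation without invariant cyclic interval that is not a rotation has an
  alignment with adjacent heads, and such an alignment forces a crossed one.
\<close>

section \<open>Dimension of affine space\<close>

lemma poly_funs_line:
  assumes "f \<in> poly_funs S"
  shows "\<exists>q. \<forall>t. f (\<lambda>i. a i + t * v i) = poly q t"
  using assms
proof induction
  case (const c)
  show ?case by (rule exI[of _ "[:c:]"]) simp
next
  case (coord i)
  show ?case by (rule exI[of _ "[:a i, v i:]"]) (simp add: algebra_simps)
next
  case (add f g)
  then show ?case by (metis poly_add)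
next
  case (mult f g)
  then show ?case by (metis poly_mult)
qed

lemma poly_funs_restrict:
  assumes "f \<in> poly_funs S"
  shows "\<exists>g \<in> poly_funs T. \<forall>x \<in> affine_space T. f x = g x"
  using assms
proof induction
  case (const c)
  show ?case by (rule bexI[of _ "\<lambda>x. c"]) (auto intro: poly_funs.const)
next
  case (coord i)
  show ?case
  proof (cases "i \<in> T")
    case True
    then show ?thesis by (intro bexI[of _ "\<lambda>x. x i"]) (auto intro: poly_funs.coord)
  next
    case False
    then show ?thesis
      by (intro bexI[of _ "\<lambda>x. 0"]) (auto intro: poly_funs.const simp: affine_space_def)
  qed
next
  case (add f g)
  then obtain f' g' where "f' \<in> poly_funs T" "\<forall>x\<in>affine_space T. f x = f' x"
    "g' \<in> poly_funs T" "\<forall>x\<in>affine_space T. g x = g' x" by blast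
  then show ?case by (intro bexI[of _ "\<lambda>x. f' x + g' x"]) (auto intro: poly_funs.add)
next
  case (mult f g)
  then obtain f' g' where "f' \<in> poly_funs T" "\<forall>x\<in>affine_space T. f x = f' x"
    "g' \<in> poly_funs T" "\<forall>x\<in>affine_space T. g x = g' x" by blast
  then show ?case by (intro bexI[of _ "\<lambda>x. f' x * g' x"]) (auto intro: poly_funs.mult)
qed

lemma irreducible_closedI:
  assumes "zariski_closed S Z" "Z \<noteq> {}"
    and line: "\<And>x y t. x \<in> Z \<Longrightarrow> y \<in> Z \<Longrightarrow> (\<lambda>i. x i + t * (y i - x i)) \<in> Z"
  shows "irreducible_closed S Z"
  unfolding irreducible_closed_def
proof (intro conjI allI impI assms(1,2))
  fix A B
  assume AB: "zariski_closed S A \<and> zariski_closed S B \<and> Z \<subseteq> A \<union> B"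
  show "Z \<subseteq> A \<or> Z \<subseteq> B"
  proof (rule ccontr)
    assume "\<not> (Z \<subseteq> A \<or> Z \<subseteq> B)"
    then obtain x y where xy: "x \<in> Z" "x \<notin> A" "y \<in> Z" "y \<notin> B" by auto
    have ZS: "Z \<subseteq> affine_space S" using assms(1) unfolding zariski_closed_def by auto
    obtain f where f: "f \<in> poly_funs S" "f x \<noteq> 0" "\<forall>z\<in>A. f z = 0"
      using AB xy ZS unfolding zariski_closed_def by blast
    obtain g where g: "g \<in> poly_funs S" "g y \<noteq> 0" "\<forall>z\<in>B. g z = 0"
      using AB xy ZS unfolding zariski_closed_def by blast
    define L where "L t = (\<lambda>i. x i + t * (y i - x i))" for t
    obtain p where p: "\<And>t. f (L t) = poly p t"
      using poly_funs_line[OF f(1), of x "\<lambda>i. y i - x i"] unfolding L_def by auto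
    obtain q where q: "\<And>t. g (L t) = poly q t"
      using poly_funs_line[OF g(1), of x "\<lambda>i. y i - x i"] unfolding L_def by auto
    have "L 0 = x" "L 1 = y" by (auto simp: L_def)
    then have "p \<noteq> 0" "q \<noteq> 0" using f(2) g(2) p[of 0] q[of 1] by auto
    moreover have "poly (p * q) t = 0" for t
    proof -
      have "L t \<in> A \<union> B" using line[OF xy(1,3)] AB unfolding L_def by blast
      then show ?thesis using f(3) g(3) p[of t] q[of t] by auto
    qed
    ultimately show False by (metis mult_eq_0_iff poly_all_0_iff_0)
  qed
qed

lemma zariski_closed_slice:
  assumes "T \<subseteq> S" "p \<in> affine_space S"
  shows "zariski_closed S {x \<in> affine_space S. \<forall>i\<in>T. x i = p i}"
proof -
  have "(\<lambda>x. x i + (- p i)) \<in> poly_funs S" if "i \<in> T" for i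
    using that assms(1) by (intro poly_funs.add poly_funs.coord poly_funs.const) auto
  then show ?thesis unfolding zariski_closed_def
    by (intro exI[of _ "(\<lambda>i x. x i + (- p i)) ` T"]) auto
qed

lemma irreducible_closed_slice:
  assumes "T \<subseteq> S" "p \<in> affine_space S"
  shows "irreducible_closed S {x \<in> affine_space S. \<forall>i\<in>T. x i = p i}"
proof (rule irreducible_closedI[OF zariski_closed_slice[OF assms]])
  show "{x \<in> affine_space S. \<forall>i\<in>T. x i = p i} \<noteq> {}" using assms(2) by auto
qed (auto simp: affine_space_def)

lemma affine_space_slice:
  "T \<subseteq> S \<Longrightarrow> affine_space T = {x \<in> affine_space S. \<forall>i\<in>S - T. x i = 0}"
  by (auto simp: affine_space_def)

lemma irreducible_closed_affine_space:
  assumes "T \<subseteq> S" shows "irreducible_closed S (affine_space T)"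
  using irreducible_closed_slice[of "S - T" S "\<lambda>i. 0"] assms affine_space_slice[OF assms]
  by (auto simp: affine_space_def)

fun monomial :: "('a \<Rightarrow> complex) list \<Rightarrow> nat list \<Rightarrow> 'a \<Rightarrow> complex" where
  "monomial (f # fs) (e # es) = (\<lambda>x. f x ^ e * monomial fs es x)"
| "monomial _ _ = (\<lambda>x. 1)"

definition exponents :: "nat \<Rightarrow> nat \<Rightarrow> nat list set" where
  "exponents d N = {es. set es \<subseteq> {..<N} \<and> length es = d}"

lemma finite_exponents [simp]: "finite (exponents d N)"
  unfolding exponents_def by (rule finite_lists_length_eq) simp

lemma card_exponents [simp]: "card (exponents d N) = N ^ d"
  unfolding exponents_def using card_lists_length_eq[of "{..<N}" d] by simp

lemma sum_exponents_Suc: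
  fixes g :: "nat list \<Rightarrow> complex"
  shows "(\<Sum>es\<in>exponents (Suc d) N. g es) = (\<Sum>e<N. \<Sum>es\<in>exponents d N. g (e # es))"
proof -
  have "exponents (Suc d) N = (\<lambda>(e, es). e # es) ` ({..<N} \<times> exponents d N)"
    by (auto simp: exponents_def length_Suc_conv image_iff)
  moreover have "inj_on (\<lambda>(e, es). e # es) ({..<N} \<times> exponents d N)"
    by (auto simp: inj_on_def)
  ultimately show ?thesis
    by (simp only: sum.reindex sum.cartesian_product) (auto intro: sum.cong)
qed

lemma irreducible_closed_mult:
  assumes "irreducible_closed S Z" "f \<in> poly_funs S" "g \<in> poly_funs S" "\<forall>x\<in>Z. f x * g x = 0"
    and "x \<in> Z" "f x \<noteq> 0" "y \<in> Z"
  shows "g y = 0"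
proof -
  have ZS: "Z \<subseteq> affine_space S" using assms(1) unfolding irreducible_closed_def zariski_closed_def by auto
  have "zariski_closed S {x \<in> affine_space S. h x = 0}" if "h \<in> poly_funs S" for h
    unfolding zariski_closed_def using that by (intro exI[of _ "{h}"]) auto
  moreover have "Z \<subseteq> {x \<in> affine_space S. f x = 0} \<union> {x \<in> affine_space S. g x = 0}"
    using ZS assms(4) by auto
  ultimately have "Z \<subseteq> {x \<in> affine_space S. f x = 0} \<or> Z \<subseteq> {x \<in> affine_space S. g x = 0}"
    using assms(1,2,3) unfolding irreducible_closed_def by blast
  then show ?thesis using assms by auto
qed

lemma poly_funs_power: "f \<in> poly_funs S \<Longrightarrow> (\<lambda>x. f x ^ e) \<in> poly_funs S"
  by (induction e) (auto intro: poly_funs.const poly_funs.mult)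

lemma poly_funs_monomial:
  "set fs \<subseteq> poly_funs S \<Longrightarrow> monomial fs es \<in> poly_funs S"
  by (induction fs es rule: list_induct2')
     (auto intro: poly_funs.const poly_funs.mult poly_funs_power)

lemma poly_funs_sum:
  "finite A \<Longrightarrow> (\<And>a. a \<in> A \<Longrightarrow> f a \<in> poly_funs S) \<Longrightarrow> (\<lambda>x. \<Sum>a\<in>A. f a x) \<in> poly_funs S"
  by (induction A rule: finite_induct) (auto intro: poly_funs.const poly_funs.add)


lemma poly_funs_mono: "f \<in> poly_funs T \<Longrightarrow> T \<subseteq> S \<Longrightarrow> f \<in> poly_funs S"
  by (induction rule: poly_funs.induct) (auto intro: poly_funs.intros)

lemma monomials_linearly_independent:
  assumes "\<And>i. i \<le> d \<Longrightarrow> irreducible_closed S (Z i)"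
    and "\<And>i. i < d \<Longrightarrow> Z i \<subseteq> Z (Suc i)"
    and "\<And>i. i < d \<Longrightarrow> f i \<in> poly_funs S"
    and "\<And>i x. i < d \<Longrightarrow> x \<in> Z i \<Longrightarrow> f i x = 0"
    and "\<And>i. i < d \<Longrightarrow> \<exists>x\<in>Z (Suc i). f i x \<noteq> 0"
    and "\<And>x. x \<in> Z d \<Longrightarrow> (\<Sum>es\<in>exponents d N. c es * monomial (map f (rev [0..<d])) es x) = 0"
    and "es \<in> exponents d N"
  shows "c es = 0"
  using assms
proof (induction d arbitrary: c es)
  case 0
  obtain x where "x \<in> Z 0" using "0.prems"(1)[of 0] unfolding irreducible_closed_def by auto
  moreover have "exponents 0 N = {[]}" by (auto simp: exponents_def)
  ultimately show ?case using "0.prems"(6)[of x] "0.prems"(7) by simp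
next
  case (Suc d)
  let ?fs = "map f (rev [0..<d])"
  define g where "g e x = (\<Sum>es\<in>exponents d N. c (e # es) * monomial ?fs es x)" for e x
  have g_poly: "g e \<in> poly_funs S" for e
    unfolding g_def
    by (intro poly_funs_sum finite_exponents poly_funs.mult poly_funs.const poly_funs_monomial)
       (use Suc.prems(3) in auto)
  have rel: "(\<Sum>e<N. f d x ^ e * g e x) = 0" if "x \<in> Z (Suc d)" for x
    using Suc.prems(6)[OF that]
    by (simp add: sum_exponents_Suc g_def sum_distrib_left mult_ac)
  have zero: "\<forall>es\<in>exponents d N. c (e # es) = 0" if "e < N" for e
    using that
  proof (induction e rule: less_induct)
    case (less e)
    have g0: "g e' x = 0" if "e' < e" for e' x
      using less that unfolding g_def by (intro sum.neutral) auto
    define h where "h x = (\<Sum>e'\<in>{e..<N}. f d x ^ (e' - e) * g e' x)" for x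
    have h_poly: "h \<in> poly_funs S" unfolding h_def
      by (intro poly_funs_sum poly_funs.mult poly_funs_power Suc.prems g_poly) auto
    have fh: "f d x ^ e * h x = 0" if "x \<in> Z (Suc d)" for x
    proof -
      have "f d x ^ e * h x = (\<Sum>e'\<in>{e..<N}. f d x ^ e' * g e' x)"
        unfolding h_def sum_distrib_left
        by (intro sum.cong refl) (simp add: mult.assoc[symmetric] power_add[symmetric])
      also have "\<dots> = (\<Sum>e'<N. f d x ^ e' * g e' x)"
        by (intro sum.mono_neutral_left) (auto simp: g0)
      finally show ?thesis using rel[OF that] by simp
    qed
    obtain z where z: "z \<in> Z (Suc d)" "f d z \<noteq> 0" using Suc.prems(5)[of d] by auto
    have hz: "h x = 0" if "x \<in> Z (Suc d)" for x
      by (rule irreducible_closed_mult[of S "Z (Suc d)" "\<lambda>x. f d x ^ e" h z])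
         (use Suc.prems z fh h_poly that in \<open>auto intro: poly_funs_power\<close>)
    have "g e x = 0" if x: "x \<in> Z d" for x
    proof -
      have "h x = (\<Sum>e'\<in>{e}. f d x ^ (e' - e) * g e' x)"
        unfolding h_def
        by (rule sum.mono_neutral_right) (use less.prems Suc.prems(4)[of d x] x in auto)
      then show ?thesis using hz Suc.prems(2)[of d] x by auto
    qed
    then have "(\<Sum>es\<in>exponents d N. c (e # es) * monomial ?fs es x) = 0" if "x \<in> Z d" for x
      using that unfolding g_def by simp
    then have "c (e # es) = 0" if "es \<in> exponents d N" for es
      using Suc.IH[of "\<lambda>es. c (e # es)" es] Suc.prems(1-5) that by simp
    then show ?case by blast
  qed
  obtain e es' where "es = e # es'" "e < N" "es' \<in> exponents d N"
    using Suc.prems(7) by (auto simp: exponents_def length_Suc_conv)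
  then show ?case using zero by blast
qed

lemma monomial_mult:
  "length es = length fs \<Longrightarrow> length es' = length fs \<Longrightarrow>
   monomial fs (map2 (+) es es') x = monomial fs es x * monomial fs es' x"
proof (induction fs arbitrary: es es')
  case (Cons f fs)
  then show ?case
    by (cases es; cases es') (auto simp: power_add mult_ac)
qed simp

lemma cspan_mult:
  assumes "f \<in> cfun.span A" "g \<in> cfun.span B"
    and AB: "\<And>a b. a \<in> A \<Longrightarrow> b \<in> B \<Longrightarrow> (\<lambda>x. a x * b x) \<in> cfun.span D"
  shows "(\<lambda>x. f x * g x) \<in> cfun.span D"
  using assms(1)
proof (induction rule: cfun.span_induct_alt)
  case base
  show ?case using cfun.span_zero[of D] by (simp add: zero_fun_def)
next
  case (step c a h)
  have "(\<lambda>x. a x * g x) \<in> cfun.span D" using assms(2)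
  proof (induction rule: cfun.span_induct_alt)
    case base
    show ?case using cfun.span_zero[of D] by (simp add: zero_fun_def)
  next
    case (step c b h)
    have "cscale c (\<lambda>x. a x * b x) + (\<lambda>x. a x * h x) \<in> cfun.span D"
      using step AB[OF \<open>a \<in> A\<close>] by (intro cfun.span_add cfun.span_scale) auto
    moreover have "(\<lambda>x. a x * (cscale c b + h) x) = cscale c (\<lambda>x. a x * b x) + (\<lambda>x. a x * h x)"
      by (simp add: fun_eq_iff cscale_def algebra_simps)
    ultimately show ?case by simp
  qed
  then have "cscale c (\<lambda>x. a x * g x) + (\<lambda>x. h x * g x) \<in> cfun.span D"
    using step by (intro cfun.span_add cfun.span_scale) auto
  moreover have "(\<lambda>x. (cscale c a + h) x * g x) = cscale c (\<lambda>x. a x * g x) + (\<lambda>x. h x * g x)"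
    by (simp add: fun_eq_iff cscale_def algebra_simps)
  ultimately show ?case by simp
qed

definition bounded_polys :: "'v list \<Rightarrow> nat \<Rightarrow> (('v \<Rightarrow> complex) \<Rightarrow> complex) set" where
  "bounded_polys vs D =
     cfun.span (monomial (map (\<lambda>i x. x i) vs) ` exponents (length vs) (Suc D))"

lemma bounded_polys_mono: "D \<le> E \<Longrightarrow> bounded_polys vs D \<subseteq> bounded_polys vs E"
  unfolding bounded_polys_def by (intro cfun.span_mono image_mono) (auto simp: exponents_def)

lemma bounded_polys_const: "(\<lambda>x. c) \<in> bounded_polys vs 0"
proof -
  have "monomial (map (\<lambda>i x. x i) vs) (replicate (length vs) 0) = (\<lambda>x. 1)"
    by (induction vs) auto
  moreover have "replicate (length vs) 0 \<in> exponents (length vs) (Suc 0)"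
    by (auto simp: exponents_def)
  ultimately have "(\<lambda>x. 1) \<in> bounded_polys vs 0"
    unfolding bounded_polys_def by (metis cfun.span_base image_eqI)
  then have "cscale c (\<lambda>x. 1) \<in> bounded_polys vs 0"
    unfolding bounded_polys_def by (rule cfun.span_scale)
  then show ?thesis by (simp add: cscale_def)
qed

lemma bounded_polys_coord: "i \<in> set vs \<Longrightarrow> (\<lambda>x. x i) \<in> bounded_polys vs 1"
proof -
  assume i: "i \<in> set vs"
  have "\<exists>es\<in>exponents (length vs) 2. monomial (map (\<lambda>i x. x i) vs) es = (\<lambda>x. x i)"
    using i
  proof (induction vs)
    case (Cons v vs)
    show ?case
    proof (cases "i = v")
      case True
      have "monomial (map (\<lambda>i x. x i) vs) (replicate (length vs) 0) = (\<lambda>x. 1)"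
        by (induction vs) auto
      then show ?thesis using True
        by (intro bexI[of _ "1 # replicate (length vs) 0"]) (auto simp: exponents_def)
    next
      case False
      then obtain es where "es\<in>exponents (length vs) 2"
          "monomial (map (\<lambda>i x. x i) vs) es = (\<lambda>x. x i)" using Cons by auto
      then show ?thesis
        by (intro bexI[of _ "0 # es"]) (auto simp: exponents_def)
    qed
  qed simp
  then show ?thesis unfolding bounded_polys_def
    by (metis One_nat_def Suc_1 cfun.span_base image_eqI)
qed

lemma bounded_polys_mult:
  assumes "f \<in> bounded_polys vs D" "g \<in> bounded_polys vs E"
  shows "(\<lambda>x. f x * g x) \<in> bounded_polys vs (D + E)"
  unfolding bounded_polys_def
proof (rule cspan_mult[OF assms[unfolded bounded_polys_def]])
  let ?m = "monomial (map (\<lambda>i x. x i) vs)"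
  fix a b
  assume "a \<in> ?m ` exponents (length vs) (Suc D)" "b \<in> ?m ` exponents (length vs) (Suc E)"
  then obtain es es' where e: "a = ?m es" "b = ?m es'" "es \<in> exponents (length vs) (Suc D)"
    "es' \<in> exponents (length vs) (Suc E)" by auto
  have "map2 (+) es es' \<in> exponents (length vs) (Suc (D + E))"
  proof -
    have "x + y < Suc (D + E)" if "(x, y) \<in> set (zip es es')" for x y
      using e(3,4) set_zip_leftD[OF that] set_zip_rightD[OF that] by (force simp: exponents_def)
    then show ?thesis using e(3,4) by (auto simp: exponents_def)
  qed
  moreover have "?m (map2 (+) es es') = (\<lambda>x. a x * b x)"
    using e by (auto simp: fun_eq_iff exponents_def monomial_mult)
  ultimately show "(\<lambda>x. a x * b x) \<in> cfun.span (?m ` exponents (length vs) (Suc (D + E)))"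
    by (intro cfun.span_base image_eqI[of _ _ "map2 (+) es es'"]) simp_all
qed

lemma poly_funs_bounded:
  assumes "f \<in> poly_funs (set vs)"
  shows "\<exists>D. f \<in> bounded_polys vs D"
  using assms
proof induction
  case (add f g)
  then obtain D E where "f \<in> bounded_polys vs D" "g \<in> bounded_polys vs E" by blast
  then have "f + g \<in> bounded_polys vs (max D E)"
    using bounded_polys_mono[of D "max D E" vs] bounded_polys_mono[of E "max D E" vs]
    unfolding bounded_polys_def by (intro cfun.span_add) auto
  then show ?case by (auto simp: plus_fun_def)
next
  case (const c)
  show ?case using bounded_polys_const by (rule exI)
next
  case (coord i)
  then have "(\<lambda>x. x i) \<in> bounded_polys vs 1" by (rule bounded_polys_coord)
  then show ?case by (rule exI)
next
  case (mult f g)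
  then obtain D E where "f \<in> bounded_polys vs D" "g \<in> bounded_polys vs E" by blast
  then have "(\<lambda>x. f x * g x) \<in> bounded_polys vs (D + E)" by (rule bounded_polys_mult)
  then show ?case by (rule exI)
qed

lemma bounded_polys_power:
  "f \<in> bounded_polys vs D \<Longrightarrow> (\<lambda>x. f x ^ e) \<in> bounded_polys vs (e * D)"
proof (induction e)
  case (Suc e)
  then show ?case using bounded_polys_mult[of f vs D "\<lambda>x. f x ^ e" "e * D"] by simp
qed (simp add: bounded_polys_const)

lemma bounded_polys_monomial:
  assumes "set fs \<subseteq> bounded_polys vs D" "es \<in> exponents (length fs) N"
  shows "monomial fs es \<in> bounded_polys vs (length fs * (N * D))"
  using assms
proof (induction fs arbitrary: es)
  case Nil
  then show ?case by (simp add: bounded_polys_const)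
next
  case (Cons f fs)
  obtain e es' where e: "es = e # es'" "e < N" "es' \<in> exponents (length fs) N"
    using Cons.prems(2) by (auto simp: exponents_def length_Suc_conv)
  have "(\<lambda>x. f x ^ e) \<in> bounded_polys vs (N * D)"
    using bounded_polys_power[of f vs D e] bounded_polys_mono[of "e * D" "N * D" vs] e(2) Cons.prems(1)
    by auto
  then show ?case using bounded_polys_mult[OF _ Cons.IH[OF _ e(3)]] Cons.prems(1) e(1) by simp
qed

lemma sum_fun_apply: "(\<Sum>a\<in>A. f a) x = (\<Sum>a\<in>A. f a x)" for f :: "'a \<Rightarrow> 'b \<Rightarrow> 'c::comm_monoid_add"
  by (induction A rule: infinite_finite_induct) auto

lemma power_bound_exponent_le:
  fixes d m c :: nat
  assumes "\<And>N. N \<ge> 1 \<Longrightarrow> N ^ d \<le> (Suc (d * (N * c))) ^ m"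
  shows "d \<le> m"
proof (rule ccontr)
  assume "\<not> d \<le> m"
  define N where "N = Suc ((Suc (d * c)) ^ m)"
  have "N * N ^ m = N ^ Suc m" by simp
  also have "\<dots> \<le> N ^ d" using \<open>\<not> d \<le> m\<close> by (intro power_increasing) (auto simp: N_def)
  also have "\<dots> \<le> (Suc (d * (N * c))) ^ m" using assms[of N] by (simp add: N_def)
  also have "\<dots> \<le> (N * Suc (d * c)) ^ m"
    by (intro power_mono) (auto simp: N_def algebra_simps)
  also have "\<dots> = N ^ m * (Suc (d * c)) ^ m" by (simp only: power_mult_distrib)
  finally have "N \<le> (Suc (d * c)) ^ m" by (simp add: N_def)
  then show False by (simp add: N_def)
qed

lemma chain_length_le:
  assumes fin: "finite T" and TS: "T \<subseteq> S"
    and irr: "\<And>i. i \<le> d \<Longrightarrow> irreducible_closed S (Z i)"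
    and chain: "\<And>i. i < d \<Longrightarrow> Z i \<subset> Z (Suc i)"
    and top: "Z d \<subseteq> affine_space T"
  shows "d \<le> card T"
proof -
  obtain vs where vs: "set vs = T" "distinct vs" using finite_distinct_list[OF fin] by auto
  have sub: "Z i \<subseteq> affine_space T" if "i \<le> d" for i
    using that
  proof (induction i rule: inc_induct)
    case base
    show ?case by (rule top)
  next
    case (step i)
    then show ?case using chain[of i] by auto
  qed
  have "\<exists>f. f \<in> poly_funs T \<and> (\<forall>x\<in>Z i. f x = 0) \<and> (\<exists>x\<in>Z (Suc i). f x \<noteq> 0)" if i: "i < d" for i
  proof -
    obtain F where F: "F \<subseteq> poly_funs S" "Z i = {x \<in> affine_space S. \<forall>f\<in>F. f x = 0}"
      using irr[of i] i unfolding irreducible_closed_def zariski_closed_def by auto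
    obtain x where x: "x \<in> Z (Suc i)" "x \<notin> Z i" using chain[OF i] by auto
    have "x \<in> affine_space S"
      using x(1) irr[of "Suc i"] i unfolding irreducible_closed_def zariski_closed_def by auto
    then obtain f where f: "f \<in> F" "f x \<noteq> 0" using F x(2) by auto
    then obtain g where g: "g \<in> poly_funs T" "\<forall>x\<in>affine_space T. f x = g x"
      using poly_funs_restrict F(1) by blast
    have "g y = 0" if y: "y \<in> Z i" for y
    proof -
      have "f y = 0" using y F(2) f(1) by simp
      moreover have "y \<in> affine_space T" using y sub[of i] i by auto
      ultimately show ?thesis using g(2) by simp
    qed
    moreover have "g x \<noteq> 0" using f(2) g(2) x(1) sub[of "Suc i"] i by auto
    ultimately show ?thesis using g(1) x(1) by blast
  qed
  then have "\<exists>f. \<forall>i. i < d \<longrightarrow> f i \<in> poly_funs T \<and> (\<forall>x\<in>Z i. f i x = 0) \<and> (\<exists>x\<in>Z (Suc i). f i x \<noteq> 0)"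
    by (intro choice) blast
  then obtain f where f: "\<And>i. i < d \<Longrightarrow> f i \<in> poly_funs T"
      "\<And>i x. i < d \<Longrightarrow> x \<in> Z i \<Longrightarrow> f i x = 0" "\<And>i. i < d \<Longrightarrow> \<exists>x\<in>Z (Suc i). f i x \<noteq> 0"
    by auto
  have "\<exists>D. f i \<in> bounded_polys vs D" if "i < d" for i
    using poly_funs_bounded[of "f i" vs] f(1)[OF that] vs(1) by simp
  then obtain D where D: "\<And>i. i < d \<Longrightarrow> f i \<in> bounded_polys vs (D i)" by metis
  define c where "c = (\<Sum>i<d. D i)"
  have fc: "f i \<in> bounded_polys vs c" if "i < d" for i
  proof -
    have "D i \<le> c" unfolding c_def using that by (intro member_le_sum) auto
    then show ?thesis using D[OF that] bounded_polys_mono[of "D i" c vs] by blast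
  qed
  let ?fs = "map f (rev [0..<d])"
  let ?B = "\<lambda>N. monomial (map (\<lambda>i x. x i) vs) ` exponents (length vs) (Suc (d * (N * c)))"
  have "N ^ d \<le> Suc (d * (N * c)) ^ card T" for N
  proof -
    have indep: "c' es = 0"
      if "\<forall>x\<in>Z d. (\<Sum>es\<in>exponents d N. c' es * monomial ?fs es x) = 0" "es \<in> exponents d N" for c' es
    proof (rule monomials_linearly_independent[where d=d and S=S and Z=Z and f=f and N=N and c=c'])
      show "f i \<in> poly_funs S" if "i < d" for i using f(1)[OF that] TS by (rule poly_funs_mono)
      show "Z i \<subseteq> Z (Suc i)" if "i < d" for i using chain[OF that] by (rule psubset_imp_subset)
    qed (fact irr, fact f(2), fact f(3), use that in auto)
    have inj: "inj_on (monomial ?fs) (exponents d N)"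
    proof (rule inj_onI, rule ccontr)
      fix es es'
      assume e: "es \<in> exponents d N" "es' \<in> exponents d N" "monomial ?fs es = monomial ?fs es'" "es \<noteq> es'"
      define c' where "c' = (\<lambda>_. 0 :: complex)(es := 1, es' := -1)"
      have "(\<Sum>a\<in>exponents d N. c' a * monomial ?fs a x) = 0" for x
      proof -
        have "(\<Sum>a\<in>exponents d N. c' a * monomial ?fs a x) = (\<Sum>a\<in>{es, es'}. c' a * monomial ?fs a x)"
          by (rule sum.mono_neutral_right) (use e in \<open>auto simp: c'_def\<close>)
        also have "\<dots> = 0" using e(3,4) by (simp add: c'_def)
        finally show ?thesis .
      qed
      then have "c' es = 0" using indep e(1) by blast
      then show False using e(4) by (simp add: c'_def)
    qed
    have "\<not> cfun.dependent (monomial ?fs ` exponents d N)"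
    proof
      assume "cfun.dependent (monomial ?fs ` exponents d N)"
      then obtain u where u: "\<exists>v\<in>monomial ?fs ` exponents d N. u v \<noteq> 0"
          "(\<Sum>v\<in>monomial ?fs ` exponents d N. cscale (u v) v) = 0"
        using cfun.dependent_finite[of "monomial ?fs ` exponents d N"] by auto
      have "(\<Sum>es\<in>exponents d N. u (monomial ?fs es) * monomial ?fs es x) = 0" for x
        using fun_cong[OF u(2), of x] unfolding sum.reindex[OF inj]
        by (simp add: sum_fun_apply cscale_def)
      then show False using indep[of "\<lambda>es. u (monomial ?fs es)"] u(1) by blast
    qed
    moreover have "monomial ?fs ` exponents d N \<subseteq> cfun.span (?B N)"
    proof
      fix m assume "m \<in> monomial ?fs ` exponents d N"
      then obtain es where es: "m = monomial ?fs es" "es \<in> exponents d N" by blast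
      have "monomial ?fs es \<in> bounded_polys vs (length ?fs * (N * c))"
        by (rule bounded_polys_monomial) (use fc es(2) in auto)
      then show "m \<in> cfun.span (?B N)" using es(1) by (simp add: bounded_polys_def)
    qed
    ultimately have "card (monomial ?fs ` exponents d N) \<le> card (?B N)"
      using cfun.independent_span_bound[of "?B N"] by simp
    also have "\<dots> \<le> card (exponents (length vs) (Suc (d * (N * c))))" by (rule card_image_le) simp
    finally show ?thesis using card_image[OF inj] vs distinct_card[of vs] by simp
  qed
  then show ?thesis by (intro power_bound_exponent_le[of d c])
qed

definition unit_fun :: "'v \<Rightarrow> 'v \<Rightarrow> complex" where
  "unit_fun i = (\<lambda>j. if j = i then 1 else 0)"

lemma subspace_affine_space: "cfun.subspace (affine_space T)"
  unfolding cfun.subspace_def by (auto simp: affine_space_def cscale_def)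

lemma span_unit_fun:
  assumes "finite T" shows "cfun.span (unit_fun ` T) = affine_space T"
proof
  show "cfun.span (unit_fun ` T) \<subseteq> affine_space T"
    by (rule cfun.span_minimal[OF _ subspace_affine_space]) (auto simp: affine_space_def unit_fun_def)
  show "affine_space T \<subseteq> cfun.span (unit_fun ` T)"
  proof
    fix x assume "x \<in> affine_space T"
    then have "x = (\<Sum>i\<in>T. cscale (x i) (unit_fun i))"
      using assms by (auto simp: fun_eq_iff sum_fun_apply cscale_def unit_fun_def affine_space_def
          if_distrib cong: if_cong)
    also have "\<dots> \<in> cfun.span (unit_fun ` T)"
      by (intro cfun.span_sum cfun.span_scale cfun.span_base) auto
    finally show "x \<in> cfun.span (unit_fun ` T)" .
  qed
qed

lemma inj_unit_fun: "inj_on unit_fun T"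
  by (rule inj_onI) (metis unit_fun_def zero_neq_one)

lemma independent_unit_fun:
  assumes "finite T" shows "\<not> cfun.dependent (unit_fun ` T)"
proof
  assume "cfun.dependent (unit_fun ` T)"
  then obtain u where u: "\<exists>v\<in>unit_fun ` T. u v \<noteq> 0" "(\<Sum>v\<in>unit_fun ` T. cscale (u v) v) = 0"
    using cfun.dependent_finite[of "unit_fun ` T"] assms by auto
  have "u (unit_fun i) = 0" if "i \<in> T" for i
  proof -
    have "(\<Sum>j\<in>T. cscale (u (unit_fun j)) (unit_fun j)) i = 0"
      using fun_cong[OF u(2), of i] by (simp add: sum.reindex[OF inj_unit_fun])
    then show ?thesis using that assms
      by (simp add: sum_fun_apply cscale_def unit_fun_def if_distrib cong: if_cong)
  qed
  then show False using u(1) by blast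
qed

lemma dim_eq_card_if_span:
  assumes "finite T" "unit_fun ` T \<subseteq> V" "V \<subseteq> affine_space T"
  shows "cfun.dim V = card T"
proof -
  have "cfun.span V = affine_space T"
    using cfun.span_minimal[OF assms(3) subspace_affine_space] cfun.span_mono[OF assms(2)]
      span_unit_fun[OF assms(1)] by auto
  then have "cfun.dim V = card (unit_fun ` T)"
    using span_unit_fun[OF assms(1)] independent_unit_fun[OF assms(1)]
    by (intro cfun.dim_eq_card) auto
  then show ?thesis by (simp add: card_image[OF inj_unit_fun])
qed

lemma dim_tangent_space:
  assumes "finite S" "T \<subseteq> S" "X \<subseteq> affine_space T"
    and lines: "\<And>i t. i \<in> T \<Longrightarrow> (\<lambda>j. p j + t * unit_fun i j) \<in> X"
  shows "cfun.dim (tangent_space S X p) = card T"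
proof (rule dim_eq_card_if_span)
  show "finite T" using assms finite_subset by blast
  show "unit_fun ` T \<subseteq> tangent_space S X p"
  proof
    fix v assume "v \<in> unit_fun ` T"
    then obtain i where i: "i \<in> T" "v = unit_fun i" by auto
    have "((\<lambda>t. f (\<lambda>j. p j + t * v j)) has_field_derivative 0) (at 0)" if "f \<in> vanishing_ideal S X" for f
    proof -
      have "(\<lambda>t. f (\<lambda>j. p j + t * v j)) = (\<lambda>t. 0)"
        using that lines[OF i(1)] i(2) by (auto simp: vanishing_ideal_def fun_eq_iff)
      then show ?thesis by simp
    qed
    then show "v \<in> tangent_space S X p"
      using i assms(2) by (auto simp: tangent_space_def affine_space_def unit_fun_def)
  qed
  show "tangent_space S X p \<subseteq> affine_space T"
  proof
    fix v assume v: "v \<in> tangent_space S X p"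
    have "v s = 0" if s: "s \<notin> T" for s
    proof (cases "s \<in> S")
      case True
      have "(\<lambda>x. x s) \<in> vanishing_ideal S X"
        using True s assms(3) by (auto simp: vanishing_ideal_def affine_space_def intro: poly_funs.coord)
      then have "((\<lambda>t. p s + t * v s) has_field_derivative 0) (at 0)"
        using v unfolding tangent_space_def by fastforce
      moreover have "((\<lambda>t. p s + t * v s) has_field_derivative v s) (at 0)"
        by (auto intro!: derivative_eq_intros)
      ultimately show ?thesis by (rule DERIV_unique[symmetric])
    next
      case False
      then show ?thesis using v by (auto simp: tangent_space_def affine_space_def)
    qed
    then show "v \<in> affine_space T" by (simp add: affine_space_def)
  qed
qed

lemma local_dim_affine_space:
  assumes "finite S" "T \<subseteq> S" "p \<in> affine_space T"
  shows "local_dim S (affine_space T) p = enat (card T)"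
proof (rule antisym)
  have fin: "finite T" using assms finite_subset by blast
  show "local_dim S (affine_space T) p \<le> enat (card T)"
    unfolding local_dim_def
  proof (rule SUP_least, clarify)
    fix d and Z :: "nat \<Rightarrow> _"
    assume "\<forall>i\<le>d. irreducible_closed S (Z i) \<and> p \<in> Z i \<and> Z i \<subseteq> affine_space T"
      "\<forall>i<d. Z i \<subset> Z (Suc i)"
    then have "d \<le> card T" by (intro chain_length_le[OF fin assms(2), of d Z]) auto
    then show "enat d \<le> enat (card T)" by simp
  qed
  obtain vs where vs: "set vs = T" "distinct vs" using finite_distinct_list[OF fin] by auto
  have len: "length vs = card T" using vs distinct_card by metis
  have pS: "p \<in> affine_space S" using assms by (auto simp: affine_space_def)
  define Z where "Z i = {x \<in> affine_space S. \<forall>s\<in>S - set (take i vs). x s = p s}" for i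
  have "irreducible_closed S (Z i)" for i
    unfolding Z_def by (rule irreducible_closed_slice[OF _ pS]) auto
  moreover have "p \<in> Z i" for i using pS by (auto simp: Z_def)
  moreover have "Z i \<subseteq> affine_space T" for i
  proof
    fix x assume x: "x \<in> Z i"
    have "x s = 0" if s: "s \<notin> T" for s
    proof (cases "s \<in> S")
      case True
      then have "x s = p s" using x s set_take_subset[of i vs] vs(1) by (auto simp: Z_def)
      then show ?thesis using assms(3) s by (simp add: affine_space_def)
    next
      case False
      then show ?thesis using x by (simp add: Z_def affine_space_def)
    qed
    then show "x \<in> affine_space T" by (simp add: affine_space_def)
  qed
  moreover have "Z i \<subset> Z (Suc i)" if i: "i < card T" for i
  proof -
    have eq: "set (take (Suc i) vs) = insert (vs ! i) (set (take i vs))"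
      using i len by (simp add: take_Suc_conv_app_nth)
    have iT: "vs ! i \<in> T" using i len vs(1) nth_mem by metis
    have new: "vs ! i \<notin> set (take i vs)"
      using i len vs(2) by (auto simp: in_set_conv_nth nth_eq_iff_index_eq)
    define x where "x = p(vs ! i := p (vs ! i) + 1)"
    have "x \<in> Z (Suc i)" using pS iT assms(2) eq by (auto simp: Z_def x_def affine_space_def)
    moreover have "x \<notin> Z i" using new iT assms(2) by (auto simp: Z_def x_def)
    moreover have "Z i \<subseteq> Z (Suc i)" unfolding Z_def eq by auto
    ultimately show ?thesis by blast
  qed
  ultimately have "card T \<in> {d. \<exists>Z. (\<forall>i\<le>d. irreducible_closed S (Z i) \<and> p \<in> Z i \<and> Z i \<subseteq> affine_space T) \<and>
                      (\<forall>i<d. Z i \<subset> Z (Suc i))}" by blast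
  then show "enat (card T) \<le> local_dim S (affine_space T) p"
    unfolding local_dim_def by (rule SUP_upper)
qed

lemma smooth_affine_affine_space:
  assumes "finite S" "T \<subseteq> S"
  shows "smooth_affine S (affine_space T)"
  unfolding smooth_affine_def
proof
  fix p assume p: "p \<in> affine_space T"
  then have "(\<lambda>j. p j + t * unit_fun i j) \<in> affine_space T" if "i \<in> T" for i t
    using that by (auto simp: affine_space_def unit_fun_def)
  then show "enat (cfun.dim (tangent_space S (affine_space T) p)) = local_dim S (affine_space T) p"
    using dim_tangent_space[OF assms, of "affine_space T" p] local_dim_affine_space[OF assms p] by simp
qed

lemma eq_affine_space_if_full_dim:
  assumes "finite S" "T \<subseteq> S" "X \<subseteq> affine_space T" "p \<in> X"
    and dim: "local_dim S X p = enat (card T)"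
  shows "X = affine_space T"
proof (cases "card T = 0")
  case True
  moreover have "finite T" using assms(1,2) by (rule finite_subset[rotated])
  ultimately have "T = {}" by simp
  then have "affine_space T = {\<lambda>_. 0}" by (auto simp: affine_space_def)
  then show ?thesis using assms by auto
next
  case False
  have fin: "finite T" using assms finite_subset by blast
  define D where "D = {d. \<exists>Z. (\<forall>i\<le>d. irreducible_closed S (Z i) \<and> p \<in> Z i \<and> Z i \<subseteq> X) \<and>
                      (\<forall>i<d. Z i \<subset> Z (Suc i))}"
  have "\<exists>d\<in>D. card T \<le> d"
  proof (rule ccontr)
    assume no: "\<not> ?thesis"
    have "enat d \<le> enat (card T - 1)" if "d \<in> D" for d
    proof -
      have "\<not> card T \<le> d" using no that by blast
      then show ?thesis by simp
    qed
    then have "local_dim S X p \<le> enat (card T - 1)"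
      unfolding local_dim_def D_def[symmetric] by (rule SUP_least)
    then show False using False dim by simp
  qed
  then obtain d where d: "d \<in> D" "card T \<le> d" by blast
  from d(1) obtain Z where Z: "\<And>i. i \<le> d \<Longrightarrow> irreducible_closed S (Z i)"
      "\<And>i. i \<le> d \<Longrightarrow> Z i \<subseteq> X" "\<And>i. i < d \<Longrightarrow> Z i \<subset> Z (Suc i)"
    unfolding D_def by auto
  have "affine_space T \<subseteq> X"
  proof (rule ccontr)
    assume "\<not> affine_space T \<subseteq> X"
    then have "Z d \<subset> affine_space T" using Z(2)[of d] assms(3) by auto
    define Z' where "Z' = Z(Suc d := affine_space T)"
    have "Suc d \<le> card T"
    proof (rule chain_length_le[OF fin assms(2), of "Suc d" Z'])
      show "irreducible_closed S (Z' i)" if "i \<le> Suc d" for i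
        using that Z(1)[of i] irreducible_closed_affine_space[OF assms(2)]
        by (cases "i = Suc d") (auto simp: Z'_def)
      show "Z' i \<subset> Z' (Suc i)" if "i < Suc d" for i
        using that Z(3)[of i] \<open>Z d \<subset> affine_space T\<close> by (cases "i = d") (simp_all add: Z'_def)
    qed (simp add: Z'_def)
    then show False using d(2) by simp
  qed
  then show ?thesis using assms(3) by auto
qed

section \<open>Charts of positroid varieties\<close>

definition chart_row :: "nat set \<Rightarrow> (nat \<times> nat \<Rightarrow> complex) \<Rightarrow> nat \<Rightarrow> nat \<Rightarrow> complex" where
  "chart_row J x i j = (if j \<in> J then (if j = i then 1 else 0) else x (i, j))"

definition chart_matrix :: "nat set \<Rightarrow> (nat \<times> nat \<Rightarrow> complex) \<Rightarrow> nat \<Rightarrow> nat \<Rightarrow> complex" where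
  "chart_matrix J x r = chart_row J x (sorted_list_of_set J ! r)"

lemma nth_image_sorted_list:
  "finite J \<Longrightarrow> (\<lambda>r. sorted_list_of_set J ! r) ` {..<card J} = J"
  by (metis length_sorted_list_of_set lessThan_atLeast0 nth_image set_sorted_list_of_set
      take_all_iff order_refl)

lemma sorted_list_of_set_nth_in:
  "finite J \<Longrightarrow> r < card J \<Longrightarrow> sorted_list_of_set J ! r \<in> J"
  using nth_image_sorted_list[of J] by blast

lemma sorted_list_of_set_index:
  "finite J \<Longrightarrow> i \<in> J \<Longrightarrow> \<exists>r<card J. sorted_list_of_set J ! r = i"
  using nth_image_sorted_list[of J] by (metis imageE lessThan_iff)

lemma sorted_list_of_set_nth_inj:
  "r < card J \<Longrightarrow> s < card J \<Longrightarrow> sorted_list_of_set J ! r = sorted_list_of_set J ! s \<longleftrightarrow> r = s"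
  by (simp add: nth_eq_iff_index_eq)

lemma chart_matrix_image:
  assumes "finite J" shows "chart_matrix J x ` {..<card J} = chart_row J x ` J"
  using nth_image_sorted_list[OF assms] unfolding chart_matrix_def image_image[symmetric] by simp

lemma inj_on_chart_row: "inj_on (chart_row J x) J"
  by (rule inj_onI) (metis chart_row_def zero_neq_one)

lemma chart_point_eq: "chart_point J x = cfun.span (chart_row J x ` J)"
  unfolding chart_point_def chart_row_def by simp

lemma independent_chart_row:
  assumes "finite J" shows "\<not> cfun.dependent (chart_row J x ` J)"
proof
  assume "cfun.dependent (chart_row J x ` J)"
  then obtain u where u: "\<exists>v\<in>chart_row J x ` J. u v \<noteq> 0" "(\<Sum>v\<in>chart_row J x ` J. cscale (u v) v) = 0"
    using cfun.dependent_finite[of "chart_row J x ` J"] assms by auto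
  have "u (chart_row J x i) = 0" if "i \<in> J" for i
  proof -
    have "(\<Sum>j\<in>J. cscale (u (chart_row J x j)) (chart_row J x j)) i = 0"
      using fun_cong[OF u(2), of i] by (simp add: sum.reindex[OF inj_on_chart_row])
    moreover have "(\<Sum>j\<in>J. cscale (u (chart_row J x j)) (chart_row J x j)) i =
        (\<Sum>j\<in>J. if i = j then u (chart_row J x j) else 0)"
      using that by (auto simp: sum_fun_apply cscale_def chart_row_def intro: sum.cong)
    ultimately show ?thesis using that assms by simp
  qed
  then show False using u(1) by blast
qed

lemma chart_point_in_grassmannian:
  assumes J: "J \<in> ksubsets n k" and x: "x \<in> affine_space (chart_index n J)"
  shows "chart_point J x \<in> grassmannian n k"
proof -
  have fin: "finite J" and k: "card J = k" using J finite_subset by (auto simp: ksubsets_def)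
  have "chart_row J x ` J \<subseteq> affine_space {1..n}"
    using J x by (auto simp: affine_space_def chart_row_def ksubsets_def chart_index_def)
  then have "chart_point J x \<subseteq> affine_space {1..n}"
    unfolding chart_point_eq by (intro cfun.span_minimal subspace_affine_space)
  moreover have "cfun.dim (chart_point J x) = k"
    unfolding chart_point_eq cfun.dim_span_eq_card_independent[OF independent_chart_row[OF fin]]
    by (simp add: card_image[OF inj_on_chart_row] k)
  ultimately show ?thesis by (simp add: grassmannian_def chart_point_eq)
qed

lemma plucker_eq_0_if_span:
  assumes J: "finite J" "card J = k"
    and A: "\<And>r. r < k \<Longrightarrow> A r \<in> chart_point J x" and zero: "plucker k (chart_matrix J x) I = 0"
  shows "plucker k A I = 0"
proof -
  have "\<exists>g. A r = (\<Sum>s<k. cscale (g s) (chart_matrix J x s))" if r: "r < k" for r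
  proof -
    have inj: "inj_on (chart_matrix J x) {..<k}"
    proof (rule inj_onI)
      fix r s assume rs: "r \<in> {..<k}" "s \<in> {..<k}" "chart_matrix J x r = chart_matrix J x s"
      then have "sorted_list_of_set J ! r = sorted_list_of_set J ! s"
        using J by (intro inj_onD[OF inj_on_chart_row[of J x]])
          (auto simp: chart_matrix_def sorted_list_of_set_nth_in)
      then show "r = s" using rs J by (simp add: sorted_list_of_set_nth_inj)
    qed
    have "A r \<in> cfun.span (chart_matrix J x ` {..<k})"
      using A[OF r] J chart_matrix_image[of J x] by (simp add: chart_point_eq)
    then obtain u where "A r = (\<Sum>v\<in>chart_matrix J x ` {..<k}. cscale (u v) v)"
      by (auto simp: cfun.span_finite)
    then have "A r = (\<Sum>s<k. cscale (u (chart_matrix J x s)) (chart_matrix J x s))"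
      by (simp add: sum.reindex[OF inj])
    then show ?thesis by (rule exI[of _ "\<lambda>s. u (chart_matrix J x s)"])
  qed
  then have "\<forall>r. \<exists>g. r < k \<longrightarrow> A r = (\<Sum>s<k. cscale (g s) (chart_matrix J x s))" by blast
  then obtain g where g: "\<And>r. r < k \<Longrightarrow> A r = (\<Sum>s<k. cscale (g r s) (chart_matrix J x s))"
    using choice[of "\<lambda>r g. r < k \<longrightarrow> A r = (\<Sum>s<k. cscale (g s) (chart_matrix J x s))"] by auto
  let ?B = "mat k k (\<lambda>(r, c). chart_matrix J x r (sorted_list_of_set I ! c))"
  have "mat k k (\<lambda>(r, c). A r (sorted_list_of_set I ! c)) = mat k k (\<lambda>(r, s). g r s) * ?B"
    by (rule eq_matI)
       (auto simp: g sum_fun_apply cscale_def scalar_prod_def lessThan_atLeast0)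
  then show ?thesis using zero det_mult[of "mat k k (\<lambda>(r, s). g r s)" k ?B] by (simp add: plucker_def)
qed

lemma chart_point_in_variety_iff:
  assumes J: "J \<in> ksubsets n k" and x: "x \<in> affine_space (chart_index n J)"
  shows "chart_point J x \<in> positroid_variety n k M \<longleftrightarrow>
    (\<forall>I \<in> ksubsets n k - M. plucker k (chart_matrix J x) I = 0)"
proof -
  have fin: "finite J" and k: "card J = k" using J finite_subset by (auto simp: ksubsets_def)
  have span: "cfun.span (chart_matrix J x ` {..<k}) = chart_point J x"
    using chart_matrix_image[OF fin, of x] k by (simp add: chart_point_eq)
  have "plucker k A I = 0" if "plucker k (chart_matrix J x) I = 0"
    "cfun.span (A ` {..<k}) = chart_point J x" for A I
    using plucker_eq_0_if_span[OF fin k _ that(1), of A] that(2) cfun.span_base[of _ "A ` {..<k}"] by auto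
  then show ?thesis using chart_point_in_grassmannian[OF J x] span
    unfolding positroid_variety_def by blast
qed

lemma matching_if_plucker_neq_0:
  assumes J: "J \<in> ksubsets n k" and I: "I \<in> ksubsets n k"
    and neq: "plucker k (chart_matrix J x) I \<noteq> 0"
  shows "\<exists>\<sigma>. bij_betw \<sigma> (J - I) (I - J) \<and> (\<forall>i\<in>J - I. x (i, \<sigma> i) \<noteq> 0)"
proof -
  have fin: "finite J" "finite I" and k: "card J = k" "card I = k"
    using J I finite_subset by (auto simp: ksubsets_def)
  let ?J = "\<lambda>r. sorted_list_of_set J ! r" and ?I = "\<lambda>r. sorted_list_of_set I ! r"
  have "\<exists>p. p permutes {0..<k} \<and> (\<Prod>r=0..<k. chart_matrix J x r (?I (p r))) \<noteq> 0"
  proof (rule ccontr)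
    assume no: "\<not> ?thesis"
    have "plucker k (chart_matrix J x) I = 0"
      unfolding plucker_def det_def'[OF mat_carrier]
    proof (rule sum.neutral, clarify)
      fix p assume p: "p permutes {0..<k}"
      then have "(\<Prod>r=0..<k. mat k k (\<lambda>(r, c). chart_matrix J x r (?I c)) $$ (r, p r)) =
        (\<Prod>r=0..<k. chart_matrix J x r (?I (p r)))"
        using permutes_in_image[OF p] by (intro prod.cong) auto
      then show "signof p * (\<Prod>r=0..<k. mat k k (\<lambda>(r, c). chart_matrix J x r (?I c)) $$ (r, p r)) = 0"
        using no p by simp
    qed
    then show False using neq by simp
  qed
  then obtain p where p: "p permutes {0..<k}" "\<And>r. r < k \<Longrightarrow> chart_matrix J x r (?I (p r)) \<noteq> 0"
    by auto
  have "\<exists>r<k. ?J r = i" if "i \<in> J" for i using sorted_list_of_set_index[OF fin(1) that] k by simp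
  then obtain idx where idx: "\<And>i. i \<in> J \<Longrightarrow> idx i < k \<and> ?J (idx i) = i" by metis
  define \<sigma> where "\<sigma> i = ?I (p (idx i))" for i
  have pk: "p r < k" if "r < k" for r using permutes_in_image[OF p(1), of r] that by simp
  have nz: "chart_row J x i (\<sigma> i) \<noteq> 0" if "i \<in> J" for i
    using p(2)[of "idx i"] idx[OF that] by (simp add: \<sigma>_def chart_matrix_def)
  have into: "\<sigma> i \<in> I" if "i \<in> J" for i
    using idx[OF that] pk k fin by (simp add: \<sigma>_def sorted_list_of_set_nth_in)
  have inj: "inj_on \<sigma> J"
  proof (rule inj_onI)
    fix i i' assume "i \<in> J" "i' \<in> J" "\<sigma> i = \<sigma> i'"
    then have "p (idx i) = p (idx i')"
      using idx pk k sorted_list_of_set_nth_inj[of "p (idx i)" I "p (idx i')"] by (simp add: \<sigma>_def)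
    then have "idx i = idx i'" using p(1) by (metis permutes_inj injD)
    then show "i = i'" using idx \<open>i \<in> J\<close> \<open>i' \<in> J\<close> by metis
  qed
  have sub: "\<sigma> i \<in> I - J \<and> x (i, \<sigma> i) \<noteq> 0" if "i \<in> J - I" for i
    using nz[of i] into[of i] that by (auto simp: chart_row_def split: if_splits)
  have "card (J - I) = card (I - J)"
    using k fin by (metis card_Diff_subset_Int Int_commute finite_Int)
  then have "bij_betw \<sigma> (J - I) (I - J)"
    unfolding bij_betw_def using sub inj fin
    by (metis (no_types, lifting) card_image card_subset_eq finite_Diff image_subsetI inj_on_diff)
  then show ?thesis using sub by blast
qed

lemma plucker_neq_0_if_unique_matching:
  assumes J: "J \<in> ksubsets n k" and I: "I \<in> ksubsets n k"
    and \<sigma>: "bij_betw \<sigma> (J - I) (I - J)" "\<And>i. i \<in> J - I \<Longrightarrow> x (i, \<sigma> i) \<noteq> 0"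
    and uniq: "\<And>i j. i \<in> J - I \<Longrightarrow> j \<in> I - J \<Longrightarrow> j \<noteq> \<sigma> i \<Longrightarrow> x (i, j) = 0"
  shows "plucker k (chart_matrix J x) I \<noteq> 0"
proof
  have fin: "finite J" "finite I" and k: "card J = k" "card I = k"
    using J I finite_subset by (auto simp: ksubsets_def)
  let ?J = "\<lambda>r. sorted_list_of_set J ! r" and ?I = "\<lambda>r. sorted_list_of_set I ! r"
  let ?A = "mat k k (\<lambda>(r, c). chart_matrix J x r (?I c))"
  assume "plucker k (chart_matrix J x) I = 0"
  then obtain v where v: "v \<in> carrier_vec k" "v \<noteq> 0\<^sub>v k" "?A *\<^sub>v v = 0\<^sub>v k"
    unfolding plucker_def using det_0_iff_vec_prod_zero[of ?A k] by auto
  have row: "(\<Sum>c<k. chart_row J x i (?I c) * v $ c) = 0" if i: "i \<in> J" for i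
  proof -
    obtain r where r: "r < k" "?J r = i" using sorted_list_of_set_index[OF fin(1) i] k by auto
    have "(?A *\<^sub>v v) $ r = 0" using r v(3) by simp
    then show ?thesis using r v(1)
      by (simp add: scalar_prod_def chart_matrix_def lessThan_atLeast0)
  qed
  have zero1: "v $ c = 0" if c: "c < k" "?I c \<notin> J" for c
  proof -
    have "?I c \<in> I - J" using c k fin sorted_list_of_set_nth_in[of I c] by simp
    then obtain i where i: "i \<in> J - I" "\<sigma> i = ?I c" using \<sigma>(1) by (metis bij_betwE bij_betw_imp_surj_on imageE)
    have "chart_row J x i (?I c') * v $ c' = 0" if c': "c' < k" "c' \<noteq> c" for c'
    proof -
      have "?I c' \<in> I" "?I c' \<noteq> ?I c"
        using c' c k fin sorted_list_of_set_nth_in[of I c'] sorted_list_of_set_nth_inj[of c' I c] by auto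
      then have "chart_row J x i (?I c') = 0" using i uniq[of i "?I c'"] by (auto simp: chart_row_def)
      then show ?thesis by simp
    qed
    then have "(\<Sum>c'<k. chart_row J x i (?I c') * v $ c') = (\<Sum>c'\<in>{c}. chart_row J x i (?I c') * v $ c')"
      using c by (intro sum.mono_neutral_right) auto
    then have "x (i, \<sigma> i) * v $ c = 0" using row[of i] i c by (simp add: chart_row_def)
    then show ?thesis using \<sigma>(2)[OF i(1)] by simp
  qed
  have zero2: "v $ c = 0" if c: "c < k" "?I c \<in> J" for c
  proof -
    have "chart_row J x (?I c) (?I c') * v $ c' = 0" if c': "c' < k" "c' \<noteq> c" for c'
      using zero1[of c'] c' c k sorted_list_of_set_nth_inj[of c' I c] by (auto simp: chart_row_def)
    then have "(\<Sum>c'<k. chart_row J x (?I c) (?I c') * v $ c') = (\<Sum>c'\<in>{c}. chart_row J x (?I c) (?I c') * v $ c')"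
      using c by (intro sum.mono_neutral_right) auto
    then show ?thesis using row[OF c(2)] c by (simp add: chart_row_def)
  qed
  have "v = 0\<^sub>v k" using v(1) zero1 zero2 by (intro eq_vecI) auto
  then show False using v(2) by simp
qed

definition exchange_edges :: "nat \<Rightarrow> nat set set \<Rightarrow> nat set \<Rightarrow> (nat \<times> nat) set" where
  "exchange_edges n M J = {(i, j) \<in> chart_index n J. insert j (J - {i}) \<in> M}"

definition chart_variety :: "nat \<Rightarrow> nat \<Rightarrow> nat set set \<Rightarrow> nat set \<Rightarrow> (nat \<times> nat \<Rightarrow> complex) set" where
  "chart_variety n k M J =
     {x \<in> affine_space (chart_index n J). chart_point J x \<in> positroid_variety n k M}"

lemma finite_chart_index: "J \<in> ksubsets n k \<Longrightarrow> finite (chart_index n J)"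
  by (auto simp: chart_index_def ksubsets_def intro: finite_subset)

lemma exchange_edges_subset: "exchange_edges n M J \<subseteq> chart_index n J"
  by (auto simp: exchange_edges_def)

lemma exchange_in_ksubsets:
  assumes "J \<in> ksubsets n k" "i \<in> J" "j \<in> {1..n} - J"
  shows "insert j (J - {i}) \<in> ksubsets n k"
proof -
  have "finite J" using assms by (auto simp: ksubsets_def intro: finite_subset)
  then show ?thesis using assms card_Suc_Diff1[of J i] by (auto simp: ksubsets_def)
qed

lemma chart_variety_subset:
  assumes J: "J \<in> ksubsets n k"
  shows "chart_variety n k M J \<subseteq> affine_space (exchange_edges n M J)"
proof
  fix x assume x: "x \<in> chart_variety n k M J"
  then have xa: "x \<in> affine_space (chart_index n J)" by (simp add: chart_variety_def)
  have "x (i, j) = 0" if ij: "(i, j) \<notin> exchange_edges n M J" for i j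
  proof (rule ccontr)
    assume nz: "x (i, j) \<noteq> 0"
    then have "(i, j) \<in> chart_index n J" using xa by (auto simp: affine_space_def)
    then have i: "i \<in> J" "j \<in> {1..n} - J" by (auto simp: chart_index_def)
    let ?I = "insert j (J - {i})"
    have I: "?I \<in> ksubsets n k - M"
      using exchange_in_ksubsets[OF J i] ij i by (auto simp: exchange_edges_def chart_index_def)
    have sets: "J - ?I = {i}" "?I - J = {j}" using i by auto
    have "plucker k (chart_matrix J x) ?I \<noteq> 0"
    proof (rule plucker_neq_0_if_unique_matching[OF J, where \<sigma> = "\<lambda>_. j"])
      show "?I \<in> ksubsets n k" using I by simp
    qed (use sets nz in \<open>auto simp: bij_betw_def\<close>)
    then show False
      using x I chart_point_in_variety_iff[OF J xa, of M] by (auto simp: chart_variety_def)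
  qed
  then show "x \<in> affine_space (exchange_edges n M J)" by (auto simp: affine_space_def)
qed

lemma smooth_if_matching_closed:
  assumes "M \<subseteq> ksubsets n k"
    and closed: "\<And>J I \<sigma>. J \<in> M \<Longrightarrow> I \<in> ksubsets n k \<Longrightarrow> bij_betw \<sigma> (J - I) (I - J) \<Longrightarrow>
       (\<And>i. i \<in> J - I \<Longrightarrow> insert (\<sigma> i) (J - {i}) \<in> M) \<Longrightarrow> I \<in> M"
  shows "smooth_in_grassmannian n k (positroid_variety n k M)"
proof -
  have "smooth_affine (chart_index n J) (chart_variety n k M J)" if J: "J \<in> ksubsets n k" for J
  proof (cases "J \<in> M")
    case True
    have "x \<in> chart_variety n k M J" if x: "x \<in> affine_space (exchange_edges n M J)" for x
    proof -
      have xa: "x \<in> affine_space (chart_index n J)"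
        using x exchange_edges_subset[of n M J] by (auto simp: affine_space_def)
      have "plucker k (chart_matrix J x) I = 0" if I: "I \<in> ksubsets n k - M" for I
      proof (rule ccontr)
        assume "plucker k (chart_matrix J x) I \<noteq> 0"
        then obtain \<sigma> where "bij_betw \<sigma> (J - I) (I - J)" "\<forall>i\<in>J - I. x (i, \<sigma> i) \<noteq> 0"
          using matching_if_plucker_neq_0[OF J] I by blast
        then have "I \<in> M" using closed[OF True, of I \<sigma>] I x
          by (auto simp: affine_space_def exchange_edges_def)
        then show False using I by simp
      qed
      then show ?thesis using xa chart_point_in_variety_iff[OF J xa, of M] by (simp add: chart_variety_def)
    qed
    then have "chart_variety n k M J = affine_space (exchange_edges n M J)"
      using chart_variety_subset[OF J] by blast
    then show ?thesis
      using smooth_affine_affine_space[OF finite_chart_index[OF J] exchange_edges_subset] by simp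
  next
    case False
    have "x \<notin> chart_variety n k M J" for x
    proof
      assume x: "x \<in> chart_variety n k M J"
      then have xa: "x \<in> affine_space (chart_index n J)" by (simp add: chart_variety_def)
      have "plucker k (chart_matrix J x) J \<noteq> 0"
        by (rule plucker_neq_0_if_unique_matching[OF J J, where \<sigma> = id]) auto
      then show False using x J False chart_point_in_variety_iff[OF J xa, of M]
        by (auto simp: chart_variety_def)
    qed
    then have "chart_variety n k M J = {}" by blast
    then show ?thesis by (simp add: smooth_affine_def)
  qed
  then show ?thesis by (simp add: smooth_in_grassmannian_def chart_variety_def)
qed

lemma double_exchange_if_smooth:
  assumes M: "M \<subseteq> ksubsets n k"
    and smooth: "smooth_in_grassmannian n k (positroid_variety n k M)"
    and J: "J \<in> M" and i: "i \<in> J" "i' \<in> J" "i \<noteq> i'" and j: "j \<noteq> j'"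
    and edges: "(i, j) \<in> exchange_edges n M J" "(i', j') \<in> exchange_edges n M J"
  shows "insert j (insert j' (J - {i, i'})) \<in> M"
proof (rule ccontr)
  let ?I = "insert j (insert j' (J - {i, i'}))"
  let ?S = "chart_index n J" and ?T = "exchange_edges n M J" and ?X = "chart_variety n k M J"
  assume notin: "?I \<notin> M"
  have Jk: "J \<in> ksubsets n k" using M J by auto
  have fin: "finite J" using Jk by (auto simp: ksubsets_def intro: finite_subset)
  have jn: "j \<in> {1..n} - J" "j' \<in> {1..n} - J" using edges by (auto simp: exchange_edges_def chart_index_def)
  have line: "(\<lambda>s. 0 + t * unit_fun e s) \<in> ?X" if e: "e \<in> ?T" for e t
  proof -
    let ?x = "\<lambda>s. 0 + t * unit_fun e s"
    obtain a b where ab: "e = (a, b)" by (cases e)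
    have xa: "?x \<in> affine_space ?S"
      using e exchange_edges_subset[of n M J] by (auto simp: affine_space_def unit_fun_def)
    have "I \<in> M" if I: "I \<in> ksubsets n k" and nz: "plucker k (chart_matrix J ?x) I \<noteq> 0" for I
    proof -
      obtain \<sigma> where \<sigma>: "bij_betw \<sigma> (J - I) (I - J)" "\<forall>i\<in>J - I. ?x (i, \<sigma> i) \<noteq> 0"
        using matching_if_plucker_neq_0[OF Jk I nz] by blast
      have sub: "J - I \<subseteq> {a}" "\<And>i. i \<in> J - I \<Longrightarrow> \<sigma> i = b"
        using \<sigma>(2) ab by (auto simp: unit_fun_def split: if_splits)
      show ?thesis
      proof (cases "J - I = {}")
        case True
        then have "I - J = {}" using \<sigma>(1) by (auto simp: bij_betw_def)
        then show ?thesis using True J by (metis Diff_eq_empty_iff subset_antisym)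
      next
        case False
        then have "J - I = {a}" using sub(1) by auto
        moreover from this have "I - J = {b}" using \<sigma>(1) sub(2)[of a] by (auto simp: bij_betw_def)
        ultimately have "I = insert b (J - {a})" by blast
        then show ?thesis using e ab by (simp add: exchange_edges_def)
      qed
    qed
    then show ?thesis using xa chart_point_in_variety_iff[OF Jk xa, of M]
      by (auto simp: chart_variety_def)
  qed
  have origin: "(\<lambda>s. 0) \<in> ?X" using line[OF edges(1), of 0] by simp
  have "cfun.dim (tangent_space ?S ?X (\<lambda>s. 0)) = card ?T"
    by (rule dim_tangent_space[OF finite_chart_index[OF Jk] exchange_edges_subset
          chart_variety_subset[OF Jk] line])
  moreover have "smooth_affine ?S ?X"
    using smooth Jk by (auto simp: smooth_in_grassmannian_def chart_variety_def)
  ultimately have "local_dim ?S ?X (\<lambda>s. 0) = enat (card ?T)"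
    using origin by (metis smooth_affine_def)
  then have X: "?X = affine_space ?T"
    by (rule eq_affine_space_if_full_dim[OF finite_chart_index[OF Jk] exchange_edges_subset
          chart_variety_subset[OF Jk] origin])
  define x :: "nat \<times> nat \<Rightarrow> complex" where "x = (\<lambda>s. if s = (i, j) \<or> s = (i', j') then 1 else 0)"
  have "x \<in> affine_space ?T" using edges by (auto simp: x_def affine_space_def)
  then have xX: "x \<in> ?X" using X by simp
  then have xa: "x \<in> affine_space ?S" by (simp add: chart_variety_def)
  have "card (J - {i, i'}) = card J - 2" using i fin by (simp add: card_Diff_subset)
  moreover have "card J \<ge> 2" using i fin by (metis card_2_iff card_mono empty_subsetI insert_subset)
  ultimately have I: "?I \<in> ksubsets n k"
    using Jk jn j fin by (auto simp: ksubsets_def)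
  have sets: "J - ?I = {i, i'}" "?I - J = {j, j'}" using i jn by auto
  have "plucker k (chart_matrix J x) ?I \<noteq> 0"
  proof (rule plucker_neq_0_if_unique_matching[OF Jk I, where \<sigma> = "\<lambda>a. if a = i then j else j'"])
    show "bij_betw (\<lambda>a. if a = i then j else j') (J - ?I) (?I - J)"
      unfolding sets using i(3) j by (auto simp: bij_betw_def inj_on_def)
  qed (use i(3) in \<open>auto simp only: sets x_def one_neq_zero split: if_splits\<close>)
  then show False using notin I xX chart_point_in_variety_iff[OF Jk xa, of M]
    by (auto simp: chart_variety_def)
qed

section \<open>Cyclic orders and the Gale order\<close>

lemma cyc_pos_eq:
  assumes "r \<in> {1..n}" "x \<in> {1..n}"
  shows "cyc_pos n r x = (if r \<le> x then x - r else x + n - r)"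
proof (cases "r \<le> x")
  case True
  then have "cyc_pos n r x = (x - r + n) mod n" by (simp add: cyc_pos_def)
  also have "\<dots> = x - r" using assms by (simp only: mod_add_self2) auto
  finally show ?thesis using True by simp
qed (use assms in \<open>auto simp: cyc_pos_def\<close>)

lemma cyc_pos_less: "r \<in> {1..n} \<Longrightarrow> x \<in> {1..n} \<Longrightarrow> cyc_pos n r x < n"
  by (auto simp: cyc_pos_eq)

lemma cyc_pos_inj: "r \<in> {1..n} \<Longrightarrow> x \<in> {1..n} \<Longrightarrow> y \<in> {1..n} \<Longrightarrow>
    cyc_pos n r x = cyc_pos n r y \<longleftrightarrow> x = y"
  by (auto simp: cyc_pos_eq split: if_splits)

lemma bij_betw_cyc_pos:
  assumes "r \<in> {1..n}" shows "bij_betw (cyc_pos n r) {1..n} {..<n}"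
proof -
  have inj: "inj_on (cyc_pos n r) {1..n}" using assms by (auto simp: inj_on_def cyc_pos_inj)
  moreover have "cyc_pos n r ` {1..n} \<subseteq> {..<n}" using assms cyc_pos_less by auto
  ultimately have "cyc_pos n r ` {1..n} = {..<n}"
    by (intro card_subset_eq) (auto simp: card_image)
  then show ?thesis using inj by (simp add: bij_betw_def)
qed

lemma cyc_pos_less_iff:
  assumes "r \<in> {1..n}" "x \<in> {1..n}" "y \<in> {1..n}"
  shows "cyc_pos n r x < cyc_pos n r y \<longleftrightarrow> (if (r \<le> x) = (r \<le> y) then x < y else r \<le> x)"
  using assms by (auto simp: cyc_pos_eq)

lemma clockwise_cyc_pos:
  assumes "r \<in> {1..n}" "x \<in> {1..n}" "y \<in> {1..n}" "z \<in> {1..n}"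
  shows "clockwise (cyc_pos n r x) (cyc_pos n r y) (cyc_pos n r z) \<longleftrightarrow> clockwise x y z"
  unfolding clockwise_def cyc_pos_less_iff[OF assms(1,2,3)] cyc_pos_less_iff[OF assms(1,3,4)]
    cyc_pos_less_iff[OF assms(1,4,2)]
  by (cases "r \<le> x"; cases "r \<le> y"; cases "r \<le> z"; simp; linarith)

lemma sorted_list_of_set_nth_le_iff:
  fixes P :: "nat set"
  assumes fin: "finite P" and i: "i < card P"
  shows "sorted_list_of_set P ! i \<le> b \<longleftrightarrow> i < card {x \<in> P. x \<le> b}"
proof
  let ?l = "sorted_list_of_set P"
  have len: "length ?l = card P" by simp
  have inj: "inj_on ((!) ?l) {..<card P}" by (auto simp: inj_on_def nth_eq_iff_index_eq)
  have mono: "?l ! j \<le> ?l ! j'" if "j \<le> j'" "j' < card P" for j j'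
    using that by (intro sorted_nth_mono) auto
  have mem: "?l ! j \<in> P" if "j < card P" for j
    using that fin by (rule sorted_list_of_set_nth_in[rotated])
  {
    assume le: "?l ! i \<le> b"
    have "(!) ?l ` {..i} \<subseteq> {x \<in> P. x \<le> b}"
    proof
      fix y assume "y \<in> (!) ?l ` {..i}"
      then obtain j where "j \<le> i" "y = ?l ! j" by auto
      then show "y \<in> {x \<in> P. x \<le> b}" using mono[of j i] mem[of j] i le by auto
    qed
    then have "card ((!) ?l ` {..i}) \<le> card {x \<in> P. x \<le> b}" using fin by (intro card_mono) auto
    moreover have "card ((!) ?l ` {..i}) = Suc i"
      using inj i by (subst card_image) (auto intro: inj_on_subset)
    ultimately show "i < card {x \<in> P. x \<le> b}" by simp
  }
  {
    assume lt: "i < card {x \<in> P. x \<le> b}"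
    show "?l ! i \<le> b"
    proof (rule ccontr)
      assume no: "\<not> ?l ! i \<le> b"
      have "{x \<in> P. x \<le> b} \<subseteq> (!) ?l ` {..<i}"
      proof
        fix y assume y: "y \<in> {x \<in> P. x \<le> b}"
        then obtain j where j: "j < card P" "y = ?l ! j" using sorted_list_of_set_index[OF fin, of y] by auto
        then have "j < i" using mono[of i j] y no by (cases "j < i") auto
        then show "y \<in> (!) ?l ` {..<i}" using j by auto
      qed
      then have "card {x \<in> P. x \<le> b} \<le> card {..<i}" by (intro surj_card_le) auto
      then show False using lt by simp
    qed
  }
qed

lemma list_all2_le_sorted_list_of_set_iff:
  fixes P Q :: "nat set"
  assumes "finite P" "finite Q"
  shows "list_all2 (\<le>) (sorted_list_of_set P) (sorted_list_of_set Q) \<longleftrightarrow>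
    card P = card Q \<and> (\<forall>b. card {x \<in> Q. x \<le> b} \<le> card {x \<in> P. x \<le> b})"
  (is "?L \<longleftrightarrow> ?R")
proof
  assume L: ?L
  have eq: "card P = card Q" using list_all2_lengthD[OF L] by simp
  have le: "sorted_list_of_set P ! i \<le> sorted_list_of_set Q ! i" if "i < card Q" for i
    using list_all2_nthD[OF L] that eq by simp
  have "card {x \<in> Q. x \<le> b} \<le> card {x \<in> P. x \<le> b}" for b
  proof (cases "card {x \<in> Q. x \<le> b}")
    case (Suc c)
    then have c: "c < card Q" using card_mono[of Q "{x \<in> Q. x \<le> b}"] assms by auto
    then have "sorted_list_of_set Q ! c \<le> b" using sorted_list_of_set_nth_le_iff assms(2) Suc by simp
    then have "sorted_list_of_set P ! c \<le> b" using le[OF c] by simp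
    then show ?thesis using sorted_list_of_set_nth_le_iff[OF assms(1)] c eq Suc by simp
  next
    case 0
    show ?thesis unfolding 0 by (rule le0)
  qed
  then show ?R using eq by blast
next
  assume R: ?R
  have "sorted_list_of_set P ! i \<le> sorted_list_of_set Q ! i" if i: "i < card P" for i
  proof -
    have "i < card {x \<in> Q. x \<le> sorted_list_of_set Q ! i}"
      using sorted_list_of_set_nth_le_iff[OF assms(2)] i R by (metis order_refl)
    then show ?thesis using sorted_list_of_set_nth_le_iff[OF assms(1) i] R by (meson less_le_trans)
  qed
  then show ?L using R by (auto simp: list_all2_conv_all_nth)
qed

context linorder
begin

lemma sorted_key_list_of_set_properties:
  assumes "inj_on f A" "finite A"
  shows "set (sorted_key_list_of_set f A) = A \<and> sorted (map f (sorted_key_list_of_set f A)) \<and>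
    distinct (map f (sorted_key_list_of_set f A))"
proof -
  interpret folding_insort_key "(\<le>)" "(<)" A f by unfold_locales (rule assms(1))
  show ?thesis using assms(2) by simp
qed

end

lemma map_sorted_key_list_of_set:
  assumes "inj_on f A" "finite A"
  shows "map f (sorted_key_list_of_set f A) = sorted_list_of_set (f ` A)"
  using sorted_key_list_of_set_properties[OF assms] assms(2)
  by (intro sorted_distinct_set_unique) auto

lemma gale_le_iff:
  assumes r: "r \<in> {1..n}" and IJ: "I \<subseteq> {1..n}" "J \<subseteq> {1..n}"
  shows "gale_le n r I J \<longleftrightarrow> card I = card J \<and>
    (\<forall>b. card {x \<in> J. cyc_pos n r x \<le> b} \<le> card {x \<in> I. cyc_pos n r x \<le> b})"
proof -
  let ?f = "cyc_pos n r"
  have inj: "inj_on ?f {1..n}" using bij_betw_cyc_pos[OF r] by (simp add: bij_betw_def)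
  have injs: "inj_on ?f K" if "K \<subseteq> {1..n}" for K using inj that by (rule inj_on_subset)
  have fin: "finite I" "finite J" using IJ finite_subset by auto
  have cnt: "card {y \<in> ?f ` K. y \<le> b} = card {x \<in> K. ?f x \<le> b}" if "K \<subseteq> {1..n}" for K b
  proof -
    have "{y \<in> ?f ` K. y \<le> b} = ?f ` {x \<in> K. ?f x \<le> b}" by auto
    moreover have "inj_on ?f {x \<in> K. ?f x \<le> b}" using that by (intro injs) auto
    ultimately show ?thesis by (simp add: card_image)
  qed
  have "gale_le n r I J \<longleftrightarrow> list_all2 (\<le>) (sorted_list_of_set (?f ` I)) (sorted_list_of_set (?f ` J))"
    unfolding gale_le_def map_sorted_key_list_of_set[OF injs[OF IJ(1)] fin(1), symmetric]
      map_sorted_key_list_of_set[OF injs[OF IJ(2)] fin(2), symmetric]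
    by (simp add: list_all2_map1 list_all2_map2)
  also have "\<dots> \<longleftrightarrow> card I = card J \<and>
    (\<forall>b. card {x \<in> J. ?f x \<le> b} \<le> card {x \<in> I. ?f x \<le> b})"
    unfolding list_all2_le_sorted_list_of_set_iff[OF fin[THEN finite_imageI]] cnt[OF IJ(1)] cnt[OF IJ(2)]
      card_image[OF injs[OF IJ(1)]] card_image[OF injs[OF IJ(2)]] by (rule refl)
  finally show ?thesis .
qed

section \<open>Blocked exchanges in a linear frame\<close>

lemma card_out_eq_card_in:
  assumes fin: "finite V" and bij: "bij_betw w V V" and A: "A \<subseteq> V"
  shows "card {x \<in> V. x \<in> A \<and> w x \<notin> A} = card {x \<in> V. x \<notin> A \<and> w x \<in> A}"
proof -
  have inj: "inj_on w V" and im: "w ` V = V" using bij by (auto simp: bij_betw_def)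
  have "w ` {x \<in> V. w x \<in> A} = A" using A im by auto
  moreover have "inj_on w {x \<in> V. w x \<in> A}" using inj by (rule inj_on_subset) auto
  ultimately have "card A = card {x \<in> V. w x \<in> A}" by (metis card_image)
  also have "{x \<in> V. w x \<in> A} = {x \<in> V. x \<in> A \<and> w x \<in> A} \<union> {x \<in> V. x \<notin> A \<and> w x \<in> A}" by auto
  also have "card \<dots> = card {x \<in> V. x \<in> A \<and> w x \<in> A} + card {x \<in> V. x \<notin> A \<and> w x \<in> A}"
    using fin by (intro card_Un_disjoint) auto
  finally have 1: "card A = card {x \<in> V. x \<in> A \<and> w x \<in> A} + card {x \<in> V. x \<notin> A \<and> w x \<in> A}" .
  have "A = {x \<in> V. x \<in> A \<and> w x \<in> A} \<union> {x \<in> V. x \<in> A \<and> w x \<notin> A}" using A by auto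
  then have "card A = card ({x \<in> V. x \<in> A \<and> w x \<in> A} \<union> {x \<in> V. x \<in> A \<and> w x \<notin> A})" by simp
  also have "\<dots> = card {x \<in> V. x \<in> A \<and> w x \<in> A} + card {x \<in> V. x \<in> A \<and> w x \<notin> A}"
    using fin by (intro card_Un_disjoint) auto
  finally show ?thesis using 1 by simp
qed

lemma ex_in_iff_ex_out:
  assumes "finite V" "bij_betw w V V" "A \<subseteq> V"
  shows "(\<exists>x\<in>A. w x \<notin> A) \<longleftrightarrow> (\<exists>x\<in>V - A. w x \<in> A)"
proof -
  have "{x \<in> V. x \<in> A \<and> w x \<notin> A} = {} \<longleftrightarrow> {x \<in> V. x \<notin> A \<and> w x \<in> A} = {}"
  proof -
    have "finite {x \<in> V. x \<in> A \<and> w x \<notin> A}" "finite {x \<in> V. x \<notin> A \<and> w x \<in> A}"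
      using assms(1) by auto
    note 0 = this[THEN card_0_eq, symmetric]
    show ?thesis unfolding 0 card_out_eq_card_in[OF assms] by (rule refl)
  qed
  then show ?thesis using assms(3) by blast
qed

definition decreasing :: "(nat \<Rightarrow> nat) \<Rightarrow> nat set \<Rightarrow> (nat \<Rightarrow> nat) \<Rightarrow> nat \<Rightarrow> bool" where
  "decreasing w C p x \<longleftrightarrow> p (w x) < p x \<or> x \<in> C"

definition nested_inc :: "nat set \<Rightarrow> (nat \<Rightarrow> nat) \<Rightarrow> nat set \<Rightarrow> (nat \<Rightarrow> nat) \<Rightarrow> (nat \<times> nat) set" where
  "nested_inc V w C p = {(x, y) \<in> V \<times> V. \<not> decreasing w C p x \<and> \<not> decreasing w C p y \<and>
     p x < p y \<and> p (w y) < p (w x)}"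

definition nested_dec :: "nat set \<Rightarrow> (nat \<Rightarrow> nat) \<Rightarrow> nat set \<Rightarrow> (nat \<Rightarrow> nat) \<Rightarrow> (nat \<times> nat) set" where
  "nested_dec V w C p = {(x, y) \<in> V \<times> V. decreasing w C p x \<and> decreasing w C p y \<and>
     p y < p x \<and> p (w x) < p (w y)}"

definition disjoint_dec_inc :: "nat set \<Rightarrow> (nat \<Rightarrow> nat) \<Rightarrow> nat set \<Rightarrow> (nat \<Rightarrow> nat) \<Rightarrow> (nat \<times> nat) set" where
  "disjoint_dec_inc V w C p = {(x, y) \<in> V \<times> V. decreasing w C p x \<and> \<not> decreasing w C p y \<and>
     (p x < p y \<or> p (w y) < p (w x))}"

definition cut :: "nat set \<Rightarrow> (nat \<Rightarrow> nat) \<Rightarrow> (nat \<Rightarrow> nat) \<Rightarrow> nat \<Rightarrow> nat \<Rightarrow> bool" where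
  "cut V w p a b \<longleftrightarrow> (\<forall>z\<in>V. p z < a \<longrightarrow> \<not> (a \<le> p (w z) \<and> p (w z) \<le> b))"

definition blocked_left :: "nat set \<Rightarrow> (nat \<Rightarrow> nat) \<Rightarrow> nat set \<Rightarrow> (nat \<Rightarrow> nat) \<Rightarrow> (nat \<times> nat) set" where
  "blocked_left V w C p = {(x, y) \<in> V \<times> V. decreasing w C p x \<and> \<not> decreasing w C p y \<and>
     (p (w y) < p (w x) \<or> (\<exists>a. p (w x) < a \<and> a \<le> p (w y) \<and> cut V w p a (p (w y))))}"

definition blocked_right :: "nat set \<Rightarrow> (nat \<Rightarrow> nat) \<Rightarrow> nat set \<Rightarrow> (nat \<Rightarrow> nat) \<Rightarrow> (nat \<times> nat) set" where
  "blocked_right V w C p = {(x, y) \<in> V \<times> V. decreasing w C p x \<and> \<not> decreasing w C p y \<and>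
     (p (w y) < p (w x) \<or> (\<exists>d. p (w x) \<le> d \<and> d < p (w y) \<and>
        (\<forall>z\<in>V. d < p z \<longrightarrow> \<not> (p (w x) \<le> p (w z) \<and> p (w z) \<le> d))))}"

definition last_cut :: "nat set \<Rightarrow> (nat \<Rightarrow> nat) \<Rightarrow> (nat \<Rightarrow> nat) \<Rightarrow> nat \<Rightarrow> nat" where
  "last_cut V w p y = (GREATEST a. a \<le> p (w y) \<and> cut V w p a (p (w y)))"

lemma last_cut:
  shows "last_cut V w p y \<le> p (w y)" and "cut V w p (last_cut V w p y) (p (w y))"
    and "a \<le> p (w y) \<Longrightarrow> cut V w p a (p (w y)) \<Longrightarrow> a \<le> last_cut V w p y"
proof -
  let ?P = "\<lambda>a. a \<le> p (w y) \<and> cut V w p a (p (w y))"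
  have "?P 0" by (simp add: cut_def)
  then have "?P (last_cut V w p y)" unfolding last_cut_def
    by (rule GreatestI_nat[where P = ?P and b = "p (w y)"]) auto
  then show "last_cut V w p y \<le> p (w y)" "cut V w p (last_cut V w p y) (p (w y))" by auto
  show "a \<le> last_cut V w p y" if "a \<le> p (w y)" "cut V w p a (p (w y))"
    unfolding last_cut_def using that by (intro Greatest_le_nat[where P = ?P and b = "p (w y)"]) auto
qed

definition cut_inc :: "nat set \<Rightarrow> (nat \<Rightarrow> nat) \<Rightarrow> nat set \<Rightarrow> (nat \<Rightarrow> nat) \<Rightarrow> (nat \<times> nat) set" where
  "cut_inc V w C p = {(x, y) \<in> nested_inc V w C p. p x < last_cut V w p y}"

definition cut_dec_inc :: "nat set \<Rightarrow> (nat \<Rightarrow> nat) \<Rightarrow> nat set \<Rightarrow> (nat \<Rightarrow> nat) \<Rightarrow> (nat \<times> nat) set" where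
  "cut_dec_inc V w C p = {(x, y) \<in> V \<times> V. decreasing w C p x \<and> \<not> decreasing w C p y \<and>
     (p x < last_cut V w p y \<or> p (w y) < p (w x))}"

locale frame =
  fixes V :: "nat set" and w :: "nat \<Rightarrow> nat" and C :: "nat set" and p :: "nat \<Rightarrow> nat"
  assumes fin: "finite V" and bij: "bij_betw w V V" and inj: "inj_on p V"
    and C: "C \<subseteq> {x \<in> V. w x = x}"
begin

lemma w_in: "x \<in> V \<Longrightarrow> w x \<in> V" using bij by (auto simp: bij_betw_def)

lemma p_eq: "x \<in> V \<Longrightarrow> y \<in> V \<Longrightarrow> p x = p y \<longleftrightarrow> x = y" using inj by (auto simp: inj_on_def)

lemma decreasing_le: "x \<in> V \<Longrightarrow> decreasing w C p x \<Longrightarrow> p (w x) \<le> p x"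
  using C by (auto simp: decreasing_def)

lemma increasing_ge: "\<not> decreasing w C p x \<Longrightarrow> p x \<le> p (w x)"
  by (auto simp: decreasing_def)

lemma tail_ge_last_cut:
  assumes "y \<in> V" shows "last_cut V w p y \<le> p y"
  using last_cut(1,2)[of V w p y] assms unfolding cut_def by (meson not_le order_refl)

lemma cut_dec_inc_subset: "cut_dec_inc V w C p \<subseteq> disjoint_dec_inc V w C p"
  using tail_ge_last_cut by (fastforce simp: cut_dec_inc_def disjoint_dec_inc_def)

lemma less_last_cut_iff:
  "u < last_cut V w p y \<longleftrightarrow> (\<exists>a. u < a \<and> a \<le> p (w y) \<and> cut V w p a (p (w y)))"
  using last_cut(1,2)[of V w p y] last_cut(3)[of _ p w y V] by (meson less_le_trans)

lemma blocked_left_iff: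
  "(x, y) \<in> blocked_left V w C p \<longleftrightarrow> x \<in> V \<and> y \<in> V \<and> decreasing w C p x \<and> \<not> decreasing w C p y \<and>
     (p (w y) < p (w x) \<or> p (w x) < last_cut V w p y)"
  by (auto simp: blocked_left_def less_last_cut_iff)

lemma cut_dec_inc_blocked: "cut_dec_inc V w C p \<subseteq> blocked_left V w C p"
proof
  fix e assume "e \<in> cut_dec_inc V w C p"
  then obtain x y where e: "e = (x, y)" "x \<in> V" "y \<in> V" "decreasing w C p x" "\<not> decreasing w C p y"
    "p x < last_cut V w p y \<or> p (w y) < p (w x)" by (auto simp: cut_dec_inc_def)
  then show "e \<in> blocked_left V w C p"
    using decreasing_le[of x] by (auto simp: blocked_left_iff)
qed

lemma card_fibers:
  assumes "R \<subseteq> V \<times> V" shows "card R = (\<Sum>y\<in>V. card {x. (x, y) \<in> R})"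
proof -
  have "prod.swap ` R = (SIGMA y:V. {x. (x, y) \<in> R})" using assms by force
  moreover have "inj_on prod.swap R" by (auto simp: inj_on_def prod_eq_iff)
  ultimately have "card R = card (SIGMA y:V. {x. (x, y) \<in> R})" by (metis card_image)
  moreover have "finite {x. (x, y) \<in> R}" for y
    using assms fin by (intro finite_subset[of "{x. (x, y) \<in> R}" V]) auto
  ultimately show ?thesis using fin by simp
qed

lemma card_blocked_left:
  "card (blocked_left V w C p) = card (cut_inc V w C p) + card (cut_dec_inc V w C p)"
proof -
  have "card {x. (x, y) \<in> blocked_left V w C p} =
    card {x. (x, y) \<in> cut_inc V w C p} + card {x. (x, y) \<in> cut_dec_inc V w C p}" if y: "y \<in> V" for y
  proof (cases "decreasing w C p y")
    case True
    then have "{x. (x, y) \<in> blocked_left V w C p} = {}" "{x. (x, y) \<in> cut_inc V w C p} = {}"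
      "{x. (x, y) \<in> cut_dec_inc V w C p} = {}"
      by (auto simp: blocked_left_def cut_inc_def cut_dec_inc_def nested_inc_def)
    then show ?thesis by simp
  next
    case False
    let ?a = "last_cut V w p y" and ?d = "decreasing w C p"
    let ?H = "{x \<in> V. ?d x \<and> p (w y) < p (w x)}" and ?L = "{x \<in> V. ?d x \<and> p x < ?a}"
    let ?O = "{x \<in> V. x \<in> {x \<in> V. p x < ?a} \<and> w x \<notin> {x \<in> V. p x < ?a}}"
    let ?N = "{x \<in> V. x \<notin> {x \<in> V. p x < ?a} \<and> w x \<in> {x \<in> V. p x < ?a}}"
    have a: "?a \<le> p (w y)" "\<And>z. z \<in> V \<Longrightarrow> p z < ?a \<Longrightarrow> ?a \<le> p (w z) \<Longrightarrow> p (w y) < p (w z)"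
      using last_cut(1,2)[of V w p y] unfolding cut_def by (auto simp: not_le)
    have le: "p (w x) < ?a" if "x \<in> ?L \<union> ?N" for x
      using that decreasing_le[of x] by auto
    have "{x. (x, y) \<in> blocked_left V w C p} = (?L \<union> ?N) \<union> ?H"
    proof (rule Set.set_eqI, rule iffI)
      fix x assume "x \<in> {x. (x, y) \<in> blocked_left V w C p}"
      then show "x \<in> (?L \<union> ?N) \<union> ?H" using w_in[of x] by (auto simp: blocked_left_iff)
    next
      fix x assume x: "x \<in> (?L \<union> ?N) \<union> ?H"
      then have "x \<in> V" "?d x" by (auto simp: decreasing_def)
      then show "x \<in> {x. (x, y) \<in> blocked_left V w C p}"
        using x y False le[of x] by (auto simp: blocked_left_iff)
    qed
    moreover have "(?L \<union> ?N) \<inter> ?H = {}"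
    proof -
      have "x \<notin> ?H" if "x \<in> ?L \<union> ?N" for x using le[OF that] a(1) by auto
      then show ?thesis by blast
    qed
    moreover have "?L \<inter> ?N = {}" by auto
    ultimately have 1: "card {x. (x, y) \<in> blocked_left V w C p} = card ?L + card ?N + card ?H"
      using fin by (simp add: card_Un_disjoint)
    have "{x. (x, y) \<in> cut_dec_inc V w C p} = ?L \<union> ?H"
      using y False by (auto simp: cut_dec_inc_def)
    moreover have "?L \<inter> ?H = {}"
    proof -
      have "x \<notin> ?H" if "x \<in> ?L" for x using le[of x] that a(1) by auto
      then show ?thesis by blast
    qed
    ultimately have 2: "card {x. (x, y) \<in> cut_dec_inc V w C p} = card ?L + card ?H"
      using fin by (simp add: card_Un_disjoint)
    have "{x. (x, y) \<in> cut_inc V w C p} = ?O"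
    proof (rule Set.set_eqI, rule iffI)
      fix x assume "x \<in> {x. (x, y) \<in> cut_inc V w C p}"
      then show "x \<in> ?O" using a(1) by (auto simp: cut_inc_def nested_inc_def)
    next
      fix x assume x: "x \<in> ?O"
      then have xs: "x \<in> V" "p x < ?a" "?a \<le> p (w x)" using w_in by auto
      then have "w x \<noteq> x" by auto
      then have "\<not> ?d x" using xs C by (auto simp: decreasing_def)
      then show "x \<in> {x. (x, y) \<in> cut_inc V w C p}"
        using xs y False a(2)[OF xs] tail_ge_last_cut[OF y] by (auto simp: cut_inc_def nested_inc_def)
    qed
    then have 3: "card {x. (x, y) \<in> cut_inc V w C p} = card ?O" by simp
    have "card ?O = card ?N" by (rule card_out_eq_card_in[OF fin bij]) auto
    then show ?thesis using 1 2 3 by simp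
  qed
  moreover have "blocked_left V w C p \<subseteq> V \<times> V" "cut_inc V w C p \<subseteq> V \<times> V" "cut_dec_inc V w C p \<subseteq> V \<times> V"
    by (auto simp: blocked_left_def cut_inc_def nested_inc_def cut_dec_inc_def)
  ultimately show ?thesis by (simp add: card_fibers sum.distrib)
qed

definition rev_pos :: "nat \<Rightarrow> nat" where "rev_pos x = Max (p ` V) - p x"

lemma p_le_Max: "x \<in> V \<Longrightarrow> p x \<le> Max (p ` V)" using fin by simp

lemma rev_pos_less: "x \<in> V \<Longrightarrow> y \<in> V \<Longrightarrow> rev_pos x < rev_pos y \<longleftrightarrow> p y < p x"
  using p_le_Max[of x] p_le_Max[of y] by (auto simp: rev_pos_def)

abbreviation "revC \<equiv> {x \<in> V. w x = x} - C"

lemma frame_rev: "frame V w revC rev_pos"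
proof
  show "inj_on rev_pos V"
  proof (rule inj_onI)
    fix x y assume xy: "x \<in> V" "y \<in> V" "rev_pos x = rev_pos y"
    then have "p x = p y" using p_le_Max[of x] p_le_Max[of y] by (simp add: rev_pos_def)
    then show "x = y" using xy p_eq by simp
  qed
qed (use fin bij in auto)

lemma decreasing_rev: "x \<in> V \<Longrightarrow> decreasing w revC rev_pos x \<longleftrightarrow> \<not> decreasing w C p x"
  using rev_pos_less[of "w x" x] w_in[of x] p_eq[of "w x" x] C by (auto simp: decreasing_def)

lemma nested_inc_rev: "nested_inc V w revC rev_pos = nested_dec V w C p"
  unfolding nested_inc_def nested_dec_def using decreasing_rev rev_pos_less w_in by auto

lemma disjoint_rev: "disjoint_dec_inc V w revC rev_pos = prod.swap ` disjoint_dec_inc V w C p"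
proof -
  have "(x, y) \<in> disjoint_dec_inc V w revC rev_pos \<longleftrightarrow> (y, x) \<in> disjoint_dec_inc V w C p" for x y
    unfolding disjoint_dec_inc_def using decreasing_rev rev_pos_less w_in by auto
  then show ?thesis by force
qed

lemma cut_rev:
  assumes "x \<in> V" "y \<in> V"
  shows "(\<exists>a. rev_pos y < a \<and> a \<le> rev_pos (w x) \<and> cut V w rev_pos a (rev_pos (w x))) \<longleftrightarrow>
    (\<exists>d. p (w x) \<le> d \<and> d < p y \<and> (\<forall>z\<in>V. d < p z \<longrightarrow> \<not> (p (w x) \<le> p (w z) \<and> p (w z) \<le> d)))"
    (is "?L \<longleftrightarrow> ?R")
proof
  let ?K = "Max (p ` V)"
  have le: "p (w x) \<le> ?K" "p y \<le> ?K" using assms w_in p_le_Max by auto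
  {
    assume ?L
    then obtain a where a: "rev_pos y < a" "a \<le> rev_pos (w x)" "cut V w rev_pos a (rev_pos (w x))" by blast
    have "\<not> (p (w x) \<le> p (w z) \<and> p (w z) \<le> ?K - a)" if z: "z \<in> V" "?K - a < p z" for z
    proof
      assume "p (w x) \<le> p (w z) \<and> p (w z) \<le> ?K - a"
      then have "rev_pos z < a" "a \<le> rev_pos (w z)" "rev_pos (w z) \<le> rev_pos (w x)"
        using z le a(1,2) p_le_Max[of z] p_le_Max[OF w_in, of z] by (auto simp: rev_pos_def)
      then show False using a(3) z(1) by (auto simp: cut_def)
    qed
    moreover have "p (w x) \<le> ?K - a" "?K - a < p y" using a(1,2) le by (auto simp: rev_pos_def)
    ultimately show ?R by blast
  }
  {
    assume ?R
    then obtain d where d: "p (w x) \<le> d" "d < p y"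
      "\<And>z. z \<in> V \<Longrightarrow> d < p z \<Longrightarrow> \<not> (p (w x) \<le> p (w z) \<and> p (w z) \<le> d)" by blast
    have "cut V w rev_pos (?K - d) (rev_pos (w x))"
      unfolding cut_def
    proof (intro ballI impI notI)
      fix z assume z: "z \<in> V" "rev_pos z < ?K - d" "?K - d \<le> rev_pos (w z) \<and> rev_pos (w z) \<le> rev_pos (w x)"
      then have "d < p z" "p (w x) \<le> p (w z)" "p (w z) \<le> d"
        using le d(1,2) p_le_Max[of z] p_le_Max[OF w_in, of z] by (auto simp: rev_pos_def)
      then show False using d(3) z(1) by blast
    qed
    moreover have "rev_pos y < ?K - d" "?K - d \<le> rev_pos (w x)" using d(1,2) le by (auto simp: rev_pos_def)
    ultimately show ?L by blast
  }
qed

lemma blocked_rev: "blocked_left V w revC rev_pos = prod.swap ` blocked_right V w C p"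
proof -
  have "(y, x) \<in> blocked_left V w revC rev_pos \<longleftrightarrow> (x, y) \<in> blocked_right V w C p" for x y
    unfolding blocked_left_def blocked_right_def
    using decreasing_rev[of x] decreasing_rev[of y] rev_pos_less[of "w x" "w y"] w_in cut_rev[of x "w y"]
    by auto
  then show ?thesis by force
qed

lemma less_last_cut_rev_iff:
  assumes "x \<in> V" "y \<in> V"
  shows "rev_pos x < last_cut V w rev_pos y \<longleftrightarrow>
    (\<exists>d. p (w y) \<le> d \<and> d < p x \<and> (\<forall>z\<in>V. d < p z \<longrightarrow> \<not> (p (w y) \<le> p (w z) \<and> p (w z) \<le> d)))"
proof -
  interpret R: frame V w revC rev_pos by (rule frame_rev)
  show ?thesis unfolding R.less_last_cut_iff using cut_rev[OF assms(2,1)] by simp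
qed

lemma finite_pairs [simp]:
  "finite (nested_inc V w C p)" "finite (nested_dec V w C p)" "finite (disjoint_dec_inc V w C p)"
  "finite (blocked_left V w C p)" "finite (blocked_right V w C p)" "finite (cut_dec_inc V w C p)"
  unfolding nested_inc_def nested_dec_def disjoint_dec_inc_def blocked_left_def blocked_right_def cut_dec_inc_def
  using fin by (auto intro: finite_subset[of _ "V \<times> V"])

text \<open>The alignments accounted for by the left- and the right-blocked exchanges overlap only in
  pairs that are blocked on both sides, so inclusion-exclusion bounds the number of blocked
  exchanges.\<close>

lemma card_blocked_le_cut:
  "card (blocked_left V w C p \<union> blocked_right V w C p) \<le> card (cut_inc V w C p) +
    card (cut_inc V w revC rev_pos) + card (cut_dec_inc V w C p \<union> prod.swap ` cut_dec_inc V w revC rev_pos)"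
proof -
  interpret R: frame V w revC rev_pos by (rule frame_rev)
  let ?F = "cut_dec_inc V w C p" and ?S = "prod.swap ` cut_dec_inc V w revC rev_pos"
  let ?L = "blocked_left V w C p" and ?R = "blocked_right V w C p"
  have inj_swap: "inj_on prod.swap A" for A :: "(nat \<times> nat) set"
    by (auto simp: inj_on_def prod_eq_iff)
  have cR: "card ?R = card (cut_inc V w revC rev_pos) + card ?S"
    using R.card_blocked_left unfolding blocked_rev by (simp add: card_image[OF inj_swap])
  have "?S \<subseteq> ?R"
    using image_mono[OF R.cut_dec_inc_blocked, of prod.swap] unfolding blocked_rev by (simp add: image_image)
  then have "card (?F \<inter> ?S) \<le> card (?L \<inter> ?R)"
    using cut_dec_inc_blocked by (intro card_mono) auto
  moreover have "card (?L \<union> ?R) + card (?L \<inter> ?R) = card ?L + card ?R"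
    by (rule card_Un_Int[symmetric]) auto
  moreover have "card (?F \<union> ?S) + card (?F \<inter> ?S) = card ?F + card ?S"
    by (rule card_Un_Int[symmetric]) auto
  ultimately show ?thesis using card_blocked_left cR by linarith
qed

lemma cut_inc_subset: "cut_inc V w C p \<subseteq> nested_inc V w C p"
  by (auto simp: cut_inc_def)

lemma cut_sets_subset:
  "cut_inc V w revC rev_pos \<subseteq> nested_dec V w C p"
  "cut_dec_inc V w C p \<union> prod.swap ` cut_dec_inc V w revC rev_pos \<subseteq> disjoint_dec_inc V w C p"
proof -
  interpret R: frame V w revC rev_pos by (rule frame_rev)
  show "cut_inc V w revC rev_pos \<subseteq> nested_dec V w C p" using R.cut_inc_subset nested_inc_rev by simp
  show "cut_dec_inc V w C p \<union> prod.swap ` cut_dec_inc V w revC rev_pos \<subseteq> disjoint_dec_inc V w C p"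
    using cut_dec_inc_subset image_mono[OF R.cut_dec_inc_subset, of prod.swap]
    unfolding disjoint_rev by (simp add: image_image)
qed

lemma card_blocked_less:
  assumes "cut_inc V w C p \<noteq> nested_inc V w C p \<or> cut_inc V w revC rev_pos \<noteq> nested_dec V w C p \<or>
    cut_dec_inc V w C p \<union> prod.swap ` cut_dec_inc V w revC rev_pos \<noteq> disjoint_dec_inc V w C p"
  shows "card (blocked_left V w C p \<union> blocked_right V w C p) <
    card (nested_inc V w C p) + card (nested_dec V w C p) + card (disjoint_dec_inc V w C p)"
proof -
  have "card (cut_inc V w C p) \<le> card (nested_inc V w C p)"
    "card (cut_inc V w revC rev_pos) \<le> card (nested_dec V w C p)"
    "card (cut_dec_inc V w C p \<union> prod.swap ` cut_dec_inc V w revC rev_pos) \<le> card (disjoint_dec_inc V w C p)"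
    using cut_inc_subset cut_sets_subset by (intro card_mono; simp)+
  moreover have "card (cut_inc V w C p) < card (nested_inc V w C p) \<or>
    card (cut_inc V w revC rev_pos) < card (nested_dec V w C p) \<or>
    card (cut_dec_inc V w C p \<union> prod.swap ` cut_dec_inc V w revC rev_pos) < card (disjoint_dec_inc V w C p)"
    using assms cut_inc_subset cut_sets_subset finite_pairs by (meson psubset_card_mono psubsetI)
  ultimately show ?thesis using card_blocked_le_cut by linarith
qed

end

section \<open>Alignments and crossings in a frame\<close>

lemma arcs_arith:
  fixes a A b B :: nat and ca cb :: bool
  assumes "a \<noteq> b" "A \<noteq> B" "ca \<longrightarrow> A = a" "cb \<longrightarrow> B = b"
  defines "da \<equiv> A < a \<or> ca" and "db \<equiv> B < b \<or> cb"
  shows "(\<not> (A = b \<or> B = a \<or> A \<noteq> a \<and> B \<noteq> b \<and> clockwise a b A \<noteq> clockwise a B A) \<and>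
      (if A = a then ca else clockwise a b A) \<noteq> (if B = b then cb else clockwise b a B)) \<longleftrightarrow>
    (\<not> da \<and> \<not> db \<and> a < b \<and> B < A \<or> da \<and> db \<and> b < a \<and> A < B \<or> da \<and> \<not> db \<and> (a < b \<or> B < A)) \<or>
    (\<not> db \<and> \<not> da \<and> b < a \<and> A < B \<or> db \<and> da \<and> a < b \<and> B < A \<or> db \<and> \<not> da \<and> (b < a \<or> A < B))"
  using assms(1-4) unfolding da_def db_def clockwise_def
  by (cases "A < a"; cases "A = a"; cases "B < b"; cases "B = b"; cases "a < b"; cases ca; cases cb;
      simp; linarith)

locale decorated_perm =
  fixes n :: nat and w :: "nat \<Rightarrow> nat" and C :: "nat set"
  assumes perm: "w permutes {1..n}" and loops: "C \<subseteq> {i \<in> {1..n}. w i = i}"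
begin

lemma w_mem: "x \<in> {1..n} \<Longrightarrow> w x \<in> {1..n}"
  using permutes_in_image[OF perm] by blast

lemma w_eq: "w x = w y \<longleftrightarrow> x = y"
  using permutes_inj[OF perm] by (auto dest: injD)

lemma arc_head_eq_iff:
  "i \<in> {1..n} \<Longrightarrow> j \<in> {1..n} \<Longrightarrow> arc_head w C i = 3 * j \<longleftrightarrow> w i \<noteq> i \<and> w i = j"
  by (auto simp: arc_head_def) presburger+

lemma left_of_tail_iff:
  assumes "i \<in> {1..n}" "j \<in> {1..n}" "i \<noteq> j"
  shows "left_of w C i (arc_tail j) \<longleftrightarrow> (if w i = i then i \<in> C else clockwise i j (w i))"
  using assms by (auto simp: left_of_def arc_tail_def arc_head_def clockwise_def)

lemma left_of_head_iff:
  assumes "i \<in> {1..n}" "j \<in> {1..n}" "i \<noteq> j" "w j \<noteq> i" "w i \<noteq> j"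
  shows "left_of w C i (arc_head w C j) \<longleftrightarrow> (if w i = i then i \<in> C else clockwise i (w j) (w i))"
  using assms by (auto simp: left_of_def arc_tail_def arc_head_def clockwise_def) presburger+

lemma crossing_iff:
  assumes "i \<in> {1..n}" "j \<in> {1..n}"
  shows "crossing w C i j \<longleftrightarrow> i \<noteq> j \<and> (w i = j \<or> w j = i \<or>
    (w i \<noteq> i \<and> w j \<noteq> j \<and> clockwise i j (w i) \<noteq> clockwise i (w j) (w i)))"
proof (cases "i = j \<or> w i = j \<or> w j = i")
  case True
  then show ?thesis using assms by (auto simp: crossing_def arc_head_def arc_tail_def)
next
  case False
  have "arc_head w C i \<noteq> arc_head w C j"
    using False w_eq[of i j] assms by (auto simp: arc_head_def)
  moreover have "arc_head w C i \<noteq> arc_tail j" "arc_head w C j \<noteq> arc_tail i" "arc_tail i \<noteq> arc_tail j"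
    using arc_head_eq_iff[OF assms] arc_head_eq_iff[OF assms(2,1)] False by (auto simp: arc_tail_def)
  ultimately have "crossing w C i j \<longleftrightarrow> left_of w C i (arc_tail j) \<noteq> left_of w C i (arc_head w C j)"
    using False by (auto simp: crossing_def)
  then show ?thesis using left_of_tail_iff[OF assms] left_of_head_iff[OF assms] False by auto
qed

lemma frame_cyc_pos: "r \<in> {1..n} \<Longrightarrow> frame {1..n} w C (cyc_pos n r)"
  using bij_betw_cyc_pos[of r n] loops permutes_imp_bij[OF perm] by unfold_locales (auto simp: bij_betw_def)

abbreviation aligned_pairs :: "nat \<Rightarrow> (nat \<times> nat) set" where
  "aligned_pairs r \<equiv> nested_inc {1..n} w C (cyc_pos n r) \<union> nested_dec {1..n} w C (cyc_pos n r) \<union>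
     disjoint_dec_inc {1..n} w C (cyc_pos n r)"

lemma alignment_iff:
  assumes r: "r \<in> {1..n}" and ij: "i \<in> {1..n}" "j \<in> {1..n}"
  shows "alignment w C i j \<longleftrightarrow> (i, j) \<in> aligned_pairs r \<or> (j, i) \<in> aligned_pairs r"
proof (cases "i = j")
  case True
  then show ?thesis by (auto simp: alignment_def nested_inc_def nested_dec_def disjoint_dec_inc_def)
next
  case False
  let ?p = "cyc_pos n r"
  note wij = w_mem[OF ij(1)] w_mem[OF ij(2)]
  have eqs: "?p i \<noteq> ?p j" "?p (w i) \<noteq> ?p (w j)" "?p (w i) = ?p j \<longleftrightarrow> w i = j" "?p (w j) = ?p i \<longleftrightarrow> w j = i"
    "?p (w i) = ?p i \<longleftrightarrow> w i = i" "?p (w j) = ?p j \<longleftrightarrow> w j = j"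
    using cyc_pos_inj[OF r] ij wij False w_eq[of i j] by auto
  have cws: "clockwise (?p i) (?p j) (?p (w i)) = clockwise i j (w i)"
    "clockwise (?p i) (?p (w j)) (?p (w i)) = clockwise i (w j) (w i)"
    "clockwise (?p j) (?p i) (?p (w j)) = clockwise j i (w j)"
    using clockwise_cyc_pos[OF r] ij wij by auto
  have "i \<in> C \<longrightarrow> ?p (w i) = ?p i" "j \<in> C \<longrightarrow> ?p (w j) = ?p j" using loops by auto
  note arith = arcs_arith[OF eqs(1,2) this, unfolded eqs(3-6) cws]
  have "alignment w C i j \<longleftrightarrow> \<not> (w i = j \<or> w j = i \<or> w i \<noteq> i \<and> w j \<noteq> j \<and> clockwise i j (w i) \<noteq> clockwise i (w j) (w i)) \<and>
      (if w i = i then i \<in> C else clockwise i j (w i)) \<noteq> (if w j = j then j \<in> C else clockwise j i (w j))"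
    using False unfolding alignment_def crossing_iff[OF ij] left_of_tail_iff[OF ij False]
      left_of_tail_iff[OF ij(2,1) False[symmetric]] by simp
  note eq = trans[OF this arith]
  show ?thesis
    unfolding eq using ij by (simp add: nested_inc_def nested_dec_def disjoint_dec_inc_def decreasing_def)
qed

lemma card_alignments:
  assumes r: "r \<in> {1..n}"
  shows "card (alignments n w C) = card (nested_inc {1..n} w C (cyc_pos n r)) +
    card (nested_dec {1..n} w C (cyc_pos n r)) + card (disjoint_dec_inc {1..n} w C (cyc_pos n r))"
proof -
  interpret frame "{1..n}" w C "cyc_pos n r" by (rule frame_cyc_pos[OF r])
  let ?f = "\<lambda>(i, j). {i, j} :: nat set"
  have sub: "aligned_pairs r \<subseteq> {1..n} \<times> {1..n}"
    by (auto simp: nested_inc_def nested_dec_def disjoint_dec_inc_def)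
  have asym: "(j, i) \<notin> aligned_pairs r" if "(i, j) \<in> aligned_pairs r" for i j
    using that by (auto simp: nested_inc_def nested_dec_def disjoint_dec_inc_def)
  have "alignments n w C = ?f ` aligned_pairs r"
  proof (rule Set.set_eqI, rule iffI)
    fix e assume "e \<in> alignments n w C"
    then obtain i j where e: "e = {i, j}" "i \<in> {1..n}" "j \<in> {1..n}" "alignment w C i j"
      by (auto simp: alignments_def)
    then consider "(i, j) \<in> aligned_pairs r" | "(j, i) \<in> aligned_pairs r"
      using alignment_iff[OF r e(2,3)] by blast
    then show "e \<in> ?f ` aligned_pairs r"
    proof cases
      case 1
      then show ?thesis using e(1) by (intro image_eqI[of _ _ "(i, j)"]) auto
    next
      case 2
      then show ?thesis using e(1) by (intro image_eqI[of _ _ "(j, i)"]) auto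
    qed
  next
    fix e assume "e \<in> ?f ` aligned_pairs r"
    then obtain i j where e: "e = {i, j}" "(i, j) \<in> aligned_pairs r" by auto
    then have ij: "i \<in> {1..n}" "j \<in> {1..n}" using sub by auto
    then have "alignment w C i j" using alignment_iff[OF r ij] e(2) by blast
    then show "e \<in> alignments n w C" unfolding alignments_def using e(1) ij by blast
  qed
  moreover have "inj_on ?f (aligned_pairs r)"
  proof (rule inj_onI)
    fix e e' assume e: "e \<in> aligned_pairs r" "e' \<in> aligned_pairs r" "?f e = ?f e'"
    obtain i j i' j' where "e = (i, j)" "e' = (i', j')" by (cases e; cases e')
    then show "e = e'" using e asym[of i j] by (auto simp: doubleton_eq_iff)
  qed
  ultimately have "card (alignments n w C) = card (aligned_pairs r)" by (simp only: card_image)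
  also have "\<dots> = card (nested_inc {1..n} w C (cyc_pos n r)) +
    card (nested_dec {1..n} w C (cyc_pos n r)) + card (disjoint_dec_inc {1..n} w C (cyc_pos n r))"
  proof -
    have d1: "nested_inc {1..n} w C (cyc_pos n r) \<inter> nested_dec {1..n} w C (cyc_pos n r) = {}"
      and d2: "(nested_inc {1..n} w C (cyc_pos n r) \<union> nested_dec {1..n} w C (cyc_pos n r)) \<inter>
        disjoint_dec_inc {1..n} w C (cyc_pos n r) = {}"
      by (auto simp: nested_inc_def nested_dec_def disjoint_dec_inc_def)
    show ?thesis
      unfolding card_Un_disjoint[OF finite_UnI[OF finite_pairs(1,2)] finite_pairs(3) d2]
        card_Un_disjoint[OF finite_pairs(1,2) d1] by (rule refl)
  qed
  finally show ?thesis .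
qed

lemma crossing_frame:
  assumes r: "r \<in> {1..n}" and ij: "i \<in> {1..n}" "j \<in> {1..n}" and "crossing w C i j"
  defines "p \<equiv> cyc_pos n r"
  shows "i \<noteq> j" "p (w i) = p j \<or> p (w j) = p i \<or>
    (p (w i) \<noteq> p i \<and> p (w j) \<noteq> p j \<and> clockwise (p i) (p j) (p (w i)) \<noteq> clockwise (p i) (p (w j)) (p (w i)))"
  using assms(4) cyc_pos_inj[OF r] clockwise_cyc_pos[OF r] ij w_mem[OF ij(1)] w_mem[OF ij(2)]
  unfolding crossing_iff[OF ij] p_def by auto

lemma cyc_pos_self: "cyc_pos n r r = 0"
  by (cases "n = 0") (auto simp: cyc_pos_def)

lemma cyc_pos_Suc:
  assumes "h \<in> {1..n}"
  defines "r \<equiv> if h = n then 1 else Suc h"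
  shows "r \<in> {1..n}" "cyc_pos n r h = n - 1"
    "x \<in> {1..n} \<Longrightarrow> x \<noteq> h \<Longrightarrow> cyc_pos n h x = Suc (cyc_pos n r x)"
proof -
  show r: "r \<in> {1..n}" using assms by (auto simp: r_def)
  show "cyc_pos n r h = n - 1" using assms r by (auto simp: cyc_pos_eq r_def)
  show "cyc_pos n h x = Suc (cyc_pos n r x)" if "x \<in> {1..n}" "x \<noteq> h"
    using assms r that by (auto simp: cyc_pos_eq r_def split: if_splits)
qed

lemma crossed_alignment_blocked_less:
  assumes ijh: "i \<in> {1..n}" "j \<in> {1..n}" "h \<in> {1..n}"
    and al: "alignment w C i j" and cr: "crossing w C h i" "crossing w C h j"
  shows "\<exists>r\<in>{1..n}. card (blocked_left {1..n} w C (cyc_pos n r) \<union> blocked_right {1..n} w C (cyc_pos n r)) <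
    card (alignments n w C)"
proof -
  let ?V = "{1..n}"
  define p where "p = cyc_pos n h"
  interpret frame ?V w C p unfolding p_def by (rule frame_cyc_pos[OF ijh(3)])
  have p0: "p h = 0" by (simp add: p_def cyc_pos_self)
  have pn: "p z < n" if "z \<in> ?V" for z using cyc_pos_less[OF ijh(3) that] by (simp add: p_def)
  have "(i, j) \<in> aligned_pairs h \<or> (j, i) \<in> aligned_pairs h"
    using alignment_iff[OF ijh(3,1,2)] al by blast
  then obtain x y where xy: "(x, y) \<in> aligned_pairs h" "x \<in> ?V" "y \<in> ?V"
      "crossing w C h x" "crossing w C h y" using ijh cr by blast
  note crx = crossing_frame[OF ijh(3,3) xy(2,4), folded p_def, unfolded p0]
  note cry = crossing_frame[OF ijh(3,3) xy(3,5), folded p_def, unfolded p0]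
  have pos: "0 < p x" "0 < p y" using p_eq[OF ijh(3) xy(2)] p_eq[OF ijh(3) xy(3)] crx(1) cry(1) p0 by auto
  have hd: "p (w h) \<noteq> p (w x)" "p (w h) \<noteq> p (w y)"
    using p_eq w_in[OF ijh(3)] w_in[OF xy(2)] w_in[OF xy(3)] w_eq crx(1) cry(1) by auto
  have wh: "w h \<in> ?V" "w x \<in> ?V" "w y \<in> ?V" using w_in ijh xy by auto
  from xy(1) consider
      (inc) "(x, y) \<in> nested_inc ?V w C p"
    | (dec) "(x, y) \<in> nested_dec ?V w C p"
    | (dis) "(x, y) \<in> disjoint_dec_inc ?V w C p" unfolding p_def by blast
  then show ?thesis
  proof cases
    case inc
    then have o: "p x < p y" "p y \<le> p (w y)" "p (w y) < p (w x)"
      using increasing_ge by (auto simp: nested_inc_def)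
    have v: "p y \<le> p (w h)" "p (w h) < p (w y)"
      using cry(2) o pos hd by (auto simp: clockwise_def)
    have "\<not> p x < last_cut ?V w p y"
    proof -
      have "\<not> cut ?V w p a (p (w y))" if a: "p x < a" "a \<le> p (w y)" for a
      proof (cases "a \<le> p (w h)")
        case True
        then show ?thesis using a v p0 ijh(3) unfolding cut_def by (intro notI) (erule ballE[of _ _ h], auto)
      next
        case False
        then show ?thesis using a v xy(3) unfolding cut_def by (intro notI) (erule ballE[of _ _ y], auto)
      qed
      then show ?thesis unfolding less_last_cut_iff by blast
    qed
    then have "(x, y) \<notin> cut_inc ?V w C p" by (auto simp: cut_inc_def)
    then have ne: "cut_inc ?V w C p \<noteq> nested_inc ?V w C p"
      using inc by blast
    have "card (blocked_left ?V w C p \<union> blocked_right ?V w C p) <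
      card (nested_inc ?V w C p) + card (nested_dec ?V w C p) + card (disjoint_dec_inc ?V w C p)"
      using ne by (intro card_blocked_less) simp
    then have "card (blocked_left ?V w C p \<union> blocked_right ?V w C p) < card (alignments n w C)"
      unfolding p_def card_alignments[OF ijh(3)] .
    then show ?thesis using ijh(3) unfolding p_def by blast
  next
    case dis
    then have d: "decreasing w C p x" "\<not> decreasing w C p y" "p x < p y \<or> p (w y) < p (w x)"
      by (auto simp: disjoint_dec_inc_def)
    then have o: "p (w x) \<le> p x" "p y \<le> p (w y)"
      using decreasing_le[OF xy(2)] increasing_ge by auto
    have v: "p y \<le> p (w h)" "p (w h) < p (w y)"
      using cry(2) o pos hd by (auto simp: clockwise_def)
    have X: "p (w x) = 0" "p x < p y"
      using crx(2) o pos hd v d(3) by (auto simp: clockwise_def)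
    have "\<not> p x < last_cut ?V w p y"
    proof -
      have "\<not> cut ?V w p a (p (w y))" if a: "p x < a" "a \<le> p (w y)" for a
      proof (cases "a \<le> p (w h)")
        case True
        then show ?thesis using a v p0 ijh(3) unfolding cut_def by (intro notI) (erule ballE[of _ _ h], auto)
      next
        case False
        then show ?thesis using a v xy(3) unfolding cut_def by (intro notI) (erule ballE[of _ _ y], auto)
      qed
      then show ?thesis unfolding less_last_cut_iff by blast
    qed
    then have F: "(x, y) \<notin> cut_dec_inc ?V w C p" using X(1) by (auto simp: cut_dec_inc_def)
    have "\<not> rev_pos y < last_cut ?V w rev_pos x"
    proof -
      have "\<exists>z\<in>?V. dd < p z \<and> p (w z) \<le> dd" if dd: "dd < p y" for dd
      proof (cases "dd < p x")
        case True
        then show ?thesis using xy(2) X by auto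
      next
        case False
        let ?A = "{z \<in> ?V. p z \<le> dd}"
        have "h \<in> ?A" "w h \<notin> ?A" using p0 ijh(3) v dd by auto
        then obtain z where "z \<in> ?V - ?A" "w z \<in> ?A"
          using ex_in_iff_ex_out[OF fin bij, of ?A] by blast
        then show ?thesis by (intro bexI[of _ z]) auto
      qed
      then show ?thesis unfolding less_last_cut_rev_iff[OF xy(3,2)] using X(1) by auto
    qed
    then have "(y, x) \<notin> cut_dec_inc ?V w revC rev_pos"
      using rev_pos_less[OF wh(3,2)] rev_pos_less[OF wh(2,3)] X(1) by (auto simp: cut_dec_inc_def)
    then have "(x, y) \<notin> prod.swap ` cut_dec_inc ?V w revC rev_pos" by auto
    then have ne: "cut_dec_inc ?V w C p \<union> prod.swap ` cut_dec_inc ?V w revC rev_pos \<noteq> disjoint_dec_inc ?V w C p"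
      using F dis by blast
    have "card (blocked_left ?V w C p \<union> blocked_right ?V w C p) <
      card (nested_inc ?V w C p) + card (nested_dec ?V w C p) + card (disjoint_dec_inc ?V w C p)"
      using ne by (intro card_blocked_less) simp
    then have "card (blocked_left ?V w C p \<union> blocked_right ?V w C p) < card (alignments n w C)"
      unfolding p_def card_alignments[OF ijh(3)] .
    then show ?thesis using ijh(3) unfolding p_def by blast
  next
    case dec
    then have o: "p y < p x" "p (w y) \<le> p y" "p (w x) < p (w y)"
      using decreasing_le[OF xy(3)] by (auto simp: nested_dec_def)
    have v: "p (w y) < p (w h)" "p (w h) \<le> p y"
      using cry(2) o pos hd by (auto simp: clockwise_def)
    define r where "r = (if h = n then 1 else Suc h)"
    define q where "q = cyc_pos n r"
    note S = cyc_pos_Suc[OF ijh(3), folded r_def, folded q_def p_def]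
    interpret Q: frame ?V w C q unfolding q_def by (rule frame_cyc_pos[OF S(1)])
    have neq: "x \<noteq> h" "y \<noteq> h" "w y \<noteq> h" "w h \<noteq> h" using crx(1) cry(1) o v p0 by auto
    have qs: "p x = Suc (q x)" "p y = Suc (q y)" "p (w y) = Suc (q (w y))" "p (w h) = Suc (q (w h))"
      using S(3)[OF xy(2)] S(3)[OF xy(3)] S(3)[OF wh(3)] S(3)[OF wh(1)] neq by auto
    have qn: "q z \<le> q h" if "z \<in> ?V" for z
      using cyc_pos_less[OF S(1) that] S(2) by (simp add: q_def)
    have qh: "q x < q h" using qn[OF xy(2)] Q.p_eq[OF xy(2) ijh(3)] neq(1) by force
    have qdec: "decreasing w C q y" using o v qs by (auto simp: decreasing_def)
    have S': "\<not> Q.rev_pos x < last_cut ?V w Q.rev_pos y"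
    proof -
      have "\<exists>z\<in>?V. d < q z \<and> q (w y) \<le> q (w z) \<and> q (w z) \<le> d" if d: "q (w y) \<le> d" "d < q x" for d
      proof (cases "q (w h) \<le> d")
        case True
        then show ?thesis using ijh(3) d qh v qs by (intro bexI[of _ h]) auto
      next
        case False
        then show ?thesis using xy(3) d v qs by (intro bexI[of _ y]) auto
      qed
      then show ?thesis unfolding Q.less_last_cut_rev_iff[OF xy(2,3)] by (meson not_le)
    qed
    show ?thesis
    proof (cases "w x = h")
      case False
      then have qx: "p (w x) = Suc (q (w x))" using S(3)[OF wh(2)] by simp
      then have "(x, y) \<in> nested_dec ?V w C q"
        using qdec o qs xy by (auto simp: nested_dec_def decreasing_def)
      moreover have "(x, y) \<notin> cut_inc ?V w Q.revC Q.rev_pos" using S' by (auto simp: cut_inc_def)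
      ultimately have ne: "cut_inc ?V w Q.revC Q.rev_pos \<noteq> nested_dec ?V w C q"
      by blast
    have "card (blocked_left ?V w C q \<union> blocked_right ?V w C q) <
      card (nested_inc ?V w C q) + card (nested_dec ?V w C q) + card (disjoint_dec_inc ?V w C q)"
      using ne by (intro Q.card_blocked_less) simp
    then have "card (blocked_left ?V w C q \<union> blocked_right ?V w C q) < card (alignments n w C)"
      unfolding q_def card_alignments[OF S(1)] .
    then show ?thesis using S(1) unfolding q_def by blast
    next
      case True
      have "x \<notin> C" using True neq(1) loops by auto
      then have inc: "\<not> decreasing w C q x" using True qh by (auto simp: decreasing_def)
      have dis: "(y, x) \<in> disjoint_dec_inc ?V w C q"
        using inc qdec xy o qs by (auto simp: disjoint_dec_inc_def)
      have "\<not> q y < last_cut ?V w q x"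
      proof -
        have "\<exists>z\<in>?V. q z < a \<and> a \<le> q (w z) \<and> q (w z) \<le> q (w x)" if a: "q y < a" "a \<le> q (w x)" for a
        proof (cases "q x < a")
          case True
          then show ?thesis using xy(2) a by auto
        next
          case False
          let ?A = "{z \<in> ?V. q z < a}"
          have "h \<in> ?V - ?A" "w h \<in> ?A" using ijh(3) wh(1) v qs a False qh by auto
          then obtain z where "z \<in> ?A" "w z \<notin> ?A"
            using ex_in_iff_ex_out[OF fin bij, of ?A] by blast
          then have "z \<in> ?V" "q z < a" "a \<le> q (w z)" "w z \<in> ?V" using w_in by auto
          then show ?thesis using qn[of "w z"] \<open>w x = h\<close> by auto
        qed
        then show ?thesis unfolding Q.less_last_cut_iff cut_def by blast
      qed
      then have F: "(y, x) \<notin> cut_dec_inc ?V w C q"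
        using qn[OF wh(3)] True by (auto simp: cut_dec_inc_def)
      have "(x, y) \<notin> cut_dec_inc ?V w Q.revC Q.rev_pos"
        using S' Q.rev_pos_less[OF wh(3,2)] qn[OF wh(3)] True by (auto simp: cut_dec_inc_def)
      then have "(y, x) \<notin> prod.swap ` cut_dec_inc ?V w Q.revC Q.rev_pos" by auto
      then have ne: "cut_dec_inc ?V w C q \<union> prod.swap ` cut_dec_inc ?V w Q.revC Q.rev_pos \<noteq> disjoint_dec_inc ?V w C q"
      using F dis by blast
    have "card (blocked_left ?V w C q \<union> blocked_right ?V w C q) <
      card (nested_inc ?V w C q) + card (nested_dec ?V w C q) + card (disjoint_dec_inc ?V w C q)"
      using ne by (intro Q.card_blocked_less) simp
    then have "card (blocked_left ?V w C q \<union> blocked_right ?V w C q) < card (alignments n w C)"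
      unfolding q_def card_alignments[OF S(1)] .
    then show ?thesis using S(1) unfolding q_def by blast
    qed
  qed
qed

end

section \<open>Positroids and their necklace bases\<close>

lemma card_johnson_neighbours:
  assumes M: "M \<subseteq> ksubsets n k" and J: "J \<in> ksubsets n k"
  shows "card {I \<in> M. card (I \<inter> J) + 1 = k} = card (exchange_edges n M J)"
proof (rule bij_betw_same_card[symmetric])
  have fin: "finite J" using J by (auto simp: ksubsets_def intro: finite_subset)
  let ?f = "\<lambda>(i, j). insert j (J - {i})"
  have inj: "inj_on ?f (exchange_edges n M J)"
  proof (rule inj_onI)
    fix e e' assume e: "e \<in> exchange_edges n M J" "e' \<in> exchange_edges n M J" "?f e = ?f e'"
    obtain i j i' j' where [simp]: "e = (i, j)" "e' = (i', j')" by (cases e; cases e')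
    have "i \<in> J" "j \<notin> J" "i' \<in> J" "j' \<notin> J" "insert j (J - {i}) = insert j' (J - {i'})"
      using e by (auto simp: exchange_edges_def chart_index_def)
    then show "e = e'" by (auto simp: set_eq_iff)
  qed
  have "?f ` exchange_edges n M J = {I \<in> M. card (I \<inter> J) + 1 = k}"
  proof (rule Set.set_eqI, rule iffI)
    fix I assume "I \<in> ?f ` exchange_edges n M J"
    then obtain i j where ij: "i \<in> J" "j \<notin> J" "I = insert j (J - {i})" "I \<in> M"
      by (auto simp: exchange_edges_def chart_index_def)
    then have "I \<inter> J = J - {i}" by auto
    then have "card (I \<inter> J) + 1 = k" using ij(1) fin J card_Suc_Diff1[OF fin ij(1)] by (simp add: ksubsets_def)
    then show "I \<in> {I \<in> M. card (I \<inter> J) + 1 = k}" using ij by simp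
  next
    fix I assume I: "I \<in> {I \<in> M. card (I \<inter> J) + 1 = k}"
    then have Ik: "I \<in> ksubsets n k" using M by auto
    have finI: "finite I" using Ik by (auto simp: ksubsets_def intro: finite_subset)
    have "card (J - I) = 1" "card (I - J) = 1"
      using I Ik J fin finI by (auto simp: ksubsets_def card_Diff_subset_Int Int_commute)
    then obtain i j where ij: "J - I = {i}" "I - J = {j}" by (auto simp: card_1_singleton_iff)
    then have "I = insert j (J - {i})" by blast
    moreover have "(i, j) \<in> exchange_edges n M J"
      using ij I Ik calculation by (auto simp: exchange_edges_def chart_index_def ksubsets_def)
    ultimately show "I \<in> ?f ` exchange_edges n M J" by force
  qed
  then show "bij_betw ?f (exchange_edges n M J) {I \<in> M. card (I \<inter> J) + 1 = k}"
    using inj by (simp add: bij_betw_def)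
qed

lemma card_chart_index:
  assumes "J \<in> ksubsets n k" shows "card (chart_index n J) = k * (n - k)"
proof -
  have "finite J" "J \<subseteq> {1..n}" "card J = k" using assms by (auto simp: ksubsets_def intro: finite_subset)
  then show ?thesis by (simp add: chart_index_def card_cartesian_product card_Diff_subset)
qed

lemma cyc_pos_change:
  assumes "r \<in> {1..n}" "r' \<in> {1..n}" "x \<in> {1..n}"
  shows "cyc_pos n r' x = (if cyc_pos n r r' \<le> cyc_pos n r x then cyc_pos n r x - cyc_pos n r r'
    else cyc_pos n r x + n - cyc_pos n r r')"
  using assms by (auto simp: cyc_pos_eq split: if_splits)

context decorated_perm
begin

abbreviation "Ir r \<equiv> shifted_anti_exceedances n w C r"

lemma Ir_subset: "Ir r \<subseteq> {1..n}"
  by (auto simp: shifted_anti_exceedances_def)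

lemma w_mem_Ir_iff:
  assumes "x \<in> {1..n}"
  shows "w x \<in> Ir r \<longleftrightarrow> decreasing w C (cyc_pos n r) x"
proof -
  have "inv_into UNIV w (w x) = x" using permutes_inj[OF perm] by (rule inv_f_f)
  moreover have "w x \<in> C \<longleftrightarrow> x \<in> C"
  proof
    assume "w x \<in> C"
    then have "w (w x) = w x" using loops by auto
    then show "x \<in> C" using w_eq \<open>w x \<in> C\<close> by auto
  next
    assume "x \<in> C"
    moreover from this have "w x = x" using loops by auto
    ultimately show "w x \<in> C" by simp
  qed
  ultimately show ?thesis using w_mem[OF assms] by (simp add: shifted_anti_exceedances_def decreasing_def)
qed

lemma card_heads:
  assumes "A \<subseteq> {1..n}"
  shows "card {x \<in> A. x \<notin> Ir r} = card {y \<in> {1..n}. w y \<in> A \<and> \<not> decreasing w C (cyc_pos n r) y}"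
proof -
  have im: "w ` {y \<in> {1..n}. w y \<in> A \<and> \<not> decreasing w C (cyc_pos n r) y} = {x \<in> A. x \<notin> Ir r}"
  proof (rule Set.set_eqI, rule iffI)
    fix x assume x: "x \<in> {x \<in> A. x \<notin> Ir r}"
    then obtain y where "y \<in> {1..n}" "x = w y" using assms permutes_image[OF perm] by blast
    then show "x \<in> w ` {y \<in> {1..n}. w y \<in> A \<and> \<not> decreasing w C (cyc_pos n r) y}"
      using x w_mem_Ir_iff by auto
  qed (use w_mem_Ir_iff in auto)
  have inj: "inj_on w {y \<in> {1..n}. w y \<in> A \<and> \<not> decreasing w C (cyc_pos n r) y}"
    using w_eq by (auto simp: inj_on_def)
  show ?thesis unfolding im[symmetric] by (rule card_image[OF inj])
qed

lemma rank_le_and_blocked: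
  fixes b i j :: nat
  assumes r: "r \<in> {1..n}" and r': "r' \<in> {1..n}"
  defines "p \<equiv> cyc_pos n r" and "A \<equiv> {x \<in> {1..n}. cyc_pos n r' x \<le> b}"
  shows "card {x \<in> A. x \<notin> Ir r'} \<le> card {x \<in> A. x \<notin> Ir r} \<and>
    (i \<in> {1..n} \<longrightarrow> j \<in> A \<longrightarrow> i \<notin> A \<longrightarrow> card {x \<in> A. x \<notin> Ir r'} = card {x \<in> A. x \<notin> Ir r} \<longrightarrow>
      p j < p i \<or> (\<exists>a. p i < a \<and> a \<le> p j \<and> cut {1..n} w p a (p j)) \<or>
      (\<exists>d. p i \<le> d \<and> d < p j \<and> (\<forall>z\<in>{1..n}. d < p z \<longrightarrow> \<not> (p i \<le> p (w z) \<and> p (w z) \<le> d))))"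
    (is "_ \<and> (_ \<longrightarrow> _ \<longrightarrow> _ \<longrightarrow> _ \<longrightarrow> ?blocked)")
proof -
  let ?V = "{1..n}"
  define q where "q = cyc_pos n r'"
  define \<rho> where "\<rho> = p r'"
  interpret P: frame ?V w C p unfolding p_def by (rule frame_cyc_pos[OF r])
  interpret Q: frame ?V w C q unfolding q_def by (rule frame_cyc_pos[OF r'])
  have \<rho>: "\<rho> < n" using cyc_pos_less[OF r r'] by (simp add: \<rho>_def p_def)
  have pn: "p x < n" if "x \<in> ?V" for x using cyc_pos_less[OF r that] by (simp add: p_def)
  have q: "q x = (if \<rho> \<le> p x then p x - \<rho> else p x + n - \<rho>)" if "x \<in> ?V" for x
    using cyc_pos_change[OF r r' that] by (simp add: p_def q_def \<rho>_def)
  have A: "x \<in> A \<longleftrightarrow> x \<in> ?V \<and> q x \<le> b" for x by (simp add: A_def q_def)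
  have AV: "A \<subseteq> ?V" by (auto simp: A_def)
  define X where "X = {y \<in> ?V. w y \<in> A \<and> \<not> decreasing w C q y}"
  define Y where "Y = {y \<in> ?V. w y \<in> A \<and> \<not> decreasing w C p y}"
  have cards: "card {x \<in> A. x \<notin> Ir r'} = card X" "card {x \<in> A. x \<notin> Ir r} = card Y"
    unfolding X_def Y_def p_def q_def by (rule card_heads[OF AV])+
  have finXY: "finite X" "finite Y" by (auto simp: X_def Y_def)
  have noloop: "y \<notin> C" if "p y < p (w y) \<or> p (w y) < p y" for y
    using that loops by auto
  show ?thesis
  proof (cases "\<rho> + b < n")
    case True
    have A': "x \<in> A \<longleftrightarrow> x \<in> ?V \<and> \<rho> \<le> p x \<and> p x \<le> \<rho> + b" for x
      using True q[of x] pn[of x] unfolding A by (auto split: if_splits)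
    have XA: "y \<in> A \<and> p y \<le> p (w y)" if "y \<in> X" for y
    proof -
      have y: "y \<in> ?V" "w y \<in> ?V" "w y \<in> A" "q y \<le> q (w y)" "q (w y) \<le> b"
        using that A w_mem by (auto simp: X_def decreasing_def)
      then have "y \<in> A" by (simp add: A)
      then show ?thesis using y(3,4) q[OF y(1)] q[OF y(2)] A' by auto
    qed
    have "X \<subseteq> Y"
    proof
      fix y assume y: "y \<in> X"
      then show "y \<in> Y" using XA[OF y] by (auto simp: X_def Y_def decreasing_def)
    qed
    moreover have ?blocked if "i \<in> ?V" "j \<in> A" "i \<notin> A" "card X = card Y"
    proof -
      have XY: "X = Y" using card_subset_eq[OF finXY(2) \<open>X \<subseteq> Y\<close> that(4)] .
      have j: "\<rho> \<le> p j" "p j \<le> \<rho> + b" using that(2) A' by auto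
      show ?thesis
      proof (cases "p i < \<rho>")
        case True
        have "cut ?V w p \<rho> (p j)"
          unfolding cut_def
        proof (intro ballI impI notI)
          fix z assume z: "z \<in> ?V" "p z < \<rho>" "\<rho> \<le> p (w z) \<and> p (w z) \<le> p j"
          then have "w z \<in> A" using A' j w_mem[OF z(1)] by auto
          then have "z \<in> Y" using z noloop[of z] by (auto simp: Y_def decreasing_def)
          then show False using XA[of z] XY A' z by auto
        qed
        then show ?thesis using True j by blast
      next
        case False
        then have "p j < p i" using that(1,3) j A' by auto
        then show ?thesis by blast
      qed
    qed
    ultimately show ?thesis unfolding cards using card_mono[OF finXY(2)] by blast
  next
    case False
    have A': "x \<in> A \<longleftrightarrow> x \<in> ?V \<and> (\<rho> \<le> p x \<or> p x + n \<le> \<rho> + b)" for x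
      using False q[of x] pn[of x] \<rho> unfolding A by (auto split: if_splits)
    let ?L = "{y \<in> ?V. p y < \<rho>}"
    define In where "In = {y \<in> ?V. y \<notin> ?L \<and> w y \<in> ?L}"
    define Out where "Out = {y \<in> ?V. y \<in> ?L \<and> w y \<notin> ?L}"
    define In' where "In' = {y \<in> In. p (w y) + n \<le> \<rho> + b}"
    have flow: "card Out = card In" unfolding In_def Out_def by (rule card_out_eq_card_in[OF P.fin P.bij]) auto
    have fins: "finite In" "finite In'" "In' \<subseteq> In" by (auto simp: In_def In'_def)
    have XY: "X - Y \<subseteq> In'"
    proof
      fix y assume "y \<in> X - Y"
      then have y: "y \<in> ?V" "w y \<in> A" "y \<notin> C" "q y \<le> q (w y)" "p (w y) < p y"
        by (auto simp: X_def Y_def decreasing_def)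
      have wy: "w y \<in> ?V" using w_mem[OF y(1)] .
      have "p (w y) < \<rho> \<and> \<rho> \<le> p y"
        using y(4,5) q[OF y(1)] q[OF wy] pn[OF y(1)] pn[OF wy] \<rho> by (auto split: if_splits)
      then show "y \<in> In'" using y wy A' by (auto simp: In_def In'_def)
    qed
    have YX: "Out \<subseteq> Y - X"
    proof
      fix y assume "y \<in> Out"
      then have y': "y \<in> ?V" "p y < \<rho>" "\<not> (w y \<in> ?V \<and> p (w y) < \<rho>)" by (auto simp: Out_def)
      then have y: "y \<in> ?V" "w y \<in> ?V" "p y < \<rho>" "\<rho> \<le> p (w y)" using w_mem[OF y'(1)] by auto
      have "q (w y) = p (w y) - \<rho>" "q y = p y + n - \<rho>" using q[OF y(1)] q[OF y(2)] y(3,4) by auto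
      then have "q (w y) < q y" using pn[OF y(2)] y(3,4) by linarith
      moreover have "w y \<in> A" using y A' by blast
      moreover have "y \<notin> C" "\<not> p (w y) < p y" using y noloop[of y] by auto
      ultimately show "y \<in> Y - X" using y(1) unfolding X_def Y_def decreasing_def by blast
    qed
    have cX: "card X = card (X \<inter> Y) + card (X - Y)" and cY: "card Y = card (X \<inter> Y) + card (Y - X)"
      using card_Int_Diff[OF finXY(1), of Y] card_Int_Diff[OF finXY(2), of X] by (simp_all add: Int_commute)
    have le: "card (X - Y) \<le> card In'" "card In' \<le> card In" "card Out \<le> card (Y - X)"
      using XY YX fins finXY by (auto intro!: card_mono)
    have ?blocked if "i \<in> ?V" "j \<in> A" "i \<notin> A" "card X = card Y"
    proof -
      have "card In' = card In" using that(4) cX cY le flow by linarith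
      then have eq: "In' = In" using fins card_subset_eq by blast
      have i: "p i < \<rho>" "\<rho> + b < p i + n" using that(1,3) A' by auto
      show ?thesis
      proof (cases "\<rho> \<le> p j")
        case True
        have "\<not> (p i \<le> p (w z) \<and> p (w z) \<le> \<rho> - 1)" if z: "z \<in> ?V" "\<rho> - 1 < p z" for z
        proof
          assume a: "p i \<le> p (w z) \<and> p (w z) \<le> \<rho> - 1"
          then have "z \<in> In" using z i w_mem[OF z(1)] by (auto simp: In_def)
          then have "z \<in> In'" using eq by simp
          then show False using a i by (auto simp: In'_def)
        qed
        moreover have "p i \<le> \<rho> - 1" "\<rho> - 1 < p j" using i True by auto
        ultimately show ?thesis by blast
      next
        case False
        then have "p j < p i" using that(2) A' i by auto
        then show ?thesis by blast
      qed
    qed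
    moreover have "card X \<le> card Y" using cX cY le flow by linarith
    ultimately show ?thesis unfolding cards by blast
  qed
qed

lemma card_Ir:
  assumes "r \<in> {1..n}" shows "card (Ir r) = card (anti_exceedances n w C)"
proof -
  have n: "1 \<in> {1..n}" using assms by auto
  have "card {x \<in> {1..n}. x \<notin> Ir r'} \<le> card {x \<in> {1..n}. x \<notin> Ir r}" if "r \<in> {1..n}" "r' \<in> {1..n}" for r r'
  proof -
    have "{x \<in> {1..n}. cyc_pos n r' x \<le> n} = {1..n}" using cyc_pos_less[OF that(2)] by fastforce
    then show ?thesis using rank_le_and_blocked[OF that, of n] by simp
  qed
  then have "card {x \<in> {1..n}. x \<notin> Ir r} = card {x \<in> {1..n}. x \<notin> Ir 1}"
    using assms n by (intro antisym) auto
  moreover have "Ir 1 = anti_exceedances n w C"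
  proof -
    have "inv_into UNIV w i \<in> {1..n}" if "i \<in> {1..n}" for i
      using permutes_in_image[OF permutes_inv[OF perm]] that by blast
    then have "cyc_pos n 1 i < cyc_pos n 1 (inv_into UNIV w i) \<longleftrightarrow> i < inv_into UNIV w i" if "i \<in> {1..n}" for i
      using cyc_pos_less_iff[OF n that, of "inv_into UNIV w i"] that by simp
    then show ?thesis unfolding shifted_anti_exceedances_def anti_exceedances_def by blast
  qed
  moreover have "card {x \<in> {1..n}. x \<notin> Ir r} + card (Ir r) = n" for r
  proof -
    have "card ({1..n} \<inter> Ir r) + card ({1..n} - Ir r) = n" using card_Int_Diff[of "{1..n}" "Ir r"] by simp
    moreover have "{1..n} \<inter> Ir r = Ir r" using Ir_subset by (rule Int_absorb1)
    moreover have "{1..n} - Ir r = {x \<in> {1..n}. x \<notin> Ir r}" by (rule set_diff_eq)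
    ultimately show ?thesis by simp
  qed
  ultimately show ?thesis by (metis add_left_cancel)
qed

end

locale positroid_data = decorated_perm +
  fixes k :: nat
  assumes card_anti_exceedances: "card (anti_exceedances n w C) = k"
begin

abbreviation "M \<equiv> positroid n k w C"

lemma M_subset: "M \<subseteq> ksubsets n k"
  by (auto simp: positroid_def)

lemma card_prefix_complement:
  assumes "I \<subseteq> {1..n}"
  shows "card {x \<in> {1..n}. cyc_pos n r x \<le> b} =
    card {x \<in> I. cyc_pos n r x \<le> b} + card {x \<in> {1..n}. cyc_pos n r x \<le> b \<and> x \<notin> I}"
proof -
  have "{x \<in> {1..n}. cyc_pos n r x \<le> b} =
      {x \<in> I. cyc_pos n r x \<le> b} \<union> {x \<in> {1..n}. cyc_pos n r x \<le> b \<and> x \<notin> I}" using assms by auto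
  moreover have "finite I" using assms finite_subset by auto
  ultimately show ?thesis by (simp add: card_Un_disjoint disjoint_iff)
qed

lemma positroid_iff:
  "I \<in> M \<longleftrightarrow> I \<in> ksubsets n k \<and> (\<forall>r\<in>{1..n}. \<forall>b.
     card {x \<in> {1..n}. cyc_pos n r x \<le> b \<and> x \<notin> Ir r} \<le> card {x \<in> {1..n}. cyc_pos n r x \<le> b \<and> x \<notin> I})"
proof (cases "I \<in> ksubsets n k")
  case True
  then have I: "I \<subseteq> {1..n}" "card I = k" by (auto simp: ksubsets_def)
  have "gale_le n r (Ir r) I \<longleftrightarrow> (\<forall>b.
     card {x \<in> {1..n}. cyc_pos n r x \<le> b \<and> x \<notin> Ir r} \<le> card {x \<in> {1..n}. cyc_pos n r x \<le> b \<and> x \<notin> I})"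
    if r: "r \<in> {1..n}" for r
  proof -
    have "card {x \<in> I. cyc_pos n r x \<le> b} \<le> card {x \<in> Ir r. cyc_pos n r x \<le> b} \<longleftrightarrow>
      card {x \<in> {1..n}. cyc_pos n r x \<le> b \<and> x \<notin> Ir r} \<le> card {x \<in> {1..n}. cyc_pos n r x \<le> b \<and> x \<notin> I}" for b
      using card_prefix_complement[OF I(1), of r b] card_prefix_complement[OF Ir_subset, of r b r] by linarith
    then show ?thesis
      using gale_le_iff[OF r Ir_subset I(1)] card_Ir[OF r] card_anti_exceedances I(2) by simp
  qed
  then show ?thesis using True by (simp add: positroid_def)
qed (simp add: positroid_def)

lemma Ir_in_M:
  assumes "r \<in> {1..n}" shows "Ir r \<in> M"
  unfolding positroid_iff
proof (intro conjI ballI allI)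
  show "Ir r \<in> ksubsets n k"
    using Ir_subset card_Ir[OF assms] card_anti_exceedances by (simp add: ksubsets_def)
  fix r' b assume "r' \<in> {1..n}"
  then show "card {x \<in> {1..n}. cyc_pos n r' x \<le> b \<and> x \<notin> Ir r'} \<le>
      card {x \<in> {1..n}. cyc_pos n r' x \<le> b \<and> x \<notin> Ir r}"
    using rank_le_and_blocked[OF assms, of r' b] by (simp add: conj_ac)
qed

lemma blocked_if_exchange_notin:
  assumes r: "r \<in> {1..n}" and ij: "i \<in> Ir r" "j \<in> {1..n} - Ir r"
    and notin: "insert j (Ir r - {i}) \<notin> M"
  shows "(i, j) \<in> map_prod w w ` (blocked_left {1..n} w C (cyc_pos n r) \<union> blocked_right {1..n} w C (cyc_pos n r))"
proof -
  let ?I = "insert j (Ir r - {i})"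
  have "Ir r \<in> ksubsets n k" using Ir_in_M[OF r] M_subset by auto
  then have "?I \<in> ksubsets n k" using exchange_in_ksubsets ij by blast
  then obtain r' b where r': "r' \<in> {1..n}" and
    lt: "card {x \<in> {1..n}. cyc_pos n r' x \<le> b \<and> x \<notin> ?I} < card {x \<in> {1..n}. cyc_pos n r' x \<le> b \<and> x \<notin> Ir r'}"
    using notin unfolding positroid_iff by (auto simp: not_le)
  define A where "A = {x \<in> {1..n}. cyc_pos n r' x \<le> b}"
  have sets: "{x \<in> {1..n}. cyc_pos n r' x \<le> b \<and> x \<notin> K} = {x \<in> A. x \<notin> K}" for K by (auto simp: A_def)
  note main = rank_le_and_blocked[OF r r', of b i j, folded A_def]
  have finA: "finite A" by (simp add: A_def)
  have i: "i \<in> {1..n}" using ij(1) Ir_subset[of r] by auto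
  have lt': "card {x \<in> A. x \<notin> ?I} < card {x \<in> A. x \<notin> Ir r}" using lt main unfolding sets by linarith
  have jA: "j \<in> A" and iA: "i \<notin> A"
  proof -
    show "j \<in> A"
    proof (rule ccontr)
      assume "j \<notin> A"
      then have "card {x \<in> A. x \<notin> Ir r} \<le> card {x \<in> A. x \<notin> ?I}" using finA by (intro card_mono) auto
      then show False using lt' by simp
    qed
    show "i \<notin> A"
    proof
      assume iA: "i \<in> A"
      have "{x \<in> A. x \<notin> Ir r} \<subseteq> insert j ({x \<in> A. x \<notin> ?I} - {i})" using ij by auto
      then have "card {x \<in> A. x \<notin> Ir r} \<le> card (insert j ({x \<in> A. x \<notin> ?I} - {i}))"
        using finA by (intro card_mono) auto
      also have "\<dots> \<le> Suc (card ({x \<in> A. x \<notin> ?I} - {i}))" using finA by (intro card_insert_le_m1) auto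
      also have "\<dots> = card {x \<in> A. x \<notin> ?I}"
        using iA ij finA by (intro card_Suc_Diff1) auto
      finally show False using lt' by simp
    qed
  qed
  have "insert j {x \<in> A. x \<notin> ?I} = {x \<in> A. x \<notin> Ir r}" using jA iA ij by auto
  then have "card {x \<in> A. x \<notin> Ir r} = Suc (card {x \<in> A. x \<notin> ?I})"
    using card_insert_disjoint[of "{x \<in> A. x \<notin> ?I}" j] finA by simp
  then have "card {x \<in> A. x \<notin> Ir r'} = card {x \<in> A. x \<notin> Ir r}" using lt main unfolding sets by linarith
  then have bl: "cyc_pos n r j < cyc_pos n r i \<or>
      (\<exists>a. cyc_pos n r i < a \<and> a \<le> cyc_pos n r j \<and> cut {1..n} w (cyc_pos n r) a (cyc_pos n r j)) \<or>
      (\<exists>d. cyc_pos n r i \<le> d \<and> d < cyc_pos n r j \<and> (\<forall>z\<in>{1..n}. d < cyc_pos n r z \<longrightarrow>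
        \<not> (cyc_pos n r i \<le> cyc_pos n r (w z) \<and> cyc_pos n r (w z) \<le> d)))"
    using main i jA iA by blast
  have "i \<in> w ` {1..n}" "j \<in> w ` {1..n}" using i ij(2) permutes_image[OF perm] by auto
  then obtain x y where xy: "x \<in> {1..n}" "i = w x" "y \<in> {1..n}" "j = w y" by blast
  have "decreasing w C (cyc_pos n r) x" "\<not> decreasing w C (cyc_pos n r) y"
    using ij xy w_mem_Ir_iff by auto
  then have "(x, y) \<in> blocked_left {1..n} w C (cyc_pos n r) \<union> blocked_right {1..n} w C (cyc_pos n r)"
    using bl xy by (auto simp: blocked_left_def blocked_right_def)
  then show ?thesis using xy by (intro image_eqI[of _ _ "(x, y)"]) auto
qed

lemma card_neighbours_Ir_ge:
  assumes r: "r \<in> {1..n}"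
  shows "k * (n - k) \<le> card {I \<in> M. card (I \<inter> Ir r) + 1 = k} +
    card (blocked_left {1..n} w C (cyc_pos n r) \<union> blocked_right {1..n} w C (cyc_pos n r))"
proof -
  interpret frame "{1..n}" w C "cyc_pos n r" by (rule frame_cyc_pos[OF r])
  let ?B = "blocked_left {1..n} w C (cyc_pos n r) \<union> blocked_right {1..n} w C (cyc_pos n r)"
  have J: "Ir r \<in> ksubsets n k" using Ir_in_M[OF r] M_subset by auto
  have "chart_index n (Ir r) \<subseteq> exchange_edges n M (Ir r) \<union> map_prod w w ` ?B"
  proof
    fix e assume e: "e \<in> chart_index n (Ir r)"
    obtain i j where ij: "e = (i, j)" by (cases e)
    then have "i \<in> Ir r" "j \<in> {1..n} - Ir r" using e by (auto simp: chart_index_def)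
    then show "e \<in> exchange_edges n M (Ir r) \<union> map_prod w w ` ?B"
      using blocked_if_exchange_notin[OF r, of i j] e ij
      by (cases "insert j (Ir r - {i}) \<in> M") (simp_all add: exchange_edges_def)
  qed
  then have "card (chart_index n (Ir r)) \<le> card (exchange_edges n M (Ir r) \<union> map_prod w w ` ?B)"
    using finite_chart_index[OF J] exchange_edges_subset[of n M "Ir r"] finite_pairs(4,5)
    by (intro card_mono finite_UnI finite_imageI) (auto intro: finite_subset)
  also have "\<dots> \<le> card (exchange_edges n M (Ir r)) + card (map_prod w w ` ?B)" by (rule card_Un_le)
  also have "card (map_prod w w ` ?B) \<le> card ?B" using finite_pairs(4,5) by (intro card_image_le) auto
  finally show ?thesis using card_chart_index[OF J] card_johnson_neighbours[OF M_subset J] by simp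
qed

lemma no_crossed_alignment_if_degree:
  assumes deg: "\<forall>J\<in>M. int (card {I \<in> M. card (I \<inter> J) + 1 = k}) =
      int k * (int n - int k) - int (card (alignments n w C))"
  shows "\<not> (\<exists>i\<in>{1..n}. \<exists>j\<in>{1..n}. crossed_alignment n w C i j)"
proof
  assume "\<exists>i\<in>{1..n}. \<exists>j\<in>{1..n}. crossed_alignment n w C i j"
  then obtain i j h where ijh: "i \<in> {1..n}" "j \<in> {1..n}" "h \<in> {1..n}" "alignment w C i j"
    "crossing w C h i" "crossing w C h j" by (auto simp: crossed_alignment_def)
  obtain r where r: "r \<in> {1..n}" and lt: "card (blocked_left {1..n} w C (cyc_pos n r) \<union>
      blocked_right {1..n} w C (cyc_pos n r)) < card (alignments n w C)"
    using crossed_alignment_blocked_less[OF ijh] by blast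
  have "k \<le> n" using Ir_in_M[OF r] M_subset card_mono[of "{1..n}" "Ir r"] by (auto simp: ksubsets_def)
  then have "int k * (int n - int k) = int (k * (n - k))" by (simp add: of_nat_diff)
  moreover have "int (card {I \<in> M. card (I \<inter> Ir r) + 1 = k}) =
      int k * (int n - int k) - int (card (alignments n w C))"
    using deg Ir_in_M[OF r] by (rule bspec)
  ultimately show False using card_neighbours_Ir_ge[OF r] lt by linarith
qed

end

section \<open>Permutations without crossed alignments\<close>

definition chord_crossing :: "(nat \<Rightarrow> nat) \<Rightarrow> nat \<Rightarrow> nat \<Rightarrow> bool" where
  "chord_crossing u i j \<longleftrightarrow> i \<noteq> j \<and> (u i = j \<or> u j = i \<or> clockwise i j (u i) \<noteq> clockwise i (u j) (u i))"

definition chord_alignment :: "(nat \<Rightarrow> nat) \<Rightarrow> nat \<Rightarrow> nat \<Rightarrow> bool" where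
  "chord_alignment u i j \<longleftrightarrow> i \<noteq> j \<and> \<not> chord_crossing u i j \<and> clockwise i j (u i) \<noteq> clockwise j i (u j)"

lemma chord_crossingI:
  assumes "z \<noteq> x" "u z \<noteq> u x" "z = c \<and> u z = e \<or> z = e \<and> u z = c"
    and "min x (u x) \<le> c" "c \<le> max x (u x)" "e \<le> min x (u x) \<or> max x (u x) \<le> e"
  shows "chord_crossing u z x"
proof (cases "u z = x \<or> u x = z")
  case True
  then show ?thesis using assms(1) by (auto simp: chord_crossing_def)
next
  case False
  then have ne: "c \<noteq> x" "c \<noteq> u x" "e \<noteq> x" "e \<noteq> u x" using assms(1-3) by auto
  have "clockwise z x (u z) \<noteq> clockwise z (u x) (u z)"
  proof (cases "x < u x")
    case True
    then have "x < c" "c < u x" "e < x \<or> u x < e" using assms(4-6) ne by auto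
    then show ?thesis using assms(3) True by (auto simp: clockwise_def)
  next
    case False
    then have "u x < c" "c < x" "e < u x \<or> x < e" using assms(4-6) ne by auto
    then show ?thesis using assms(3) False by (auto simp: clockwise_def)
  qed
  then show ?thesis using assms(1) by (simp add: chord_crossing_def)
qed

lemma chord_alignment_nestedI:
  "x < y \<Longrightarrow> y < u y \<Longrightarrow> u y < u x \<Longrightarrow> chord_alignment u x y"
  by (auto simp: chord_alignment_def chord_crossing_def clockwise_def)

lemma chord_alignment_disjointI:
  "u x < x \<Longrightarrow> x < y \<Longrightarrow> y < u y \<Longrightarrow> chord_alignment u x y"
  by (auto simp: chord_alignment_def chord_crossing_def clockwise_def)

text \<open>The arcs leaving \<open>{1..<b}\<close> towards the inner chord \<open>b \<mapsto> B\<close> and towards the outer side of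
  the chord \<open>0 \<mapsto> B + 1\<close> must both exist, and comparing the extreme endpoints \<open>m1\<close> and \<open>m2\<close> of
  these two families always produces a crossed alignment.\<close>

lemma crossed_alignment_if_adjacent_heads:
  assumes bij: "bij_betw u {..<m} {..<m}"
    and no_fix: "\<And>x. x < m \<Longrightarrow> u x \<noteq> x"
    and no_crossed: "\<And>i j h. i < m \<Longrightarrow> j < m \<Longrightarrow> h < m \<Longrightarrow> chord_alignment u i j \<Longrightarrow>
      chord_crossing u h i \<Longrightarrow> chord_crossing u h j \<Longrightarrow> False"
    and no_invariant: "\<And>c d. c \<le> d \<Longrightarrow> d < m \<Longrightarrow> 0 < c \<or> Suc d < m \<Longrightarrow> \<exists>x\<in>{c..d}. u x \<notin> {c..d}"
    and b: "0 < b" "b < B" "u b = B" "u 0 = Suc B" "Suc B < m"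
  shows False
proof -
  have um: "u x < m" if "x < m" for x using bij that by (auto simp: bij_betw_def)
  have ueq: "u x = u y \<longleftrightarrow> x = y" if "x < m" "y < m" for x y
    using bij that by (auto simp: bij_betw_def inj_on_def)
  have enters: "\<exists>x<m. x \<notin> {c..d} \<and> u x \<in> {c..d}" if "c \<le> d" "d < m" "0 < c \<or> Suc d < m" for c d
  proof -
    have sub: "{c..d} \<subseteq> {..<m}" using that(2) by auto
    have "\<exists>x\<in>{..<m} - {c..d}. u x \<in> {c..d}"
      using ex_in_iff_ex_out[OF finite_lessThan bij sub] no_invariant[OF that] by blast
    then show ?thesis by auto
  qed
  define U where "U x \<longleftrightarrow> b \<le> x \<and> x \<le> B" for x
  define V where "V x \<longleftrightarrow> x = 0 \<or> B < x \<and> x < m" for x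
  define R where "R x \<longleftrightarrow> 0 < x \<and> x < b" for x
  have URV: "x < m \<Longrightarrow> U x \<or> V x \<or> R x" "\<not> (U x \<and> V x)" "\<not> (U x \<and> R x)" "\<not> (V x \<and> R x)" for x
    using b by (auto simp: U_def V_def R_def)
  have bm: "b < m" "B < m" "0 < m" using b by auto
  have al0b: "chord_alignment u 0 b" by (rule chord_alignment_nestedI) (use b in auto)
  define arc where "arc x c e \<longleftrightarrow> x < m \<and> (x = c \<and> u x = e \<or> x = e \<and> u x = c)" for x c e
  have cross_b: "chord_crossing u x b" if "arc x c e" "U c" "\<not> U e" for x c e
  proof (rule chord_crossingI[where c = c and e = e])
    show "x \<noteq> b" "u x \<noteq> u b" using that b ueq[of x b] bm by (auto simp: arc_def U_def)
  qed (use that b in \<open>auto simp: arc_def U_def\<close>)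
  have cross_0: "chord_crossing u x 0" if "arc x c e" "V e" "\<not> V c" for x c e
  proof (rule chord_crossingI[where c = c and e = e])
    have "x \<noteq> 0" using that b by (auto simp: arc_def V_def)
    then show "x \<noteq> 0" "u x \<noteq> u 0" using that ueq[of x 0] bm by (auto simp: arc_def)
    have "c < m" using that um by (auto simp: arc_def)
    then show "min 0 (u 0) \<le> c" "c \<le> max 0 (u 0)" using that b by (auto simp: V_def)
  qed (use that b in \<open>auto simp: arc_def V_def\<close>)
  have noUV: False if "arc x c e" "U c" "V e" for x c e
  proof -
    have ec: "\<not> U e" "\<not> V c" and xm: "x < m" using that URV(2) by (auto simp: arc_def)
    show False
      by (rule no_crossed[OF bm(3,1) xm al0b cross_0[OF that(1,3) ec(2)] cross_b[OF that(1,2) ec(1)]])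
  qed
  have tail: "arc x x (u x)" "arc x (u x) x" if "x < m" for x using that by (auto simp: arc_def)
  define EU where "EU c \<longleftrightarrow> R c \<and> (\<exists>x e. arc x c e \<and> U e)" for c
  define EV where "EV c \<longleftrightarrow> R c \<and> (\<exists>x e. arc x c e \<and> V e)" for c
  have Rm: "R c \<Longrightarrow> c < m" for c using bm by (auto simp: R_def)
  have "\<exists>c. EU c"
  proof -
    obtain x where x: "x \<in> {b..B}" "u x \<notin> {b..B}" using no_invariant[of b B] b by auto
    then have "x < m" "U x" "\<not> U (u x)" using b by (auto simp: U_def)
    then have "R (u x)" using noUV[OF tail(1)] URV(1)[OF um] by blast
    then show ?thesis using tail(2) \<open>x < m\<close> \<open>U x\<close> unfolding EU_def by blast
  qed
  moreover have "\<exists>c. EV c"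
  proof -
    obtain x where x: "x \<in> {1..B}" "u x \<notin> {1..B}" using no_invariant[of 1 B] b by auto
    then have "x < m" "\<not> V x" using b by (auto simp: V_def)
    moreover have "V (u x)" using x(2) um[OF \<open>x < m\<close>] by (auto simp: V_def)
    ultimately have "R x" using noUV[OF tail(1)] URV(1) by blast
    then show ?thesis using tail(1) \<open>x < m\<close> \<open>V (u x)\<close> unfolding EV_def by blast
  qed
  moreover have "finite (Collect EU)" "finite (Collect EV)"
    by (rule finite_subset[of _ "{..<b}"]; auto simp: EU_def EV_def R_def)+
  ultimately obtain m1 m2 where m1: "EU m1" "\<And>c. EU c \<Longrightarrow> m1 \<le> c" and m2: "EV m2" "\<And>c. EV c \<Longrightarrow> c \<le> m2"
    using that[of "Min (Collect EU)" "Max (Collect EV)"] Min_in[of "Collect EU"] Max_in[of "Collect EV"]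
      Min_le[of "Collect EU"] Max_ge[of "Collect EV"] by blast
  obtain x1 e1 where x1: "arc x1 m1 e1" "U e1" using m1(1) by (auto simp: EU_def)
  obtain x2 e2 where x2: "arc x2 m2 e2" "V e2" using m2(1) by (auto simp: EV_def)
  have R12: "R m1" "R m2" using m1(1) m2(1) by (auto simp: EU_def EV_def)
  have inner: "c < x" if x: "R x" "U (u x)" and c: "EV c" for x c
  proof (rule ccontr)
    assume "\<not> c < x"
    obtain z e where z: "arc z c e" "V e" "R c" using c by (auto simp: EV_def)
    have xm: "x < m" "z < m" using x z by (auto simp: Rm arc_def)
    have ord: "0 < x" "x < u x" "u x < u 0" "x < b" "b \<le> u x" "u x \<le> B" "c < b"
      using x z(3) b by (auto simp: R_def U_def)
    have "z \<noteq> x" using z x ord \<open>\<not> c < x\<close> URV(2,4) by (auto simp: arc_def)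
    then have "chord_crossing u z x"
    proof (rule chord_crossingI[where c = c and e = e])
      show "u z \<noteq> u x" using \<open>z \<noteq> x\<close> ueq xm by simp
      show "e \<le> min x (u x) \<or> max x (u x) \<le> e" using z(2) ord by (auto simp: V_def)
    qed (use z(1) ord \<open>\<not> c < x\<close> in \<open>auto simp: arc_def\<close>)
    moreover have "chord_crossing u z 0" using cross_0[OF z(1,2)] z(3) URV(4) by blast
    moreover have "chord_alignment u 0 x" by (rule chord_alignment_nestedI) (use ord in auto)
    ultimately show False using no_crossed[OF bm(3) xm] by blast
  qed
  have outer: "x < c" if x: "R x" "V (u x)" and c: "EU c" for x c
  proof (rule ccontr)
    assume "\<not> x < c"
    obtain z e where z: "arc z c e" "U e" "R c" using c by (auto simp: EU_def)
    have xm: "x < m" "z < m" using x z by (auto simp: Rm arc_def)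
    have ord: "0 < x" "x < b" "u x = 0 \<or> B < u x" "0 < c" "c \<le> x" "b \<le> e" "e \<le> B"
      using x z(2,3) \<open>\<not> x < c\<close> by (auto simp: R_def V_def U_def)
    have "z \<noteq> x" using z x ord \<open>\<not> x < c\<close> URV(2,3) by (auto simp: arc_def)
    then have "chord_crossing u z x"
    proof (cases "u x = 0")
      case True
      show ?thesis
        by (rule chord_crossingI[where c = c and e = e])
          (use z(1) ord \<open>z \<noteq> x\<close> ueq xm True in \<open>auto simp: arc_def\<close>)
    next
      case False
      show ?thesis
        by (rule chord_crossingI[where c = e and e = c])
          (use z(1) ord \<open>z \<noteq> x\<close> ueq xm False in \<open>auto simp: arc_def\<close>)
    qed
    moreover have "chord_crossing u z b" using cross_b[of z e c] z URV(3) by (auto simp: arc_def)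
    moreover have "chord_alignment u x b"
      using chord_alignment_nestedI[of x b u] chord_alignment_disjointI[of u x b] ord b by auto
    ultimately show False using no_crossed[OF xm(1) bm(1) xm(2)] by blast
  qed
  consider "m1 = m2" | "m1 < m2" | "m2 < m1" by linarith
  then show False
  proof cases
    case 1
    then have "\<not> U (u m1)" "\<not> V (u m1)" using inner[OF R12(1) _ m2(1)] outer[OF R12(1) _ m1(1)] by auto
    then have "u x1 = m1" "x1 = e1" "u x2 = m1" "x2 = e2" using x1 x2 1 by (auto simp: arc_def)
    then show False using ueq[of x1 x2] x1 x2 URV(2) by (auto simp: arc_def)
  next
    case 2
    then have "\<not> U (u m1)" using inner[OF R12(1) _ m2(1)] by auto
    then have "u x1 = m1" "x1 < m" "U x1" using x1 by (auto simp: arc_def)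
    have mb: "m2 < b" using R12 by (auto simp: R_def)
    obtain y where y: "y < m" "y \<notin> {Suc m2..B}" "u y \<in> {Suc m2..B}"
      using enters[of "Suc m2" B] mb b by auto
    have "\<not> V y"
    proof
      assume "V y"
      have "R (u y) \<or> U (u y)" using y(3) by (auto simp: R_def U_def)
      then show False
      proof
        assume "U (u y)"
        then show False using noUV[OF tail(2)[OF y(1)]] \<open>V y\<close> by blast
      next
        assume "R (u y)"
        then have "EV (u y)" using tail(2)[OF y(1)] \<open>V y\<close> unfolding EV_def by blast
        then show False using m2(2)[of "u y"] y(3) by auto
      qed
    qed
    then have Ry: "R y" "y \<le> m2" using y(1,2) mb by (auto simp: V_def R_def)
    have "\<not> U (u y)" using inner[OF Ry(1) _ m2(1)] Ry(2) by auto
    then have uy: "m2 < u y" "u y < b" using y(3) by (auto simp: U_def)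
    have "x2 \<noteq> y" using x2 uy Ry b by (auto simp: arc_def V_def R_def)
    have "chord_crossing u x2 y"
      by (rule chord_crossingI[where c = m2 and e = e2])
        (use x2 Ry uy \<open>x2 \<noteq> y\<close> ueq y(1) b in \<open>auto simp: arc_def V_def R_def\<close>)
    moreover have "chord_crossing u x2 0" using cross_0[OF x2] R12(2) URV(4) by blast
    moreover have "chord_alignment u 0 y"
      by (rule chord_alignment_nestedI) (use Ry uy b in \<open>auto simp: R_def\<close>)
    moreover have "x2 < m" using x2(1) by (simp add: arc_def)
    ultimately show False using no_crossed[OF bm(3) y(1)] by blast
  next
    case 3
    have mb: "0 < m1" "m1 < b" using R12 by (auto simp: R_def)
    obtain y where y: "y \<in> {m1..B}" "u y \<notin> {m1..B}" using no_invariant[of m1 B] mb b by auto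
    have ym: "y < m" using y(1) b by auto
    have "\<not> U y"
    proof
      assume "U y"
      have "V (u y) \<or> R (u y) \<and> u y < m1" using y(2) um[OF ym] mb by (auto simp: V_def R_def)
      then show False
      proof
        assume "V (u y)"
        then show False using noUV[OF tail(1)[OF ym] \<open>U y\<close>] by blast
      next
        assume a: "R (u y) \<and> u y < m1"
        then have "EU (u y)" using tail(2)[OF ym] \<open>U y\<close> unfolding EU_def by blast
        then show False using m1(2)[of "u y"] a by auto
      qed
    qed
    then have Ry: "R y" "m1 \<le> y" using y(1) mb by (auto simp: U_def R_def)
    have "\<not> V (u y)"
    proof
      assume "V (u y)"
      then have "EV y" using Ry(1) tail(1)[OF ym] unfolding EV_def by blast
      then show False using m2(2)[of y] 3 Ry(2) by auto
    qed
    then have uy: "0 < u y" "u y < m1" using y(2) um[OF ym] by (auto simp: V_def)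
    have "x1 \<noteq> y" using x1 uy Ry mb by (auto simp: arc_def U_def R_def)
    have "chord_crossing u x1 y"
      by (rule chord_crossingI[where c = m1 and e = e1])
        (use x1 Ry uy \<open>x1 \<noteq> y\<close> ueq ym b in \<open>auto simp: arc_def U_def R_def\<close>)
    moreover have "chord_crossing u x1 b" using cross_b[of x1 e1 m1] x1 R12(1) URV(3) by (auto simp: arc_def)
    moreover have "chord_alignment u y b"
      by (rule chord_alignment_disjointI) (use Ry uy b in \<open>auto simp: R_def\<close>)
    moreover have "x1 < m" using x1(1) by (simp add: arc_def)
    ultimately show False using no_crossed[OF ym bm(1)] by blast
  qed
qed

definition rk :: "nat set \<Rightarrow> nat \<Rightarrow> nat" where
  "rk S x = card {y \<in> S. y < x}"

lemma rk_nth: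
  assumes "finite S" "i < card S" shows "rk S (sorted_list_of_set S ! i) = i"
proof -
  let ?x = "sorted_list_of_set S ! i"
  have x: "?x \<in> S" using sorted_list_of_set_nth_in assms by blast
  have "card {y \<in> S. y \<le> ?x} = Suc i"
  proof (rule antisym)
    show "Suc i \<le> card {y \<in> S. y \<le> ?x}"
      using sorted_list_of_set_nth_le_iff[OF assms, of ?x] by simp
    show "card {y \<in> S. y \<le> ?x} \<le> Suc i"
    proof (rule ccontr)
      assume "\<not> ?thesis"
      then have lt: "Suc i < card {y \<in> S. y \<le> ?x}" by simp
      also have "\<dots> \<le> card S" using assms(1) by (intro card_mono) auto
      finally have i: "Suc i < card S" .
      then have "sorted_list_of_set S ! Suc i \<le> ?x" using sorted_list_of_set_nth_le_iff[OF assms(1) i] lt by simp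
      moreover have "?x \<le> sorted_list_of_set S ! Suc i" using i by (intro sorted_nth_mono) auto
      ultimately show False using sorted_list_of_set_nth_inj[of i S "Suc i"] i by simp
    qed
  qed
  moreover have "{y \<in> S. y \<le> ?x} = insert ?x {y \<in> S. y < ?x}" using x by auto
  ultimately show ?thesis using assms(1) by (simp add: rk_def)
qed

lemma rk_less_card: "finite S \<Longrightarrow> x \<in> S \<Longrightarrow> rk S x < card S"
  unfolding rk_def by (intro psubset_card_mono) auto

lemma nth_rk: "finite S \<Longrightarrow> x \<in> S \<Longrightarrow> sorted_list_of_set S ! rk S x = x"
  using sorted_list_of_set_index[of S x] rk_nth[of S] by auto

lemma rk_less_iff: "finite S \<Longrightarrow> x \<in> S \<Longrightarrow> y \<in> S \<Longrightarrow> rk S x < rk S y \<longleftrightarrow> x < y"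
proof -
  have "rk S x < rk S y" if "finite S" "x \<in> S" "x < y" for x y
    unfolding rk_def using that by (intro psubset_card_mono) auto
  then show "finite S \<Longrightarrow> x \<in> S \<Longrightarrow> y \<in> S \<Longrightarrow> rk S x < rk S y \<longleftrightarrow> x < y"
    by (metis linorder_neqE_nat order_less_asym order_less_irrefl)
qed

lemma rk_eq_iff: "finite S \<Longrightarrow> x \<in> S \<Longrightarrow> y \<in> S \<Longrightarrow> rk S x = rk S y \<longleftrightarrow> x = y"
  using rk_less_iff[of S x y] rk_less_iff[of S y x] by (metis linorder_neqE_nat order_less_irrefl)

lemma spirograph_on_iff:
  assumes "finite S" "w ` S = S"
  shows "spirograph_on w S \<longleftrightarrow> (\<exists>t\<in>{1..card S}. \<forall>x\<in>S. rk S (w x) = (rk S x + t) mod card S)"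
proof -
  have "(\<forall>i<card S. w (sorted_list_of_set S ! i) = sorted_list_of_set S ! ((i + t) mod card S)) \<longleftrightarrow>
    (\<forall>x\<in>S. rk S (w x) = (rk S x + t) mod card S)" (is "?L \<longleftrightarrow> ?R") for t
  proof
    assume ?L
    show ?R
    proof
      fix x assume x: "x \<in> S"
      have m: "(rk S x + t) mod card S < card S" using rk_less_card[OF assms(1) x] by (intro mod_less_divisor) auto
      have "w x = sorted_list_of_set S ! ((rk S x + t) mod card S)"
        using \<open>?L\<close> rk_less_card[OF assms(1) x] nth_rk[OF assms(1) x] by metis
      then show "rk S (w x) = (rk S x + t) mod card S" using rk_nth[OF assms(1) m] by simp
    qed
  next
    assume ?R
    show ?L
    proof (intro allI impI)
      fix i assume i: "i < card S"
      let ?x = "sorted_list_of_set S ! i"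
      have x: "?x \<in> S" using sorted_list_of_set_nth_in[OF assms(1) i] .
      then have "w ?x \<in> S" using assms(2) by blast
      then have "w ?x = sorted_list_of_set S ! rk S (w ?x)" using nth_rk[OF assms(1)] by simp
      also have "rk S (w ?x) = (i + t) mod card S" using \<open>?R\<close> x rk_nth[OF assms(1) i] by simp
      finally show "w ?x = sorted_list_of_set S ! ((i + t) mod card S)" .
    qed
  qed
  then show ?thesis by (simp add: spirograph_on_def)
qed

definition cyc_dist :: "nat set \<Rightarrow> nat \<Rightarrow> nat \<Rightarrow> nat" where
  "cyc_dist S r x = cyc_pos (card S) (Suc (rk S r)) (Suc (rk S x))"

context
  fixes S :: "nat set"
  assumes fin: "finite S"
begin

lemma Suc_rk_mem: "x \<in> S \<Longrightarrow> Suc (rk S x) \<in> {1..card S}"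
  using rk_less_card[OF fin] by (simp add: Suc_le_eq)

lemma cyc_dist_eq:
  assumes "r \<in> S" "x \<in> S"
  shows "cyc_dist S r x = (if rk S r \<le> rk S x then rk S x - rk S r else rk S x + card S - rk S r)"
  unfolding cyc_dist_def using cyc_pos_eq[OF Suc_rk_mem[OF assms(1)] Suc_rk_mem[OF assms(2)]] by simp

lemma bij_betw_cyc_dist:
  assumes "r \<in> S" shows "bij_betw (cyc_dist S r) S {..<card S}"
proof -
  have "inj_on (cyc_dist S r) S"
  proof (rule inj_onI)
    fix x y assume "x \<in> S" "y \<in> S" "cyc_dist S r x = cyc_dist S r y"
    then show "x = y"
      using cyc_pos_inj[OF Suc_rk_mem[OF assms] Suc_rk_mem[of x] Suc_rk_mem[of y]] rk_eq_iff[OF fin, of x y]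
      by (simp add: cyc_dist_def)
  qed
  moreover have "cyc_dist S r ` S \<subseteq> {..<card S}"
    using cyc_pos_less[OF Suc_rk_mem[OF assms] Suc_rk_mem] by (auto simp: cyc_dist_def)
  ultimately show ?thesis
    unfolding bij_betw_def using card_subset_eq[of "{..<card S}" "cyc_dist S r ` S"] by (simp add: card_image)
qed

lemma clockwise_cyc_dist:
  assumes "r \<in> S" "x \<in> S" "y \<in> S" "z \<in> S"
  shows "clockwise (cyc_dist S r x) (cyc_dist S r y) (cyc_dist S r z) \<longleftrightarrow> clockwise x y z"
proof -
  have "clockwise (Suc (rk S x)) (Suc (rk S y)) (Suc (rk S z)) \<longleftrightarrow> clockwise x y z"
    unfolding clockwise_def by (simp add: rk_less_iff[OF fin] assms)
  then show ?thesis unfolding cyc_dist_def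
    using clockwise_cyc_pos[OF Suc_rk_mem[OF assms(1)] Suc_rk_mem[OF assms(2)] Suc_rk_mem[OF assms(3)]
        Suc_rk_mem[OF assms(4)]] by simp
qed

end

lemma adjacent_heads_arith:
  fixes \<alpha> \<beta> y z m :: nat
  defines "d \<equiv> \<lambda>i j. if i \<le> j then j - i else j + m - i"
  assumes "\<alpha> < m" "\<beta> < m" "y < m" "z = (if Suc y = m then 0 else Suc y)" "0 < d \<beta> y" "d \<beta> y + 2 \<le> d \<alpha> z"
  shows "Suc (d \<alpha> y) = d \<alpha> z \<and> d \<alpha> \<beta> + d \<beta> y = d \<alpha> y \<and> 0 < d \<alpha> \<beta>"
proof -
  have *: "i \<le> j \<Longrightarrow> d i j + i = j" "j < i \<Longrightarrow> i < m \<Longrightarrow> d i j + i = j + m" for i j by (auto simp: d_def)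
  have A: "Suc (d \<alpha> y) = d \<alpha> z"
    using *(1)[of \<alpha> y] *(2)[of y \<alpha>] *(1)[of \<alpha> z] *(2)[of z \<alpha>] assms(2-) by (cases "\<alpha> \<le> y"; cases "\<alpha> \<le> z"; cases "Suc y = m"; simp)
  have "d \<alpha> \<beta> + d \<beta> y = d \<alpha> y"
    using A *(1)[of \<alpha> y] *(2)[of y \<alpha>] *(1)[of \<beta> y] *(2)[of y \<beta>] *(1)[of \<alpha> \<beta>] *(2)[of \<beta> \<alpha>] assms(2,3,4,7)
    by (cases "\<alpha> \<le> y"; cases "\<beta> \<le> y"; cases "\<alpha> \<le> \<beta>"; simp)
  then show ?thesis using A assms(7) by simp
qed

context decorated_perm
begin

definition unsplittable :: "nat set \<Rightarrow> bool" where
  "unsplittable S \<longleftrightarrow> (\<forall>T. T \<subseteq> S \<and> T \<noteq> {} \<and> T \<noteq> S \<and> w ` T = T \<longrightarrow>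
     (\<exists>a\<in>T. \<exists>c\<in>T. \<exists>b\<in>S - T. \<exists>d\<in>S - T. clockwise a b c \<and> clockwise a c d))"

lemma no_fixed_point_if_unsplittable:
  assumes "unsplittable S" "card S \<noteq> 1" "x \<in> S"
  shows "w x \<noteq> x"
proof
  assume "w x = x"
  moreover have "{x} \<noteq> S" using assms(2) by auto
  ultimately show False
    using assms(1,3) unfolding unsplittable_def by (auto dest!: spec[of _ "{x}"] simp: clockwise_def)
qed

lemma spirograph_if_unsplittable:
  assumes S: "S \<subseteq> {1..n}" "w ` S = S" "S \<noteq> {}" and un: "unsplittable S"
    and nc: "\<not> (\<exists>i\<in>{1..n}. \<exists>j\<in>{1..n}. crossed_alignment n w C i j)"
  shows "spirograph_on w S"
proof (cases "card S = 1")
  case True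
  then obtain s where "S = {s}" by (auto simp: card_1_singleton_iff)
  then show ?thesis using S(2) by (simp add: spirograph_on_def)
next
  case False
  have fin: "finite S" using S(1) finite_subset by auto
  define m where "m = card S"
  have m: "2 \<le> m" using False S(3) fin card_gt_0_iff[of S] by (simp add: m_def)
  have wS: "w x \<in> S" if "x \<in> S" for x using S(2) that by blast
  have bijw: "bij_betw w S S" using S(2) w_eq by (auto simp: bij_betw_def inj_on_def)
  have no_fix: "w x \<noteq> x" if "x \<in> S" for x
    by (rule no_fixed_point_if_unsplittable[OF un False that])
  define g where "g x = cyc_dist S x (w x)" for x
  note D = cyc_dist_eq[OF fin, folded m_def]
  have rkm: "rk S x < m" if "x \<in> S" for x using rk_less_card[OF fin that] by (simp add: m_def)
  have rke: "rk S x = rk S y \<longleftrightarrow> x = y" if "x \<in> S" "y \<in> S" for x y using rk_eq_iff[OF fin that] .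
  have g: "0 < g x" "g x < m" if "x \<in> S" for x
    unfolding g_def using D[OF that wS[OF that]] rkm[OF that] rkm[OF wS[OF that]] rke[OF that wS[OF that]]
      no_fix[OF that] by auto
  have "\<exists>x\<in>S. rk S (w x) = y" if "y < m" for y
  proof -
    have "sorted_list_of_set S ! y \<in> w ` S" using sorted_list_of_set_nth_in[OF fin] that S(2) by (simp add: m_def)
    then obtain x where "x \<in> S" "w x = sorted_list_of_set S ! y" by auto
    then have "rk S (w x) = y" using rk_nth[OF fin, of y] that by (simp add: m_def)
    then show ?thesis using \<open>x \<in> S\<close> by blast
  qed
  then have "\<forall>y. \<exists>x. y < m \<longrightarrow> x \<in> S \<and> rk S (w x) = y" by blast
  then obtain tl where tl: "\<And>y. y < m \<Longrightarrow> tl y \<in> S" "\<And>y. y < m \<Longrightarrow> rk S (w (tl y)) = y"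
    using choice[of "\<lambda>y x. y < m \<longrightarrow> x \<in> S \<and> rk S (w x) = y"] by auto
  define nxt where "nxt y = (if Suc y = m then 0 else Suc y)" for y
  have nxt: "nxt y < m" if "y < m" for y using that m by (auto simp: nxt_def)
  show ?thesis
  proof (cases "\<forall>y<m. g (tl (nxt y)) \<le> g (tl y) + 1")
    case True
    have le: "g (tl (nxt y)) \<le> g (tl y)" if y: "y < m" for y
    proof (rule ccontr)
      assume "\<not> ?thesis"
      then have eq: "g (tl (nxt y)) = g (tl y) + 1" using True y by (metis Suc_eq_plus1 le_antisym not_less_eq_eq)
      have s: "tl y \<in> S" "tl (nxt y) \<in> S" using tl y nxt by auto
      have "rk S (tl (nxt y)) = rk S (tl y)"
        using eq D[OF s(1) wS[OF s(1)]] D[OF s(2) wS[OF s(2)]] tl(2)[OF y] tl(2)[OF nxt[OF y]] rkm[OF s(1)] rkm[OF s(2)] y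
        by (auto simp: g_def nxt_def split: if_splits)
      then have "tl (nxt y) = tl y" using rke s by simp
      then show False using eq by simp
    qed
    have mono: "g (tl y) \<le> g (tl z)" if "z \<le> y" "y < m" for y z
      using that
    proof (induction y)
      case (Suc y)
      then show ?case using le[of y] by (cases "z = Suc y") (auto simp: nxt_def)
    qed simp
    have "g (tl 0) \<le> g (tl (m - 1))" using le[of "m - 1"] m by (simp add: nxt_def)
    then have const: "g (tl y) = g (tl 0)" if "y < m" for y
    proof -
      have "y \<le> m - 1" "m - 1 < m" using that by auto
      then have "g (tl (m - 1)) \<le> g (tl y)" by (rule mono)
      then show ?thesis using mono[of 0 y] that \<open>g (tl 0) \<le> g (tl (m - 1))\<close> by simp
    qed
    define t where "t = g (tl 0)"
    have gt: "g x = t" if x: "x \<in> S" for x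
    proof -
      have y: "rk S (w x) < m" using rkm wS x by blast
      have "w (tl (rk S (w x))) = w x"
        using rke[OF wS[OF tl(1)[OF y]] wS[OF x]] tl(2)[OF y] by simp
      then have "tl (rk S (w x)) = x" using w_eq by simp
      then show ?thesis using const[OF y] by (simp add: t_def)
    qed
    have t: "t \<in> {1..card S}" using g[OF tl(1)[of 0]] m by (simp add: t_def m_def)
    have "rk S (w x) = (rk S x + t) mod card S" if x: "x \<in> S" for x
    proof -
      have "t < m" using gt[OF x] g[OF x] by simp
      show ?thesis
      proof (cases "rk S x \<le> rk S (w x)")
        case True
        then have "rk S x + t = rk S (w x)" using gt[OF x] D[OF x wS[OF x]] by (simp add: g_def)
        then show ?thesis using rkm[OF wS[OF x]] by (simp add: m_def)
      next
        case False
        then have "rk S x + t = rk S (w x) + m"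
          using gt[OF x] D[OF x wS[OF x]] rkm[OF x] by (simp add: g_def)
        then show ?thesis using rkm[OF wS[OF x]] by (simp add: m_def)
      qed
    qed
    then show ?thesis unfolding spirograph_on_iff[OF fin S(2)] using t by blast
  next
    case False
    then obtain y where y: "y < m" "g (tl y) + 2 \<le> g (tl (nxt y))" by auto
    define a where "a = tl (nxt y)"
    define b where "b = tl y"
    have ab: "a \<in> S" "b \<in> S" "rk S (w b) = y" "rk S (w a) = nxt y" "g b + 2 \<le> g a"
      using tl y nxt by (auto simp: a_def b_def)
    define p where "p = cyc_dist S a"
    define ip where "ip = inv_into S p"
    define u where "u = (\<lambda>x. p (w (ip x)))"
    have bijp: "bij_betw p S {..<m}" unfolding p_def m_def by (rule bij_betw_cyc_dist[OF fin ab(1)])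
    have ip: "ip x \<in> S" "p (ip x) = x" if "x < m" for x
      using that bijp unfolding ip_def bij_betw_def by (auto simp: inv_into_into f_inv_into_f)
    have ip_p: "ip (p x) = x" if "x \<in> S" for x
      using that bijp unfolding ip_def bij_betw_def by simp
    have pm: "p x < m" if "x \<in> S" for x using that bijp by (auto simp: bij_betw_def)
    have pe: "p x = p z \<longleftrightarrow> x = z" if "x \<in> S" "z \<in> S" for x z
      using that bijp by (auto simp: bij_betw_def inj_on_def)
    have cw: "clockwise (p x) (p y) (p z) \<longleftrightarrow> clockwise x y z" if "x \<in> S" "y \<in> S" "z \<in> S" for x y z
      unfolding p_def by (rule clockwise_cyc_dist[OF fin ab(1) that])
    have cwi: "clockwise i j l \<longleftrightarrow> clockwise (ip i) (ip j) (ip l)" if "i < m" "j < m" "l < m" for i j l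
      using cw[of "ip i" "ip j" "ip l"] that ip by simp
    have um: "u i < m" "ip (u i) = w (ip i)" if "i < m" for i
      using that ip pm wS ip_p by (auto simp: u_def)
    have ipe: "i = j \<longleftrightarrow> ip i = ip j" if "i < m" "j < m" for i j using ip(2) that by metis
    have cross: "crossing w C (ip i) (ip j)" if ij: "i < m" "j < m" and c: "chord_crossing u i j" for i j
    proof -
      have mem: "ip i \<in> {1..n}" "ip j \<in> {1..n}" using ip(1)[OF ij(1)] ip(1)[OF ij(2)] S(1) by auto
      have "u i = j \<longleftrightarrow> w (ip i) = ip j" "u j = i \<longleftrightarrow> w (ip j) = ip i"
        using ipe[OF um(1) ij(2)] ipe[OF um(1) ij(1)] um(2) ij by auto
      moreover have "clockwise i j (u i) = clockwise (ip i) (ip j) (w (ip i))"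
        "clockwise i (u j) (u i) = clockwise (ip i) (w (ip j)) (w (ip i))"
        using cwi um ij by auto
      ultimately show ?thesis
        using c ipe[OF ij] no_fix ip ij unfolding crossing_iff[OF mem] chord_crossing_def by simp
    qed
    have cross': "chord_crossing u i j" if ij: "i < m" "j < m" and c: "crossing w C (ip i) (ip j)" for i j
    proof -
      have mem: "ip i \<in> {1..n}" "ip j \<in> {1..n}" using ip(1)[OF ij(1)] ip(1)[OF ij(2)] S(1) by auto
      have "u i = j \<longleftrightarrow> w (ip i) = ip j" "u j = i \<longleftrightarrow> w (ip j) = ip i"
        using ipe[OF um(1) ij(2)] ipe[OF um(1) ij(1)] um(2) ij by auto
      moreover have "clockwise i j (u i) = clockwise (ip i) (ip j) (w (ip i))"
        "clockwise i (u j) (u i) = clockwise (ip i) (w (ip j)) (w (ip i))"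
        using cwi um ij by auto
      ultimately show ?thesis
        using c ipe[OF ij] unfolding crossing_iff[OF mem] chord_crossing_def by auto
    qed
    have False
    proof (rule crossed_alignment_if_adjacent_heads[where u = u and m = m and b = "p b" and B = "p (w b)"])
      show "bij_betw u {..<m} {..<m}"
      proof -
        have "bij_betw ip {..<m} S" unfolding ip_def using bijp by (rule bij_betw_inv_into)
        then show ?thesis unfolding u_def
          using bij_betw_trans[OF bij_betw_trans[OF _ bijw] bijp] by (simp add: comp_def)
      qed
      show "u x \<noteq> x" if "x < m" for x
        using um(2)[OF that] no_fix[OF ip(1)[OF that]] by metis
      show False if "i < m" "j < m" "h < m" "chord_alignment u i j" "chord_crossing u h i" "chord_crossing u h j" for i j h
      proof -
        have mem: "ip i \<in> {1..n}" "ip j \<in> {1..n}" "ip h \<in> {1..n}" using ip(1)[OF that(1)] ip(1)[OF that(2)] ip(1)[OF that(3)] S(1) by auto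
        have ne: "ip i \<noteq> ip j" using that(4) ipe[OF that(1,2)] by (auto simp: chord_alignment_def)
        have nf: "w (ip i) \<noteq> ip i" "w (ip j) \<noteq> ip j" using no_fix ip that by auto
        have "\<not> crossing w C (ip i) (ip j)" using that(4) cross'[OF that(1,2)] by (auto simp: chord_alignment_def)
        moreover have "clockwise (ip i) (ip j) (w (ip i)) \<noteq> clockwise (ip j) (ip i) (w (ip j))"
          using that(4) cwi[OF that(1,2) um(1)[OF that(1)]] cwi[OF that(2,1) um(1)[OF that(2)]] um(2) that
          by (simp add: chord_alignment_def)
        ultimately have "alignment w C (ip i) (ip j)"
          using ne nf unfolding alignment_def left_of_tail_iff[OF mem(1,2) ne] left_of_tail_iff[OF mem(2,1) ne[symmetric]]
          by simp
        then have "crossed_alignment n w C (ip i) (ip j)"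
          unfolding crossed_alignment_def using cross[OF that(3,1,5)] cross[OF that(3,2,6)] mem by blast
        then show False using nc mem by blast
      qed
      show "\<exists>x\<in>{c..d}. u x \<notin> {c..d}" if cd: "c \<le> d" "d < m" "0 < c \<or> Suc d < m" for c d
      proof (rule ccontr)
        assume no: "\<not> ?thesis"
        define T where "T = {x \<in> S. c \<le> p x \<and> p x \<le> d}"
        have "w ` T \<subseteq> T"
        proof
          fix z assume "z \<in> w ` T"
          then obtain x where x: "x \<in> S" "c \<le> p x" "p x \<le> d" "z = w x" by (auto simp: T_def)
          then have "u (p x) \<in> {c..d}" using no by auto
          then show "z \<in> T" using x ip_p wS by (simp add: u_def T_def)
        qed
        moreover have "card (w ` T) = card T" using w_eq by (intro card_image) (auto simp: inj_on_def)
        ultimately have "w ` T = T" using fin by (intro card_subset_eq) (auto simp: T_def)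
        moreover have "ip c \<in> T" using ip[of c] cd by (simp add: T_def)
        moreover have "T \<noteq> S"
        proof (cases "0 < c")
          case True
          then have "ip 0 \<in> S - T" using ip[of 0] m by (simp add: T_def)
          then show ?thesis by blast
        next
          case False
          then have "ip (Suc d) \<in> S - T" using ip[of "Suc d"] cd by (simp add: T_def)
          then show ?thesis by blast
        qed
        moreover have "T \<subseteq> S" by (auto simp: T_def)
        ultimately have "T \<subseteq> S \<and> T \<noteq> {} \<and> T \<noteq> S \<and> w ` T = T" by blast
        then have "\<exists>a\<in>T. \<exists>c\<in>T. \<exists>b\<in>S - T. \<exists>d\<in>S - T. clockwise a b c \<and> clockwise a c d"
          by (rule un[unfolded unsplittable_def, rule_format])
        then obtain x1 x2 y1 y2 where q: "x1 \<in> T" "x2 \<in> T" "y1 \<in> S - T" "y2 \<in> S - T"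
          "clockwise x1 y1 x2" "clockwise x1 x2 y2" by blast
        then have "clockwise (p x1) (p y1) (p x2)" "clockwise (p x1) (p x2) (p y2)"
          using cw by (auto simp: T_def)
        then show False using q(1-4) by (auto simp: T_def clockwise_def)
      qed
      have nf: "w b \<noteq> b" using no_fix ab by blast
      have "p a = 0" using D[OF ab(1,1)] by (simp add: p_def)
      moreover have "Suc (p (w b)) = p (w a)" "p b + g b = p (w b)" "0 < p b"
        using adjacent_heads_arith[OF rkm[OF ab(1)] rkm[OF ab(2)] y(1) ab(4)[unfolded nxt_def]]
          ab(5) g(1)[OF ab(2)] unfolding p_def g_def D[OF ab(1) wS[OF ab(1)]] D[OF ab(1) wS[OF ab(2)]]
          D[OF ab(2) wS[OF ab(2)]] D[OF ab(1,2)] ab(3) by auto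
      moreover have "0 < g b" using g ab by blast
      ultimately show "0 < p b" "p b < p (w b)" "u (p b) = p (w b)" "u 0 = Suc (p (w b))" "Suc (p (w b)) < m"
        using ip_p[OF ab(1)] ip_p[OF ab(2)] pm[OF wS[OF ab(1)]] by (auto simp: u_def)
    qed
    then show ?thesis ..
  qed
qed

lemma ex_spirograph_partition:
  assumes "S \<subseteq> {1..n}" "w ` S = S"
    and nc: "\<not> (\<exists>i\<in>{1..n}. \<exists>j\<in>{1..n}. crossed_alignment n w C i j)"
  shows "\<exists>P. partition_on S P \<and> noncrossing P \<and> (\<forall>B\<in>P. w ` B = B \<and> spirograph_on w B \<and> (card B = 1 \<or> (\<forall>x\<in>B. w x \<noteq> x)))"
  using assms(1,2)
proof (induction "card S" arbitrary: S rule: less_induct)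
  case less
  have fin: "finite S" using less.prems(1) by (rule finite_subset) simp
  show ?case
  proof (cases "unsplittable S")
    case True
    show ?thesis
    proof (cases "S = {}")
      case True
      then show ?thesis by (intro exI[of _ "{}"]) (auto simp: partition_on_def noncrossing_def)
    next
      case False
      then show ?thesis
        using spirograph_if_unsplittable[OF less.prems False True nc] less.prems partition_on_space[OF False]
          no_fixed_point_if_unsplittable[OF True]
        by (intro exI[of _ "{S}"]) (auto simp: noncrossing_def)
    qed
  next
    case False
    then obtain T where T': "T \<subseteq> S \<and> T \<noteq> {} \<and> T \<noteq> S \<and> w ` T = T"
      "\<not> (\<exists>a\<in>T. \<exists>c\<in>T. \<exists>b\<in>S - T. \<exists>d\<in>S - T. clockwise a b c \<and> clockwise a c d)"
      unfolding unsplittable_def not_all not_imp by (elim exE conjE) (rule that, auto)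
    then have T: "T \<subseteq> S" "T \<noteq> {}" "T \<noteq> S" "w ` T = T" by simp_all
    have sep: "\<not> (clockwise a b c \<and> clockwise a c d)"
      if "a \<in> T" "c \<in> T" "b \<in> S - T" "d \<in> S - T" for a b c d using T'(2) that by blast
    have "w ` (S - T) = S - T" using image_set_diff[OF permutes_inj[OF perm], of S T] T(4) less.prems(2) by simp
    moreover have "card (S - T) < card S" using T fin by (intro psubset_card_mono) auto
    ultimately obtain P2 where P2: "partition_on (S - T) P2" "noncrossing P2" "\<forall>B\<in>P2. w ` B = B \<and> spirograph_on w B \<and> (card B = 1 \<or> (\<forall>x\<in>B. w x \<noteq> x))"
      using less.hyps[of "S - T"] less.prems by blast
    have "card T < card S" using T fin by (intro psubset_card_mono) auto
    then obtain P1 where P1: "partition_on T P1" "noncrossing P1" "\<forall>B\<in>P1. w ` B = B \<and> spirograph_on w B \<and> (card B = 1 \<or> (\<forall>x\<in>B. w x \<noteq> x))"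
      using less.hyps[of T] less.prems T by blast
    have "partition_on S (P1 \<union> P2)"
    proof -
      have u: "\<Union>P1 = T" "\<Union>P2 = S - T" "{} \<notin> P1" "{} \<notin> P2" and d: "disjoint P1" "disjoint P2"
        using P1(1) P2(1) by (auto simp: partition_on_def)
      have "disjoint (P1 \<union> P2)" by (rule disjoint_union[OF d]) (use u in blast)
      moreover have "\<Union>(P1 \<union> P2) = S" unfolding Union_Un_distrib u using T(1) by blast
      ultimately show ?thesis using u(3,4) by (simp add: partition_on_def)
    qed
    moreover have "noncrossing (P1 \<union> P2)"
      unfolding noncrossing_def
    proof (intro ballI impI notI)
      fix A B assume AB: "A \<in> P1 \<union> P2" "B \<in> P1 \<union> P2" "A \<noteq> B"
        "\<exists>a b c d. a < b \<and> b < c \<and> c < d \<and> a \<in> A \<and> c \<in> A \<and> b \<in> B \<and> d \<in> B"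
      then obtain a b c d where q: "a < b" "b < c" "c < d" "a \<in> A" "c \<in> A" "b \<in> B" "d \<in> B" by blast
      have "\<Union>P1 = T" "\<Union>P2 = S - T" using P1(1) P2(1) by (simp_all add: partition_on_def)
      then have sub: "\<And>A. A \<in> P1 \<Longrightarrow> A \<subseteq> T" "\<And>A. A \<in> P2 \<Longrightarrow> A \<subseteq> S - T" by blast+
      have cw: "clockwise a b c" "clockwise a c d" "clockwise b c d" "clockwise b d a"
        using q by (auto simp: clockwise_def)
      consider "A \<in> P1" "B \<in> P1" | "A \<in> P2" "B \<in> P2" | "A \<in> P1" "B \<in> P2" | "A \<in> P2" "B \<in> P1" using AB by blast
      then show False
      proof cases
        case 1
        from P1(2)[unfolded noncrossing_def, THEN bspec, OF 1(1), THEN bspec, OF 1(2), THEN mp, OF AB(3)] AB(4)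
        show ?thesis by (rule notE)
      next
        case 2
        from P2(2)[unfolded noncrossing_def, THEN bspec, OF 2(1), THEN bspec, OF 2(2), THEN mp, OF AB(3)] AB(4)
        show ?thesis by (rule notE)
      next
        case 3
        then have "a \<in> T" "c \<in> T" "b \<in> S - T" "d \<in> S - T" using sub(1)[OF 3(1)] sub(2)[OF 3(2)] q by blast+
        then show ?thesis using sep[of a c b d] cw(1,2) by blast
      next
        case 4
        then have "b \<in> T" "d \<in> T" "c \<in> S - T" "a \<in> S - T" using sub(1)[OF 4(2)] sub(2)[OF 4(1)] q by blast+
        then show ?thesis using sep[of b d c a] cw(3,4) by blast
      qed
    qed
    moreover have "\<forall>B\<in>P1 \<union> P2. w ` B = B \<and> spirograph_on w B \<and> (card B = 1 \<or> (\<forall>x\<in>B. w x \<noteq> x))"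
      unfolding ball_Un using P1(3) P2(3) by (rule conjI)
    ultimately show ?thesis by (intro exI[of _ "P1 \<union> P2"] conjI)
  qed
qed

lemma union_of_spirographs_if_no_crossed_alignment:
  assumes "\<not> (\<exists>i\<in>{1..n}. \<exists>j\<in>{1..n}. crossed_alignment n w C i j)"
  shows "union_of_spirographs n w"
proof -
  obtain P where P: "partition_on {1..n} P" "noncrossing P"
      "\<forall>B\<in>P. w ` B = B \<and> spirograph_on w B \<and> (card B = 1 \<or> (\<forall>x\<in>B. w x \<noteq> x))"
    using ex_spirograph_partition[OF order_refl permutes_image[OF perm] assms] by (elim exE conjE) (rule that)
  then show ?thesis unfolding union_of_spirographs_def by (intro exI[of _ P] conjI) auto
qed

end

section \<open>Direct sums of uniform matroids\<close>

definition cyc_rank :: "nat \<Rightarrow> nat \<Rightarrow> nat set \<Rightarrow> nat \<Rightarrow> nat" where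
  "cyc_rank n r B x = card {y \<in> B. cyc_pos n r y < cyc_pos n r x}"

lemma cyc_rank_eq:
  assumes r: "r \<in> {1..n}" and B: "B \<subseteq> {1..n}" and x: "x \<in> B"
  shows "cyc_rank n r B x =
    (if r \<le> x then rk B x - card {y \<in> B. y < r} else rk B x + card B - card {y \<in> B. y < r})"
proof -
  have fin: "finite B" using B by (rule finite_subset) simp
  have iff: "cyc_pos n r y < cyc_pos n r x \<longleftrightarrow> (if (r \<le> y) = (r \<le> x) then y < x else r \<le> y)" if "y \<in> B" for y
    using cyc_pos_less_iff[OF r, of y x] that B x by blast
  show ?thesis
  proof (cases "r \<le> x")
    case True
    then have "{y \<in> B. cyc_pos n r y < cyc_pos n r x} = {y \<in> B. y < x} - {y \<in> B. y < r}" using iff by (auto split: if_splits)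
    moreover have "{y \<in> B. y < r} \<subseteq> {y \<in> B. y < x}" using True by auto
    ultimately show ?thesis using True fin by (simp add: cyc_rank_def rk_def card_Diff_subset)
  next
    case False
    then have "{y \<in> B. cyc_pos n r y < cyc_pos n r x} = {y \<in> B. y < x} \<union> (B - {y \<in> B. y < r})" using iff by (auto split: if_splits)
    moreover have "{y \<in> B. y < x} \<inter> (B - {y \<in> B. y < r}) = {}" using False by auto
    ultimately have "cyc_rank n r B x = rk B x + (card B - card {y \<in> B. y < r})"
      using fin by (simp add: cyc_rank_def rk_def card_Un_disjoint card_Diff_subset)
    moreover have "card {y \<in> B. y < r} \<le> card B" using fin by (intro card_mono) auto
    ultimately show ?thesis using False by simp
  qed
qed

lemma cyc_rank_less_iff:
  assumes "finite B" "x \<in> B" "y \<in> B"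
  shows "cyc_rank n r B x < cyc_rank n r B y \<longleftrightarrow> cyc_pos n r x < cyc_pos n r y"
proof
  assume lt: "cyc_pos n r x < cyc_pos n r y"
  have "{z \<in> B. cyc_pos n r z < cyc_pos n r x} \<subset> {z \<in> B. cyc_pos n r z < cyc_pos n r y}"
    using lt assms by auto
  then show "cyc_rank n r B x < cyc_rank n r B y"
    unfolding cyc_rank_def using assms(1) by (intro psubset_card_mono) auto
next
  assume lt: "cyc_rank n r B x < cyc_rank n r B y"
  show "cyc_pos n r x < cyc_pos n r y"
  proof (rule ccontr)
    assume "\<not> ?thesis"
    then have "cyc_rank n r B y \<le> cyc_rank n r B x"
      unfolding cyc_rank_def using assms(1) by (intro card_mono) auto
    then show False using lt by simp
  qed
qed

lemma cyc_rank_less_card: "finite B \<Longrightarrow> x \<in> B \<Longrightarrow> cyc_rank n r B x < card B"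
  unfolding cyc_rank_def by (intro psubset_card_mono) auto

lemma card_cyc_rank_less:
  assumes r: "r \<in> {1..n}" and B: "B \<subseteq> {1..n}" and k: "k \<le> card B"
  shows "card {x \<in> B. cyc_rank n r B x < k} = k"
proof -
  have fin: "finite B" using B by (rule finite_subset) simp
  have inj: "inj_on (cyc_rank n r B) B"
  proof (rule inj_onI)
    fix x y assume xy: "x \<in> B" "y \<in> B" "cyc_rank n r B x = cyc_rank n r B y"
    then have "\<not> cyc_pos n r x < cyc_pos n r y" "\<not> cyc_pos n r y < cyc_pos n r x"
      using cyc_rank_less_iff[OF fin] by (metis order_less_irrefl)+
    moreover have "x \<in> {1..n}" "y \<in> {1..n}" using xy B by blast+
    ultimately show "x = y" using cyc_pos_inj[OF r, of x y] by auto
  qed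
  have "cyc_rank n r B ` B \<subseteq> {..<card B}" using cyc_rank_less_card[OF fin] by auto
  then have "cyc_rank n r B ` B = {..<card B}" using inj by (intro card_subset_eq) (auto simp: card_image)
  then have "{..<k} \<subseteq> cyc_rank n r B ` B" using k by auto
  then have "cyc_rank n r B ` {x \<in> B. cyc_rank n r B x < k} = {..<k}" by auto
  moreover have "inj_on (cyc_rank n r B) {x \<in> B. cyc_rank n r B x < k}" using inj by (rule inj_on_subset) auto
  ultimately show ?thesis by (metis card_image card_lessThan)
qed

lemma cyc_rank_rotation:
  assumes r: "r \<in> {1..n}" and B: "B \<subseteq> {1..n}" and xy: "x \<in> B" "y \<in> B"
    and t: "t < card B" "rk B y = (rk B x + t) mod card B"
  shows "cyc_rank n r B y = (cyc_rank n r B x + t) mod card B"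
proof -
  have fin: "finite B" using B by (rule finite_subset) simp
  let ?m = "card B" and ?s = "card {y \<in> B. y < r}"
  have le: "?s \<le> rk B z" if "r \<le> z" "z \<in> B" for z unfolding rk_def using fin that by (intro card_mono) auto
  have gt: "rk B z < ?s" if "z < r" "z \<in> B" for z
    unfolding rk_def using fin that by (intro psubset_card_mono) auto
  have sm: "?s \<le> ?m" using fin by (intro card_mono) auto
  have rot: "cyc_rank n r B z = (rk B z + ?m - ?s) mod ?m" if z: "z \<in> B" for z
  proof (cases "r \<le> z")
    case True
    then have "rk B z + ?m - ?s = (rk B z - ?s) + ?m" using le[OF True z] by simp
    then have "(rk B z + ?m - ?s) mod ?m = (rk B z - ?s) mod ?m" by simp
    also have "\<dots> = rk B z - ?s" using rk_less_card[OF fin z] by (intro mod_less) simp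
    finally show ?thesis using cyc_rank_eq[OF r B z] True by simp
  next
    case False
    then have "rk B z + ?m - ?s < ?m" using gt[of z] z sm by simp
    then show ?thesis using cyc_rank_eq[OF r B z] False by simp
  qed
  have "cyc_rank n r B y = (((rk B x + t) mod ?m) + (?m - ?s)) mod ?m"
    using rot[OF xy(2)] t(2) sm by simp
  also have "\<dots> = ((rk B x + (?m - ?s)) + t) mod ?m" by (simp add: mod_add_left_eq ac_simps)
  also have "\<dots> = (((rk B x + (?m - ?s)) mod ?m) + t) mod ?m" by (simp add: mod_add_left_eq)
  finally show ?thesis using rot[OF xy(1)] sm by simp
qed

locale block_positroid = positroid_data +
  fixes P :: "nat set set" and \<kappa> :: "nat set \<Rightarrow> nat"
  assumes part: "partition_on {1..n} P"
    and inv: "\<And>B. B \<in> P \<Longrightarrow> w ` B = B"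
    and \<kappa>_le: "\<And>B. B \<in> P \<Longrightarrow> \<kappa> B \<le> card B"
    and initial: "\<And>r B x. r \<in> {1..n} \<Longrightarrow> B \<in> P \<Longrightarrow> x \<in> B \<Longrightarrow> x \<in> Ir r \<longleftrightarrow> cyc_rank n r B x < \<kappa> B"
begin

lemma block_subset: "B \<in> P \<Longrightarrow> B \<subseteq> {1..n}"
  using part by (auto simp: partition_on_def)

lemma block_finite: "B \<in> P \<Longrightarrow> finite B"
  using block_subset finite_subset by blast

lemma blocks_finite: "finite P"
  using part finite_elements[of "{1..n}" P] by simp

lemma block_eq: "A \<in> P \<Longrightarrow> B \<in> P \<Longrightarrow> x \<in> A \<Longrightarrow> x \<in> B \<Longrightarrow> A = B"
  using part by (auto simp: partition_on_def disjoint_def)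

lemma block_obtain:
  assumes "x \<in> {1..n}" obtains B where "B \<in> P" "x \<in> B"
  using assms part unfolding partition_on_def by blast

lemma card_blocks:
  assumes "A \<subseteq> {1..n}" shows "card A = (\<Sum>B\<in>P. card (A \<inter> B))"
proof -
  have "A = (\<Union>B\<in>P. A \<inter> B)" using assms part by (auto simp: partition_on_def)
  then have "card A = card (\<Union>B\<in>P. A \<inter> B)" by simp
  also have "\<dots> = (\<Sum>B\<in>P. card (A \<inter> B))"
    using blocks_finite block_finite block_eq by (intro card_UN_disjoint) auto
  finally show ?thesis .
qed

lemma card_Ir_block:
  assumes "r \<in> {1..n}" "B \<in> P" shows "card (Ir r \<inter> B) = \<kappa> B"
proof -
  have "Ir r \<inter> B = {x \<in> B. cyc_rank n r B x < \<kappa> B}" using initial[OF assms] by auto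
  then show ?thesis using card_cyc_rank_less[OF assms(1) block_subset[OF assms(2)] \<kappa>_le[OF assms(2)]] by simp
qed

lemma card_prefix_Ir_block:
  assumes r: "r \<in> {1..n}" and B: "B \<in> P" and I: "card (I \<inter> B) = \<kappa> B"
  shows "card ({x \<in> I. cyc_pos n r x \<le> b} \<inter> B) \<le> card ({x \<in> Ir r. cyc_pos n r x \<le> b} \<inter> B)"
proof (cases "{x \<in> B. cyc_pos n r x \<le> b} \<subseteq> Ir r")
  case True
  then have "{x \<in> I. cyc_pos n r x \<le> b} \<inter> B \<subseteq> {x \<in> Ir r. cyc_pos n r x \<le> b} \<inter> B" by auto
  then show ?thesis using block_finite[OF B] by (intro card_mono) auto
next
  case False
  then obtain x where x: "x \<in> B" "cyc_pos n r x \<le> b" "x \<notin> Ir r" by auto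
  have "Ir r \<inter> B \<subseteq> {x \<in> Ir r. cyc_pos n r x \<le> b} \<inter> B"
  proof
    fix y assume y: "y \<in> Ir r \<inter> B"
    then have "cyc_rank n r B y < cyc_rank n r B x" using initial[OF r B] x by auto
    then have "cyc_pos n r y < cyc_pos n r x" using cyc_rank_less_iff[OF block_finite[OF B]] x y by auto
    then show "y \<in> {x \<in> Ir r. cyc_pos n r x \<le> b} \<inter> B" using x y by auto
  qed
  then have "\<kappa> B \<le> card ({x \<in> Ir r. cyc_pos n r x \<le> b} \<inter> B)"
    using card_Ir_block[OF r B] block_finite[OF B] by (metis card_mono finite_Int)
  moreover have "card ({x \<in> I. cyc_pos n r x \<le> b} \<inter> B) \<le> \<kappa> B"
    unfolding I[symmetric] using block_finite[OF B] by (intro card_mono) auto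
  ultimately show ?thesis by simp
qed

lemma mem_M_iff_prefix:
  "I \<in> M \<longleftrightarrow> I \<in> ksubsets n k \<and> (\<forall>r\<in>{1..n}. \<forall>b.
     card {x \<in> I. cyc_pos n r x \<le> b} \<le> card {x \<in> Ir r. cyc_pos n r x \<le> b})"
proof (cases "I \<in> ksubsets n k")
  case True
  then have I: "I \<subseteq> {1..n}" by (simp add: ksubsets_def)
  have "card {x \<in> I. cyc_pos n r x \<le> b} \<le> card {x \<in> Ir r. cyc_pos n r x \<le> b} \<longleftrightarrow>
      card {x \<in> {1..n}. cyc_pos n r x \<le> b \<and> x \<notin> Ir r} \<le> card {x \<in> {1..n}. cyc_pos n r x \<le> b \<and> x \<notin> I}" for r b
    using card_prefix_complement[OF I, of r b] card_prefix_complement[OF Ir_subset, of r b r] by linarith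
  then show ?thesis unfolding positroid_iff by simp
qed (simp add: positroid_iff)

lemma in_M_if_block_cards:
  assumes I: "I \<in> ksubsets n k" and cards: "\<And>B. B \<in> P \<Longrightarrow> card (I \<inter> B) = \<kappa> B"
  shows "I \<in> M"
  unfolding mem_M_iff_prefix
proof (intro conjI I ballI allI)
  fix r b assume r: "r \<in> {1..n}"
  have sub: "{x \<in> I. cyc_pos n r x \<le> b} \<subseteq> {1..n}" "{x \<in> Ir r. cyc_pos n r x \<le> b} \<subseteq> {1..n}"
    using I Ir_subset[of r] by (auto simp: ksubsets_def)
  show "card {x \<in> I. cyc_pos n r x \<le> b} \<le> card {x \<in> Ir r. cyc_pos n r x \<le> b}"
    unfolding card_blocks[OF sub(1)] card_blocks[OF sub(2)]
    by (intro sum_mono card_prefix_Ir_block[OF r _ cards])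
qed

end

locale noncrossing_block_positroid = block_positroid +
  assumes nc: "noncrossing P"
begin

lemma card_saturated_prefix_le:
  assumes I: "I \<in> M" and r: "r \<in> {1..n}"
    and sat: "\<And>B. B \<in> P \<Longrightarrow> B \<subseteq> {x. cyc_pos n r x \<le> b} \<or> B \<inter> {x. cyc_pos n r x \<le> b} = {}"
  shows "card {x \<in> I. cyc_pos n r x \<le> b} \<le> (\<Sum>B\<in>{B \<in> P. B \<subseteq> {x. cyc_pos n r x \<le> b}}. \<kappa> B)"
proof -
  have sub: "{x \<in> Ir r. cyc_pos n r x \<le> b} \<subseteq> {1..n}" using Ir_subset[of r] by auto
  have "card {x \<in> I. cyc_pos n r x \<le> b} \<le> card {x \<in> Ir r. cyc_pos n r x \<le> b}"
    using I r unfolding mem_M_iff_prefix by blast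
  also have "\<dots> = (\<Sum>B\<in>P. card ({x \<in> Ir r. cyc_pos n r x \<le> b} \<inter> B))" by (rule card_blocks[OF sub])
  also have "\<dots> = (\<Sum>B\<in>P. if B \<subseteq> {x. cyc_pos n r x \<le> b} then \<kappa> B else 0)"
  proof (rule sum.cong[OF refl])
    fix B assume B: "B \<in> P"
    show "card ({x \<in> Ir r. cyc_pos n r x \<le> b} \<inter> B) = (if B \<subseteq> {x. cyc_pos n r x \<le> b} then \<kappa> B else 0)"
    proof (cases "B \<subseteq> {x. cyc_pos n r x \<le> b}")
      case True
      then have "{x \<in> Ir r. cyc_pos n r x \<le> b} \<inter> B = Ir r \<inter> B" by auto
      then show ?thesis using True card_Ir_block[OF r B] by simp
    next
      case False
      then have "{x \<in> Ir r. cyc_pos n r x \<le> b} \<inter> B = {}" using sat[OF B] by auto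
      then show ?thesis using False by simp
    qed
  qed
  also have "\<dots> = (\<Sum>B\<in>{B \<in> P. B \<subseteq> {x. cyc_pos n r x \<le> b}}. \<kappa> B)"
    using blocks_finite by (simp add: sum.inter_filter)
  finally show ?thesis .
qed

lemma k_eq_sum:
  assumes "r \<in> {1..n}" shows "k = (\<Sum>B\<in>P. \<kappa> B)"
  using card_blocks[OF Ir_subset[of r]] card_Ir_block[OF assms] card_Ir[OF assms] card_anti_exceedances by simp

lemma card_saturated_prefix:
  assumes I: "I \<in> M" and r: "r \<in> {1..n}"
    and sat: "\<And>B. B \<in> P \<Longrightarrow> B \<subseteq> {x. cyc_pos n r x \<le> b} \<or> B \<inter> {x. cyc_pos n r x \<le> b} = {}"
  shows "card {x \<in> I. cyc_pos n r x \<le> b} = (\<Sum>B\<in>{B \<in> P. B \<subseteq> {x. cyc_pos n r x \<le> b}}. \<kappa> B)"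
proof -
  have Ik: "I \<subseteq> {1..n}" "card I = k" "finite I"
    using I M_subset by (auto simp: ksubsets_def intro: finite_subset)
  show ?thesis
  proof (cases "Suc b < n")
    case False
    then have all: "cyc_pos n r x \<le> b" if "x \<in> {1..n}" for x using cyc_pos_less[OF r that] by simp
    have "{x \<in> I. cyc_pos n r x \<le> b} = I" using all Ik(1) by auto
    moreover have "{B \<in> P. B \<subseteq> {x. cyc_pos n r x \<le> b}} = P" using all block_subset by blast
    ultimately show ?thesis using k_eq_sum[OF r] Ik(2) by simp
  next
    case True
    then have "Suc b \<in> cyc_pos n r ` {1..n}" using bij_betw_cyc_pos[OF r] by (simp add: bij_betw_def)
    then obtain r' where r': "r' \<in> {1..n}" "cyc_pos n r r' = Suc b" by auto
    have compl: "cyc_pos n r' x \<le> n - 2 - b \<longleftrightarrow> \<not> cyc_pos n r x \<le> b" if "x \<in> {1..n}" for x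
      using cyc_pos_change[OF r r'(1) that] r'(2) cyc_pos_less[OF r that] True by auto
    let ?A = "{x. cyc_pos n r x \<le> b}" and ?A' = "{x. cyc_pos n r' x \<le> n - 2 - b}"
    have bl: "B \<subseteq> ?A' \<longleftrightarrow> B \<inter> ?A = {}" "B \<inter> ?A' = {} \<longleftrightarrow> B \<subseteq> ?A" if "B \<in> P" for B
    proof -
      have "x \<in> ?A' \<longleftrightarrow> x \<notin> ?A" if "x \<in> B" for x
        using compl block_subset[OF \<open>B \<in> P\<close>] that by blast
      then show "B \<subseteq> ?A' \<longleftrightarrow> B \<inter> ?A = {}" "B \<inter> ?A' = {} \<longleftrightarrow> B \<subseteq> ?A" by blast+
    qed
    have "card {x \<in> I. cyc_pos n r' x \<le> n - 2 - b} \<le> (\<Sum>B\<in>{B \<in> P. B \<subseteq> ?A'}. \<kappa> B)"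
      using bl sat by (intro card_saturated_prefix_le[OF I r'(1)]) blast
    moreover have "{x \<in> I. cyc_pos n r' x \<le> n - 2 - b} = I - {x \<in> I. cyc_pos n r x \<le> b}"
      using compl Ik(1) by auto
    moreover have "{B \<in> P. B \<subseteq> ?A'} = P - {B \<in> P. B \<subseteq> ?A}"
    proof -
      have "B \<noteq> {}" if "B \<in> P" for B using that part by (auto simp: partition_on_def)
      then show ?thesis using bl sat by blast
    qed
    ultimately have "card I - card {x \<in> I. cyc_pos n r x \<le> b} \<le> (\<Sum>B\<in>P. \<kappa> B) - (\<Sum>B\<in>{B \<in> P. B \<subseteq> ?A}. \<kappa> B)"
      using Ik(3) blocks_finite by (simp add: card_Diff_subset sum_diff_nat)
    moreover have "(\<Sum>B\<in>{B \<in> P. B \<subseteq> ?A}. \<kappa> B) \<le> (\<Sum>B\<in>P. \<kappa> B)" using blocks_finite by (intro sum_mono2) auto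
    moreover have "card {x \<in> I. cyc_pos n r x \<le> b} \<le> card I" using Ik(3) by (intro card_mono) auto
    ultimately have "(\<Sum>B\<in>{B \<in> P. B \<subseteq> ?A}. \<kappa> B) \<le> card {x \<in> I. cyc_pos n r x \<le> b}"
      using k_eq_sum[OF r] Ik(2) by linarith
    then show ?thesis using card_saturated_prefix_le[OF I r sat] by simp
  qed
qed

lemma card_block:
  assumes I: "I \<in> M" and B: "B \<in> P"
  shows "card (I \<inter> B) = \<kappa> B"
  using B
proof (induction "Max B - Min B" arbitrary: B rule: less_induct)
  case less
  define lo where "lo = Min B"
  define hi where "hi = Max B"
  have ne: "B \<noteq> {}" and fin: "finite B" using less.prems part block_finite by (auto simp: partition_on_def)
  have lh: "lo \<in> B" "hi \<in> B" "\<And>x. x \<in> B \<Longrightarrow> lo \<le> x \<and> x \<le> hi" using ne fin by (auto simp: lo_def hi_def)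
  have lo: "lo \<in> {1..n}" "hi \<in> {1..n}" "lo \<le> hi" using lh block_subset[OF less.prems] by auto
  let ?A = "{x. cyc_pos n lo x \<le> hi - lo}"
  have A: "x \<in> ?A \<longleftrightarrow> lo \<le> x \<and> x \<le> hi" if "x \<in> {1..n}" for x
    using cyc_pos_eq[OF lo(1) that] lo that by auto
  have strict: "lo < x \<and> x < hi" if "B' \<in> P" "B' \<noteq> B" "x \<in> B'" "x \<in> ?A" for B' x
  proof -
    have "x \<notin> B" using block_eq[OF that(1) less.prems that(3)] that(2) by blast
    then have "x \<noteq> lo" "x \<noteq> hi" using lh by auto
    moreover have "x \<in> {1..n}" using block_subset[OF that(1)] that(3) by blast
    ultimately show ?thesis using A[of x] that(4) by auto
  qed
  have inside: "B' \<subseteq> ?A" if B': "B' \<in> P" "B' \<noteq> B" "B' \<inter> ?A \<noteq> {}" for B'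
  proof
    fix y assume y: "y \<in> B'"
    obtain x where x: "x \<in> B'" "x \<in> ?A" using B'(3) by auto
    have s: "lo < x" "x < hi" using strict[OF B'(1,2) x] by auto
    have yB: "y \<in> {1..n}" "y \<noteq> lo" "y \<noteq> hi"
      using block_subset[OF B'(1)] y block_eq[OF B'(1) less.prems y] B'(2) lh by auto
    note nc1 = nc[unfolded noncrossing_def, THEN bspec, OF less.prems, THEN bspec, OF B'(1), THEN mp, OF B'(2)[symmetric]]
    note nc2 = nc[unfolded noncrossing_def, THEN bspec, OF B'(1), THEN bspec, OF less.prems, THEN mp, OF B'(2)]
    have "\<not> hi < y" using nc1 s x(1) y lh(1,2) by blast
    moreover have "\<not> y < lo" using nc2 s x(1) y lh(1,2) by blast
    ultimately show "y \<in> ?A" using A[OF yB(1)] by simp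
  qed
  have BA: "B \<subseteq> ?A" using A lh block_subset[OF less.prems] by auto
  have sat: "B' \<subseteq> ?A \<or> B' \<inter> ?A = {}" if "B' \<in> P" for B'
    using inside[OF that] BA by (cases "B' = B") auto
  let ?Q = "{B' \<in> P. B' \<subseteq> ?A}"
  have BQ: "B \<in> ?Q" using less.prems BA by blast
  have finQ: "finite ?Q" using blocks_finite by simp
  have IH: "card (I \<inter> B') = \<kappa> B'" if B': "B' \<in> ?Q - {B}" for B'
  proof -
    have B'P: "B' \<in> P" "B' \<noteq> B" "B' \<subseteq> ?A" using B' by auto
    have fin': "finite B'" "B' \<noteq> {}" using B'P(1) part block_finite by (auto simp: partition_on_def)
    have "Min B' \<in> B'" "Max B' \<in> B'" "Min B' \<le> Max B'" using fin' by auto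
    then have "lo < Min B'" "Max B' < hi" using strict[OF B'P(1,2)] B'P(3) by blast+
    then have "Max B' - Min B' < Max B - Min B"
      using \<open>Min B' \<le> Max B'\<close> unfolding lo_def hi_def by linarith
    then show ?thesis using less.hyps B'P(1) by blast
  qed
  have Ik: "I \<subseteq> {1..n}" using I M_subset by (auto simp: ksubsets_def)
  have "card {x \<in> I. cyc_pos n lo x \<le> hi - lo} = (\<Sum>B'\<in>P. card ({x \<in> I. cyc_pos n lo x \<le> hi - lo} \<inter> B'))"
    using Ik by (intro card_blocks) auto
  also have "\<dots> = (\<Sum>B'\<in>P. if B' \<subseteq> ?A then card (I \<inter> B') else 0)"
  proof (rule sum.cong[OF refl])
    fix B' assume B': "B' \<in> P"
    show "card ({x \<in> I. cyc_pos n lo x \<le> hi - lo} \<inter> B') = (if B' \<subseteq> ?A then card (I \<inter> B') else 0)"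
    proof (cases "B' \<subseteq> ?A")
      case True
      then have "{x \<in> I. cyc_pos n lo x \<le> hi - lo} \<inter> B' = I \<inter> B'" by auto
      then show ?thesis using True by simp
    next
      case False
      then have "{x \<in> I. cyc_pos n lo x \<le> hi - lo} \<inter> B' = {}" using sat[OF B'] by auto
      then show ?thesis using False by simp
    qed
  qed
  also have "\<dots> = (\<Sum>B'\<in>?Q. card (I \<inter> B'))" using blocks_finite by (simp add: sum.inter_filter)
  finally have "(\<Sum>B'\<in>?Q. card (I \<inter> B')) = (\<Sum>B'\<in>?Q. \<kappa> B')" using card_saturated_prefix[OF I lo(1) sat] by simp
  moreover have "(\<Sum>B'\<in>?Q - {B}. card (I \<inter> B')) = (\<Sum>B'\<in>?Q - {B}. \<kappa> B')" using IH by (intro sum.cong) auto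
  ultimately show ?case
    using sum.remove[OF finQ BQ, of "\<lambda>B'. card (I \<inter> B')"] sum.remove[OF finQ BQ, of \<kappa>] by simp
qed

lemma M_iff: "I \<in> M \<longleftrightarrow> I \<in> ksubsets n k \<and> (\<forall>B\<in>P. card (I \<inter> B) = \<kappa> B)"
  using card_block in_M_if_block_cards M_subset by blast

lemma exchange_in_M_iff:
  assumes J: "J \<in> M" and i: "i \<in> J" "i \<in> A" "A \<in> P" and j: "j \<in> {1..n} - J" "j \<in> B" "B \<in> P"
  shows "insert j (J - {i}) \<in> M \<longleftrightarrow> A = B"
proof
  let ?I = "insert j (J - {i})"
  have fin: "finite J" using J M_subset by (auto simp: ksubsets_def intro: finite_subset)
  {
    assume I: "?I \<in> M"
    show "A = B"
    proof (rule ccontr)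
      assume ne: "A \<noteq> B"
      then have "j \<notin> A" using block_eq[OF i(3) j(3)] j(2) by blast
      then have "?I \<inter> A = (J \<inter> A) - {i}" by auto
      then have "card (?I \<inter> A) < card (J \<inter> A)" using i fin by (metis IntI card_Diff1_less finite_Int)
      then show False using card_block[OF I i(3)] card_block[OF J i(3)] by simp
    qed
  }
  {
    assume AB: "A = B"
    have "card (?I \<inter> D) = \<kappa> D" if D: "D \<in> P" for D
    proof (cases "D = B")
      case True
      then have "?I \<inter> D = insert j (J \<inter> D - {i})" using j by auto
      moreover have "i \<in> J \<inter> D" "j \<notin> J \<inter> D" using i j True AB by auto
      moreover from this have "card (insert j (J \<inter> D - {i})) = Suc (card (J \<inter> D - {i}))"
        using fin by (intro card_insert_disjoint) auto
      ultimately have "card (?I \<inter> D) = card (J \<inter> D)"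
        using fin card_Suc_Diff1[of "J \<inter> D" i] by (simp del: card_Diff_insert card_Diff_singleton)
      then show ?thesis using card_block[OF J D] by simp
    next
      case False
      then have "i \<notin> D" "j \<notin> D" using block_eq[OF D] i j AB by blast+
      then have "?I \<inter> D = J \<inter> D" by auto
      then show ?thesis using card_block[OF J D] by simp
    qed
    moreover have "?I \<in> ksubsets n k" using exchange_in_ksubsets J M_subset i(1) j(1) by blast
    ultimately show "?I \<in> M" using M_iff by blast
  }
qed

lemma smooth: "smooth_in_grassmannian n k (positroid_variety n k M)"
proof (rule smooth_if_matching_closed[OF M_subset])
  fix J I \<sigma>
  assume J: "J \<in> M" and I: "I \<in> ksubsets n k" and \<sigma>: "bij_betw \<sigma> (J - I) (I - J)"
    and ex: "\<And>i. i \<in> J - I \<Longrightarrow> insert (\<sigma> i) (J - {i}) \<in> M"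
  have finJ: "finite J" "finite I" using J I M_subset by (auto simp: ksubsets_def intro: finite_subset)
  have sub: "J \<subseteq> {1..n}" "I \<subseteq> {1..n}" using J I M_subset by (auto simp: ksubsets_def)
  have im: "\<sigma> ` (J - I) = I - J" and inj: "inj_on \<sigma> (J - I)" using \<sigma> by (auto simp: bij_betw_def)
  have same: "i \<in> B \<longleftrightarrow> \<sigma> i \<in> B" if B: "B \<in> P" and i: "i \<in> J - I" for B i
  proof -
    have "\<sigma> i \<in> I - J" using im i by blast
    then have \<sigma>i: "\<sigma> i \<in> {1..n} - J" using sub(2) by blast
    obtain A where A: "A \<in> P" "i \<in> A" using block_obtain i sub(1) by blast
    obtain A' where A': "A' \<in> P" "\<sigma> i \<in> A'" using block_obtain \<sigma>i by blast
    have "A = A'" using exchange_in_M_iff[OF J _ A(2,1) \<sigma>i A'(2,1)] ex[OF i] i by blast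
    then show ?thesis using block_eq[OF B A(1)] block_eq[OF B A'(1)] A A' by blast
  qed
  have "card (I \<inter> B) = \<kappa> B" if B: "B \<in> P" for B
  proof -
    have "\<sigma> ` ((J - I) \<inter> B) = (I - J) \<inter> B"
    proof (rule Set.set_eqI, rule iffI)
      fix y assume "y \<in> \<sigma> ` ((J - I) \<inter> B)"
      then obtain i where "i \<in> J - I" "i \<in> B" "y = \<sigma> i" by blast
      then show "y \<in> (I - J) \<inter> B" using same[OF B] im by blast
    next
      fix y assume y: "y \<in> (I - J) \<inter> B"
      then obtain i where "i \<in> J - I" "y = \<sigma> i" using im by blast
      then show "y \<in> \<sigma> ` ((J - I) \<inter> B)" using same[OF B, of i] y by blast
    qed
    moreover have "inj_on \<sigma> ((J - I) \<inter> B)" using inj by (rule inj_on_subset) auto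
    ultimately have "card ((I - J) \<inter> B) = card ((J - I) \<inter> B)" by (metis card_image)
    moreover have "card (I \<inter> B) = card (I \<inter> J \<inter> B) + card ((I - J) \<inter> B)"
      using card_Int_Diff[of "I \<inter> B" J] finJ by (simp add: Int_Diff Int_ac)
    moreover have "card (J \<inter> B) = card (I \<inter> J \<inter> B) + card ((J - I) \<inter> B)"
      using card_Int_Diff[of "J \<inter> B" I] finJ by (simp add: Int_Diff Int_ac)
    ultimately show ?thesis using card_block[OF J B] by simp
  qed
  then show "I \<in> M" using M_iff I by blast
qed

end

lemma clockwise_eq_if_noncrossing:
  assumes nc: "noncrossing P" and AB: "A \<in> P" "B \<in> P" "A \<noteq> B" "A \<inter> B = {}"
    and x: "x \<in> A" "x' \<in> A" and y: "y \<in> B" "y' \<in> B"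
  shows "clockwise x y x' = clockwise x y' x'"
proof -
  note nc1 = nc[unfolded noncrossing_def, THEN bspec, OF AB(1), THEN bspec, OF AB(2), THEN mp, OF AB(3)]
  note nc2 = nc[unfolded noncrossing_def, THEN bspec, OF AB(2), THEN bspec, OF AB(1), THEN mp, OF AB(3)[symmetric]]
  have ord: "\<not> (x < z \<and> z < x' \<and> x' < z')" "\<not> (x' < z \<and> z < x \<and> x < z')"
    "\<not> (z < x \<and> x < z' \<and> z' < x')" "\<not> (z < x' \<and> x' < z' \<and> z' < x)" if "z \<in> B" "z' \<in> B" for z z'
    using nc1 nc2 x that by blast+
  have ne: "y \<noteq> x" "y \<noteq> x'" "y' \<noteq> x" "y' \<noteq> x'" using AB(4) x y by auto
  consider "x = x'" | "x < x'" | "x' < x" by linarith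
  then show ?thesis
  proof cases
    case 1
    then show ?thesis by (auto simp: clockwise_def)
  next
    case 2
    then have "clockwise x z x' \<longleftrightarrow> x < z \<and> z < x'" for z by (auto simp: clockwise_def)
    moreover have "x < z' \<and> z' < x'" if "x < z" "z < x'" "z \<in> B" "z' \<in> B" "z' \<noteq> x" "z' \<noteq> x'" for z z'
    proof -
      have "\<not> x' < z'" using ord(1)[OF that(3,4)] that by blast
      moreover have "\<not> z' < x" using ord(3)[OF that(4,3)] that by blast
      ultimately show ?thesis using that(5,6) by linarith
    qed
    ultimately show ?thesis using y ne by metis
  next
    case 3
    then have "clockwise x z x' \<longleftrightarrow> z < x' \<or> x < z" for z by (auto simp: clockwise_def)
    moreover have "z' < x' \<or> x < z'" if "z < x' \<or> x < z" "z \<in> B" "z' \<in> B" "z' \<noteq> x" "z' \<noteq> x'" for z z'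
    proof (rule ccontr)
      assume "\<not> ?thesis"
      then have "x' < z'" "z' < x" using that(4,5) by linarith+
      then show False using ord(2)[OF that(3,2)] ord(4)[OF that(2,3)] that(1) by blast
    qed
    ultimately show ?thesis using y ne by metis
  qed
qed

lemma no_alignment_arith:
  fixes a b m t A B:: nat
  assumes "a < m" "b < m" "a < b" "0 < t" "t < m"
   and A: "A = a + t \<and> A < m \<or> A + m = a + t" and B: "B = b + t \<and> B < m\<or> B + m = b + t"
  assumes "A \<noteq> b" "B \<noteq> a" "clockwise a b A = clockwise a B A"
  shows "clockwise a b A = clockwise b a B"
  using A B
proof (elim disjE)
  assume "A = a + t \<and> A < m" "B = b + t \<and> B < m"
  then show ?thesis using assms by (auto simp: clockwise_def)
next
  assume "A = a + t \<and> A < m" "B + m = b + t"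
  then have "a < A" "A < m" "B < b" "B < A" using assms by linarith+
  then show ?thesis using assms(3,8,9,10) by (auto simp: clockwise_def)
next
  assume "A + m = a + t" "B = b + t \<and> B < m"
  then show ?thesis using assms by linarith
next
  assume "A + m = a + t" "B + m = b + t"
  then have "A < a" "B < b" "A < B" using assms by linarith+
  then show ?thesis using assms(3,8,9,10) by (auto simp: clockwise_def)
qed

context decorated_perm
begin

lemma alignment_sym: "i \<in> {1..n} \<Longrightarrow> j \<in> {1..n} \<Longrightarrow> alignment w C i j \<longleftrightarrow> alignment w C j i"
  using alignment_iff[of i i j] alignment_iff[of i j i] by blast

lemma no_alignment_in_spirograph:
  assumes B: "B \<subseteq> {1..n}" "w ` B = B" and sp: "spirograph_on w B"
    and ij: "i \<in> B" "j \<in> B" and nf: "w i \<noteq> i" "w j \<noteq> j"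
  shows "\<not> alignment w C i j"
proof -
  have fin: "finite B" using B(1) by (rule finite_subset) simp
  obtain t where t: "t \<in> {1..card B}" "\<And>x. x \<in> B \<Longrightarrow> rk B (w x) = (rk B x + t) mod card B"
    using sp unfolding spirograph_on_iff[OF fin B(2)] by blast
  have main: "\<not> alignment w C i j" if ij: "i \<in> B" "j \<in> B" "i < j" "w i \<noteq> i" "w j \<noteq> j" for i j
  proof
    assume al: "alignment w C i j"
    have wij: "w i \<in> B" "w j \<in> B" using B(2) ij by auto
    have "t \<noteq> card B"
    proof
      assume "t = card B"
      then have "rk B (w i) = rk B i" using t(2)[OF ij(1)] rk_less_card[OF fin ij(1)] by simp
      then show False using rk_eq_iff[OF fin wij(1) ij(1)] ij(4) by simp
    qed
    then have tm: "0 < t" "t < card B" using t(1) by auto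
    have ne: "i \<noteq> j" using ij(3) by simp
    have mem: "i \<in> {1..n}" "j \<in> {1..n}" using B(1) ij by auto
    have cw: "clockwise (rk B x) (rk B y) (rk B z) = clockwise x y z" if "x \<in> B" "y \<in> B" "z \<in> B" for x y z
      unfolding clockwise_def by (simp add: rk_less_iff[OF fin] that)
    have nc: "w i \<noteq> j" "w j \<noteq> i" "clockwise i j (w i) = clockwise i (w j) (w i)"
      using al ne ij(4,5) unfolding alignment_def crossing_iff[OF mem] by auto
    have shift: "rk B (w x) = rk B x + t \<and> rk B (w x) < card B \<or> rk B (w x) + card B = rk B x + t" if "x \<in> B" for x
    proof (cases "rk B x + t < card B")
      case True
      then show ?thesis using t(2)[OF that] by simp
    next
      case False
      then show ?thesis using t(2)[OF that] rk_less_card[OF fin that] tm by (simp add: le_mod_geq)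
    qed
    have "clockwise (rk B i) (rk B j) (rk B (w i)) = clockwise (rk B j) (rk B i) (rk B (w j))"
    proof (rule no_alignment_arith[OF rk_less_card[OF fin ij(1)] rk_less_card[OF fin ij(2)] _ tm shift[OF ij(1)] shift[OF ij(2)]])
      show "rk B i < rk B j" using rk_less_iff[OF fin ij(1,2)] ij(3) by simp
      show "rk B (w i) \<noteq> rk B j" "rk B (w j) \<noteq> rk B i"
        using rk_eq_iff[OF fin wij(1) ij(2)] rk_eq_iff[OF fin wij(2) ij(1)] nc by auto
      show "clockwise (rk B i) (rk B j) (rk B (w i)) = clockwise (rk B i) (rk B (w j)) (rk B (w i))"
        using cw ij wij nc(3) by simp
    qed
    then have "clockwise i j (w i) = clockwise j i (w j)" using cw ij wij by simp
    then show False using al ne ij(4,5)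
      unfolding alignment_def left_of_tail_iff[OF mem ne] left_of_tail_iff[OF mem(2,1) ne[symmetric]] by simp
  qed
  have mem: "i \<in> {1..n}" "j \<in> {1..n}" using B(1) ij by auto
  show ?thesis using main[of i j] main[of j i] ij nf alignment_sym[OF mem]
    by (cases i j rule: linorder_cases) (auto simp: alignment_def)
qed

lemma same_block_if_crossing:
  assumes P: "partition_on {1..n} P" "noncrossing P" "\<And>B. B \<in> P \<Longrightarrow> w ` B = B"
    and cr: "crossing w C i j" and A: "A \<in> P" "i \<in> A" and B: "B \<in> P" "j \<in> B"
  shows "A = B"
proof (rule ccontr)
  assume ne: "A \<noteq> B"
  have disj: "A \<inter> B = {}" using P(1) A(1) B(1) ne by (auto simp: partition_on_def disjoint_def)
  have mem: "i \<in> {1..n}" "j \<in> {1..n}" using P(1) A B by (auto simp: partition_on_def)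
  have w: "w i \<in> A" "w j \<in> B" using P(3) A B by auto
  have "clockwise i j (w i) = clockwise i (w j) (w i)"
    by (rule clockwise_eq_if_noncrossing[OF P(2) A(1) B(1) ne disj A(2) w(1) B(2) w(2)])
  then show False using cr disj A(2) B(2) w unfolding crossing_iff[OF mem] by blast
qed

lemma no_crossed_alignment_if_union_of_spirographs:
  assumes "union_of_spirographs n w"
  shows "\<not> (\<exists>i\<in>{1..n}. \<exists>j\<in>{1..n}. crossed_alignment n w C i j)"
proof
  obtain P where P: "partition_on {1..n} P" "noncrossing P" and bl: "\<And>B. B \<in> P \<Longrightarrow> w ` B = B"
      "\<And>B. B \<in> P \<Longrightarrow> spirograph_on w B"
    using assms unfolding union_of_spirographs_def by (elim exE conjE) (rule that, auto)
  assume "\<exists>i\<in>{1..n}. \<exists>j\<in>{1..n}. crossed_alignment n w C i j"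
  then obtain i j h where ijh: "i \<in> {1..n}" "j \<in> {1..n}" "h \<in> {1..n}" "alignment w C i j"
    "crossing w C h i" "crossing w C h j" by (auto simp: crossed_alignment_def)
  have blk: "\<exists>B\<in>P. x \<in> B" if "x \<in> {1..n}" for x using P(1) that unfolding partition_on_def by blast
  obtain A where A: "A \<in> P" "h \<in> A" using blk ijh(3) by blast
  have iA: "i \<in> A" using blk[OF ijh(1)] same_block_if_crossing[OF P bl(1) ijh(5) A] by blast
  have jA: "j \<in> A" using blk[OF ijh(2)] same_block_if_crossing[OF P bl(1) ijh(6) A] by blast
  have nf: "w i \<noteq> i" "w j \<noteq> j"
    using ijh(5,6) w_eq unfolding crossing_iff[OF ijh(3,1)] crossing_iff[OF ijh(3,2)] by metis+
  have "A \<subseteq> {1..n}" using P(1) A(1) by (auto simp: partition_on_def)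
  then show False using no_alignment_in_spirograph[OF _ bl(1)[OF A(1)] bl(2)[OF A(1)] iA jA nf] ijh(4) by blast
qed

lemma block_initial_segments:
  assumes B: "B \<subseteq> {1..n}" "w ` B = B" "spirograph_on w B" "card B = 1 \<or> (\<forall>x\<in>B. w x \<noteq> x)"
  shows "\<exists>c\<le>card B. \<forall>r\<in>{1..n}. \<forall>x\<in>B. x \<in> Ir r \<longleftrightarrow> cyc_rank n r B x < c"
proof (cases "card B = 1")
  case True
  then obtain x where x: "B = {x}" by (auto simp: card_1_singleton_iff)
  then have wx: "w x = x" "x \<in> {1..n}" using B by auto
  have "x \<in> Ir r \<longleftrightarrow> x \<in> C" for r using w_mem_Ir_iff[OF wx(2), of r] wx(1) by (simp add: decreasing_def)
  moreover have "cyc_rank n r B x = 0" for r by (simp add: cyc_rank_def x)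
  ultimately show ?thesis using x by (intro exI[of _ "if x \<in> C then 1 else 0"]) auto
next
  case False
  then have nf: "\<And>x. x \<in> B \<Longrightarrow> w x \<noteq> x" using B(4) by blast
  have fin: "finite B" using B(1) by (rule finite_subset) simp
  obtain t where t: "t \<in> {1..card B}" "\<And>x. x \<in> B \<Longrightarrow> rk B (w x) = (rk B x + t) mod card B"
    using B(3) unfolding spirograph_on_iff[OF fin B(2)] by blast
  have "x \<in> Ir r \<longleftrightarrow> cyc_rank n r B x < t" if r: "r \<in> {1..n}" and x: "x \<in> B" for r x
  proof -
    obtain y where y: "y \<in> B" "x = w y" using B(2) x by blast
    have "t \<noteq> card B"
    proof
      assume "t = card B"
      then have "rk B (w y) = rk B y" using t(2)[OF y(1)] rk_less_card[OF fin y(1)] by simp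
      then show False using rk_eq_iff[OF fin _ y(1), of "w y"] nf[OF y(1)] x y by simp
    qed
    then have tm: "0 < t" "t < card B" using t(1) by auto
    have yC: "y \<notin> C" "y \<in> {1..n}" using nf[OF y(1)] loops B(1) y by auto
    have "x \<in> Ir r \<longleftrightarrow> cyc_pos n r x < cyc_pos n r y"
      using w_mem_Ir_iff[OF yC(2), of r] yC(1) y(2) by (simp add: decreasing_def)
    also have "\<dots> \<longleftrightarrow> cyc_rank n r B x < cyc_rank n r B y" using cyc_rank_less_iff[OF fin x y(1)] by simp
    also have "\<dots> \<longleftrightarrow> cyc_rank n r B x < t"
    proof -
      have eq: "cyc_rank n r B x = (cyc_rank n r B y + t) mod card B"
        using cyc_rank_rotation[OF r B(1) y(1) x tm(2)] t(2)[OF y(1)] y(2) by simp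
      have lt: "cyc_rank n r B y < card B" by (rule cyc_rank_less_card[OF fin y(1)])
      show ?thesis
      proof (cases "cyc_rank n r B y + t < card B")
        case True
        then show ?thesis unfolding eq using tm by simp
      next
        case False
        then have "(cyc_rank n r B y + t) mod card B = cyc_rank n r B y + t - card B"
          using lt tm by (simp add: le_mod_geq)
        then show ?thesis unfolding eq using lt tm False by linarith
      qed
    qed
    finally show ?thesis .
  qed
  then show ?thesis using t(1) by (intro exI[of _ t]) auto
qed

lemma left_of_iff_Ir:
  assumes "x \<in> {1..n}" "y \<in> {1..n}" "x \<noteq> y" "w x \<noteq> y"
  shows "left_of w C x (arc_tail y) \<longleftrightarrow> w x \<in> Ir y"
proof -
  have wx: "w x \<in> {1..n}" using w_mem[OF assms(1)] .
  have "clockwise x y (w x) \<longleftrightarrow> clockwise (cyc_pos n y x) 0 (cyc_pos n y (w x))"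
    using clockwise_cyc_pos[OF assms(2,1,2) wx] cyc_pos_self[of y] by simp
  moreover have "cyc_pos n y x \<noteq> 0" "cyc_pos n y (w x) \<noteq> 0"
    using cyc_pos_inj[OF assms(2,1,2)] cyc_pos_inj[OF assms(2) wx assms(2)] assms(3,4) cyc_pos_self[of y] by auto
  ultimately have "clockwise x y (w x) \<longleftrightarrow> cyc_pos n y (w x) < cyc_pos n y x" by (auto simp: clockwise_def)
  then show ?thesis
    unfolding left_of_tail_iff[OF assms(1-3)] w_mem_Ir_iff[OF assms(1)] decreasing_def using loops by auto
qed

end

context noncrossing_block_positroid
begin

lemma card_pairs_blocks:
  assumes "X \<subseteq> {1..n} \<times> {1..n}"
  shows "card X = (\<Sum>e\<in>P \<times> P. card (X \<inter> fst e \<times> snd e))"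
proof -
  have "X \<subseteq> (\<Union>e\<in>P \<times> P. X \<inter> fst e \<times> snd e)"
  proof
    fix z assume z: "z \<in> X"
    obtain x y where xy: "z = (x, y)" by (cases z)
    have "x \<in> {1..n}" "y \<in> {1..n}" using z xy assms by blast+
    obtain A where A: "A \<in> P" "x \<in> A" using block_obtain[OF \<open>x \<in> {1..n}\<close>] .
    obtain B where B: "B \<in> P" "y \<in> B" using block_obtain[OF \<open>y \<in> {1..n}\<close>] .
    show "z \<in> (\<Union>e\<in>P \<times> P. X \<inter> fst e \<times> snd e)"
      using A B z xy by (intro UN_I[of "(A, B)"]) auto
  qed
  then have "X = (\<Union>e\<in>P \<times> P. X \<inter> fst e \<times> snd e)" by (intro equalityI) auto
  then have "card X = card (\<Union>e\<in>P \<times> P. X \<inter> fst e \<times> snd e)" by simp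
  also have "\<dots> = (\<Sum>e\<in>P \<times> P. card (X \<inter> fst e \<times> snd e))"
  proof (rule card_UN_disjoint)
    show "finite (P \<times> P)" using blocks_finite by simp
    show "\<forall>e\<in>P \<times> P. finite (X \<inter> fst e \<times> snd e)" using block_finite by auto
    show "\<forall>e\<in>P \<times> P. \<forall>e'\<in>P \<times> P. e \<noteq> e' \<longrightarrow> (X \<inter> fst e \<times> snd e) \<inter> (X \<inter> fst e' \<times> snd e') = {}"
    proof (intro ballI impI)
      fix e e' assume e: "e \<in> P \<times> P" "e' \<in> P \<times> P" "e \<noteq> e'"
      have "fst e \<noteq> fst e' \<or> snd e \<noteq> snd e'" using e(3) by (simp add: prod_eq_iff)
      moreover have "fst e \<in> P" "snd e \<in> P" "fst e' \<in> P" "snd e' \<in> P" using e by auto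
      ultimately have "fst e \<inter> fst e' = {} \<or> snd e \<inter> snd e' = {}" using block_eq by blast
      then show "(X \<inter> fst e \<times> snd e) \<inter> (X \<inter> fst e' \<times> snd e') = {}" by auto
    qed
  qed
  finally show ?thesis .
qed

definition same_block :: "nat \<Rightarrow> nat \<Rightarrow> bool" where
  "same_block x y \<longleftrightarrow> (\<exists>B\<in>P. x \<in> B \<and> y \<in> B)"

lemma same_block_iff: "A \<in> P \<Longrightarrow> B \<in> P \<Longrightarrow> x \<in> A \<Longrightarrow> y \<in> B \<Longrightarrow> same_block x y \<longleftrightarrow> A = B"
  using block_eq unfolding same_block_def by blast

lemma w_in_block: "B \<in> P \<Longrightarrow> x \<in> B \<Longrightarrow> w x \<in> B"
  using inv by blast

lemma left_of_iff_Ir_blocks: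
  assumes A: "A \<in> P" "x \<in> A" and B: "B \<in> P" "y \<in> B" and ne: "A \<noteq> B"
  shows "left_of w C x (arc_tail y) \<longleftrightarrow> w x \<in> Ir y"
proof (rule left_of_iff_Ir)
  show "x \<in> {1..n}" "y \<in> {1..n}" using block_subset A B by blast+
  show "x \<noteq> y" using block_eq[OF A(1) B(1) A(2)] B(2) ne by blast
  show "w x \<noteq> y" using block_eq[OF A(1) B(1) w_in_block[OF A]] B(2) ne by blast
qed

lemma Ir_const_on_block:
  assumes A: "A \<in> P" "x \<in> A" and B: "B \<in> P" "y \<in> B" "y' \<in> B" and ne: "A \<noteq> B"
  shows "w x \<in> Ir y \<longleftrightarrow> w x \<in> Ir y'"
proof -
  have disj: "A \<inter> B = {}" using block_eq[OF A(1) B(1)] ne by blast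
  have mem: "x \<in> {1..n}" "y \<in> {1..n}" "y' \<in> {1..n}" using block_subset A B by blast+
  have xy: "x \<noteq> y" "x \<noteq> y'" using disj A B by auto
  have "clockwise x y (w x) = clockwise x y' (w x)"
    by (rule clockwise_eq_if_noncrossing[OF nc A(1) B(1) ne disj A(2) w_in_block[OF A] B(2,3)])
  then show ?thesis
    unfolding left_of_iff_Ir_blocks[OF A B(1,2) ne, symmetric] left_of_iff_Ir_blocks[OF A B(1,3) ne, symmetric]
      left_of_tail_iff[OF mem(1,2) xy(1)] left_of_tail_iff[OF mem(1,3) xy(2)] by simp
qed

lemma card_heads_block:
  assumes "B \<in> P" "y \<in> {1..n}"
  shows "card {x \<in> B. w x \<in> Ir y} = \<kappa> B"
proof -
  have im: "w ` {x \<in> B. w x \<in> Ir y} = Ir y \<inter> B"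
  proof (rule Set.set_eqI, rule iffI)
    fix z assume "z \<in> Ir y \<inter> B"
    moreover from this obtain x where "x \<in> B" "z = w x" using inv[OF assms(1)] by blast
    ultimately show "z \<in> w ` {x \<in> B. w x \<in> Ir y}" by blast
  qed (use w_in_block[OF assms(1)] in blast)
  have "inj_on w {x \<in> B. w x \<in> Ir y}" using w_eq by (auto simp: inj_on_def)
  then show ?thesis using card_image im card_Ir_block[OF assms(2,1)] by fastforce
qed

lemma card_alignments_blocks:
  assumes na: "\<And>B i j. B \<in> P \<Longrightarrow> i \<in> B \<Longrightarrow> j \<in> B \<Longrightarrow> \<not> alignment w C i j" and J: "J \<in> M"
  shows "card {I \<in> M. card (I \<inter> J) + 1 = k} + card (alignments n w C) = k * (n - k)"
proof -
  have Jk: "J \<in> ksubsets n k" "J \<subseteq> {1..n}" using J M_subset by (auto simp: ksubsets_def)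
  define Q where "Q = {(x, y) \<in> {1..n} \<times> {1..n}. \<not> same_block x y \<and> w x \<in> Ir y \<and> w y \<notin> Ir x}"
  define N where "N = {(i, j) \<in> J \<times> ({1..n} - J). \<not> same_block i j}"
  have al: "alignment w C x y \<longleftrightarrow> \<not> same_block x y \<and> (w x \<in> Ir y \<longleftrightarrow> w y \<notin> Ir x)"
    if xy: "x \<in> {1..n}" "y \<in> {1..n}" for x y
  proof -
    obtain A where A: "A \<in> P" "x \<in> A" using block_obtain[OF xy(1)] .
    obtain B where B: "B \<in> P" "y \<in> B" using block_obtain[OF xy(2)] .
    show ?thesis
    proof (cases "A = B")
      case True
      then show ?thesis using na[OF A(1)] A B same_block_iff[OF A(1) B(1) A(2) B(2)] by blast
    next
      case False
      have "\<not> crossing w C x y" using same_block_if_crossing[OF part nc inv _ A B] False by blast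
      moreover have "x \<noteq> y" using block_eq[OF A(1) B(1) A(2)] B(2) False by blast
      ultimately show ?thesis
        unfolding alignment_def left_of_iff_Ir_blocks[OF A B False] left_of_iff_Ir_blocks[OF B A False[symmetric]]
        using False same_block_iff[OF A(1) B(1) A(2) B(2)] by blast
    qed
  qed
  let ?f = "\<lambda>(x, y). {x, y} :: nat set"
  have sym: "same_block x y \<longleftrightarrow> same_block y x" for x y by (auto simp: same_block_def)
  have "alignments n w C = ?f ` Q"
  proof (rule Set.set_eqI, rule iffI)
    fix e assume "e \<in> alignments n w C"
    then obtain x y where e: "e = {x, y}" "x \<in> {1..n}" "y \<in> {1..n}" "alignment w C x y"
      by (auto simp: alignments_def)
    then consider "(x, y) \<in> Q" | "(y, x) \<in> Q"
      using al[OF e(2,3)] sym[of x y] unfolding Q_def by blast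
    then show "e \<in> ?f ` Q"
    proof cases
      case 1
      then show ?thesis using e(1) by (intro image_eqI[of _ _ "(x, y)"]) auto
    next
      case 2
      then show ?thesis using e(1) by (intro image_eqI[of _ _ "(y, x)"]) auto
    qed
  next
    fix e assume "e \<in> ?f ` Q"
    then obtain x y where e: "e = {x, y}" "(x, y) \<in> Q" by auto
    then have xy: "x \<in> {1..n}" "y \<in> {1..n}" by (auto simp: Q_def)
    have "alignment w C x y" using al[OF xy] e(2) by (auto simp: Q_def)
    then show "e \<in> alignments n w C" unfolding alignments_def using e(1) xy by blast
  qed
  moreover have "inj_on ?f Q"
  proof (rule inj_onI)
    fix e e' assume e: "e \<in> Q" "e' \<in> Q" "?f e = ?f e'"
    obtain x y x' y' where "e = (x, y)" "e' = (x', y')" by (cases e; cases e')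
    then show "e = e'" using e by (auto simp: doubleton_eq_iff Q_def)
  qed
  ultimately have cQ: "card (alignments n w C) = card Q" by (simp only: card_image)
  have "card (Q \<inter> A \<times> B) = card (N \<inter> A \<times> B)" if AB: "A \<in> P" "B \<in> P" for A B
  proof (cases "A = B")
    case True
    have "same_block x y" if "x \<in> A" "y \<in> B" for x y using same_block_iff[OF AB that] True by simp
    then have "Q \<inter> A \<times> B = {}" "N \<inter> A \<times> B = {}" by (auto simp: Q_def N_def)
    then show ?thesis by simp
  next
    case False
    obtain x0 y0 where x0: "x0 \<in> A" and y0: "y0 \<in> B" using AB part by (fastforce simp: partition_on_def)
    have mem: "x0 \<in> {1..n}" "y0 \<in> {1..n}" using block_subset AB x0 y0 by blast+
    have ns: "\<not> same_block x y" if "x \<in> A" "y \<in> B" for x y using same_block_iff[OF AB that] False by simp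
    have "Q \<inter> A \<times> B = {x \<in> A. w x \<in> Ir y0} \<times> {y \<in> B. w y \<notin> Ir x0}"
    proof (rule Set.set_eqI)
      fix e :: "nat \<times> nat"
      obtain x y where e: "e = (x, y)" by (cases e)
      show "e \<in> Q \<inter> A \<times> B \<longleftrightarrow> e \<in> {x \<in> A. w x \<in> Ir y0} \<times> {y \<in> B. w y \<notin> Ir x0}"
      proof (cases "x \<in> A \<and> y \<in> B")
        case True
        then have "w x \<in> Ir y \<longleftrightarrow> w x \<in> Ir y0" "w y \<in> Ir x \<longleftrightarrow> w y \<in> Ir x0"
          using Ir_const_on_block[OF AB(1) _ AB(2) _ y0 False, of x y]
            Ir_const_on_block[OF AB(2) _ AB(1) _ x0 False[symmetric], of y x] by auto
        moreover have "x \<in> {1..n}" "y \<in> {1..n}" using True block_subset AB by blast+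
        ultimately show ?thesis using True ns[of x y] e by (auto simp: Q_def)
      qed (use e in auto)
    qed
    moreover have "card {x \<in> A. w x \<in> Ir y0} = \<kappa> A" by (rule card_heads_block[OF AB(1) mem(2)])
    moreover have "card {y \<in> B. w y \<notin> Ir x0} = card B - \<kappa> B"
    proof -
      have "{y \<in> B. w y \<notin> Ir x0} = B - {y \<in> B. w y \<in> Ir x0}" by auto
      then show ?thesis using card_heads_block[OF AB(2) mem(1)] block_finite[OF AB(2)] by (simp add: card_Diff_subset)
    qed
    ultimately have Q: "card (Q \<inter> A \<times> B) = \<kappa> A * (card B - \<kappa> B)" by (simp add: card_cartesian_product)
    have "N \<inter> A \<times> B = (J \<inter> A) \<times> (B - J \<inter> B)"
      using ns block_subset[OF AB(2)] by (auto simp: N_def)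
    then have "card (N \<inter> A \<times> B) = \<kappa> A * (card B - \<kappa> B)"
      using card_block[OF J AB(1)] card_block[OF J AB(2)] block_finite[OF AB(2)]
      by (simp add: card_cartesian_product card_Diff_subset)
    then show ?thesis using Q by simp
  qed
  note pairs = this
  have sub: "Q \<subseteq> {1..n} \<times> {1..n}" "N \<subseteq> {1..n} \<times> {1..n}" using Jk(2) by (auto simp: Q_def N_def)
  have "card Q = card N"
    unfolding card_pairs_blocks[OF sub(1)] card_pairs_blocks[OF sub(2)]
    by (intro sum.cong refl pairs) auto
  moreover have "chart_index n J = exchange_edges n M J \<union> N" "exchange_edges n M J \<inter> N = {}"
  proof -
    have "insert j (J - {i}) \<in> M \<longleftrightarrow> same_block i j" if i: "i \<in> J" and j: "j \<in> {1..n} - J" for i j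
    proof -
      have "i \<in> {1..n}" using i Jk(2) by blast
      then obtain A where A: "A \<in> P" "i \<in> A" by (rule block_obtain)
      have "j \<in> {1..n}" using j by blast
      then obtain B where B: "B \<in> P" "j \<in> B" by (rule block_obtain)
      show ?thesis using exchange_in_M_iff[OF J i A(2,1) j B(2,1)] same_block_iff[OF A(1) B(1) A(2) B(2)] by simp
    qed
    then show "chart_index n J = exchange_edges n M J \<union> N" "exchange_edges n M J \<inter> N = {}"
      by (auto simp: exchange_edges_def N_def chart_index_def)
  qed
  moreover have "finite (exchange_edges n M J)" "finite N"
    using finite_chart_index[OF Jk(1)] calculation(2) by (metis finite_Un)+
  ultimately show ?thesis
    using card_chart_index[OF Jk(1)] card_johnson_neighbours[OF M_subset Jk(1)] cQ by (simp add: card_Un_disjoint)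
qed

end

section \<open>Positroids closed under double exchanges\<close>

definition exchange_rel :: "nat \<Rightarrow> nat set set \<Rightarrow> nat set \<Rightarrow> (nat \<times> nat) set" where
  "exchange_rel n M J = (exchange_edges n M J \<union> (exchange_edges n M J)\<inverse>)\<^sup>*"

lemma sym_exchange_rel: "(x, y) \<in> exchange_rel n M J \<Longrightarrow> (y, x) \<in> exchange_rel n M J"
proof -
  have "sym (exchange_edges n M J \<union> (exchange_edges n M J)\<inverse>)" by (rule sym_Un_converse)
  then have "sym (exchange_rel n M J)" unfolding exchange_rel_def by (rule sym_rtrancl)
  then show "(x, y) \<in> exchange_rel n M J \<Longrightarrow> (y, x) \<in> exchange_rel n M J" by (rule symD)
qed

lemma edge_in_exchange_rel: "e \<in> exchange_edges n M J \<Longrightarrow> e \<in> exchange_rel n M J"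
  unfolding exchange_rel_def by blast

lemma trans_exchange_rel:
  "(x, y) \<in> exchange_rel n M J \<Longrightarrow> (y, z) \<in> exchange_rel n M J \<Longrightarrow> (x, z) \<in> exchange_rel n M J"
  unfolding exchange_rel_def by (rule rtrancl_trans)

lemma exchange_edgesD:
  assumes "(i, j) \<in> exchange_edges n M J"
  shows "i \<in> J" "j \<in> {1..n} - J" "insert j (J - {i}) \<in> M"
  using assms by (auto simp: exchange_edges_def chart_index_def)

lemma exchange_edgesI:
  "i \<in> J \<Longrightarrow> j \<in> {1..n} - J \<Longrightarrow> insert j (J - {i}) \<in> M \<Longrightarrow> (i, j) \<in> exchange_edges n M J"
  by (simp add: exchange_edges_def chart_index_def)

locale double_exchange =
  fixes n k :: nat and M :: "nat set set"
  assumes M_sub: "M \<subseteq> ksubsets n k"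
    and double: "\<And>J i i' j j'. J \<in> M \<Longrightarrow> i \<noteq> i' \<Longrightarrow> j \<noteq> j' \<Longrightarrow> (i, j) \<in> exchange_edges n M J \<Longrightarrow>
      (i', j') \<in> exchange_edges n M J \<Longrightarrow> insert j (insert j' (J - {i, i'})) \<in> M"
begin

abbreviation "E J \<equiv> exchange_edges n M J"
abbreviation "rel J \<equiv> exchange_rel n M J"

lemma J_sub: "J \<in> M \<Longrightarrow> J \<subseteq> {1..n}"
  using M_sub by (auto simp: ksubsets_def)

lemma rectangular:
  assumes J: "J \<in> M" and e: "(i1, j1) \<in> E J" "(i2, j1) \<in> E J" "(i2, j2) \<in> E J"
  shows "(i1, j2) \<in> E J"
proof (cases "i1 = i2 \<or> j1 = j2")
  case True
  then show ?thesis using e by auto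
next
  case False
  note d = exchange_edgesD[OF e(1)] exchange_edgesD[OF e(2)] exchange_edgesD[OF e(3)]
  let ?J = "insert j1 (J - {i2})"
  have i2: "i2 \<in> {1..n}" using d J_sub[OF J] by blast
  have "insert i2 (?J - {i1}) = insert j1 (J - {i1})" using d False by auto
  then have 1: "(i1, i2) \<in> E ?J" using d False i2 by (intro exchange_edgesI) auto
  have "insert j2 (?J - {j1}) = insert j2 (J - {i2})" using d by auto
  then have 2: "(j1, j2) \<in> E ?J" using d False by (intro exchange_edgesI) auto
  have "insert i2 (insert j2 (?J - {i1, j1})) \<in> M"
    using double[OF d(6) _ _ 1 2] d False by auto
  moreover have "insert i2 (insert j2 (?J - {i1, j1})) = insert j2 (J - {i1})" using d False by auto
  ultimately show ?thesis using d by (intro exchange_edgesI) auto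
qed

lemma edge_if_rel:
  assumes J: "J \<in> M" and r: "(i, y) \<in> rel J" and i: "i \<in> J" and y: "y \<notin> J"
  shows "(i, y) \<in> E J"
proof -
  have "(y \<notin> J \<longrightarrow> (i, y) \<in> E J) \<and> (y \<in> J \<longrightarrow> y = i \<or> (\<exists>j. (i, j) \<in> E J \<and> (y, j) \<in> E J))"
    using r unfolding exchange_rel_def
  proof (induction rule: rtrancl_induct)
    case base
    then show ?case using i by simp
  next
    case (step y z)
    from step.hyps(2) show ?case
    proof
      assume e: "(y, z) \<in> E J"
      then have yz: "y \<in> J" "z \<notin> J" using exchange_edgesD[OF e] by auto
      then have "(i, z) \<in> E J" using step.IH e rectangular[OF J] by blast
      then show ?case using yz by simp
    next
      assume "(y, z) \<in> (E J)\<inverse>"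
      then have e: "(z, y) \<in> E J" by simp
      then have yz: "z \<in> J" "y \<notin> J" using exchange_edgesD[OF e] by auto
      then have "(i, y) \<in> E J" using step.IH by blast
      then show ?case using yz e by blast
    qed
  qed
  then show ?thesis using y by blast
qed

lemma rel_subset_exchange:
  assumes J: "J \<in> M" and ab: "(a, b) \<in> E J"
  shows "rel J \<subseteq> rel (insert b (J - {a}))"
proof -
  let ?J = "insert b (J - {a})"
  note dab = exchange_edgesD[OF ab]
  have a: "a \<in> {1..n}" using dab J_sub[OF J] by blast
  have "insert a (?J - {b}) = J" using dab by auto
  then have ba: "(b, a) \<in> E ?J" using dab a J by (intro exchange_edgesI) auto
  note bar = edge_in_exchange_rel[OF ba]
  have main: "(i, j) \<in> rel ?J" if ij: "(i, j) \<in> E J" for i j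
  proof -
    note d = exchange_edgesD[OF ij]
    consider "i = a" "j = b" | "i = a" "j \<noteq> b" | "i \<noteq> a" "j = b" | "i \<noteq> a" "j \<noteq> b" by blast
    then show ?thesis
    proof cases
      case 1
      then show ?thesis using sym_exchange_rel[OF bar] by simp
    next
      case 2
      then have "insert j (?J - {b}) = insert j (J - {i})" using dab by auto
      then have "(b, j) \<in> E ?J" using d 2 by (intro exchange_edgesI) auto
      then show ?thesis using trans_exchange_rel[OF sym_exchange_rel[OF bar] edge_in_exchange_rel] 2 by simp
    next
      case 3
      then have "insert a (?J - {i}) = insert j (J - {i})" using dab d by auto
      then have "(i, a) \<in> E ?J" using d dab 3 a by (intro exchange_edgesI) auto
      then show ?thesis using trans_exchange_rel[OF edge_in_exchange_rel sym_exchange_rel[OF bar]] 3 by simp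
    next
      case 4
      then have "insert j (insert b (J - {i, a})) \<in> M" using double[OF J _ _ ij ab] by blast
      moreover have "insert j (?J - {i}) = insert j (insert b (J - {i, a}))" using dab d 4 by auto
      ultimately have "(i, j) \<in> E ?J" using d dab 4 by (intro exchange_edgesI) auto
      then show ?thesis by (rule edge_in_exchange_rel)
    qed
  qed
  have "E J \<union> (E J)\<inverse> \<subseteq> rel ?J" using main sym_exchange_rel by auto
  then have "rel J \<subseteq> (rel ?J)\<^sup>*" unfolding exchange_rel_def[of n M J] by (rule rtrancl_mono)
  then show ?thesis by (simp add: exchange_rel_def)
qed

lemma rel_exchange:
  assumes J: "J \<in> M" and ab: "(a, b) \<in> E J"
  shows "rel (insert b (J - {a})) = rel J"
proof
  let ?J = "insert b (J - {a})"
  note dab = exchange_edgesD[OF ab]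
  have a: "a \<in> {1..n}" using dab J_sub[OF J] by blast
  have eq: "insert a (?J - {b}) = J" using dab by auto
  then have "(b, a) \<in> E ?J" using dab a J by (intro exchange_edgesI) auto
  from rel_subset_exchange[OF dab(3) this] show "rel ?J \<subseteq> rel J" unfolding eq .
  show "rel J \<subseteq> rel ?J" by (rule rel_subset_exchange[OF J ab])
qed

end

context positroid_data
begin

lemma Ir_next:
  assumes r: "r \<in> {1..n}"
  defines "r' \<equiv> if r = n then 1 else Suc r"
  shows "w r = r \<Longrightarrow> Ir r' = Ir r"
    and "w r \<noteq> r \<Longrightarrow> r \<in> Ir r \<and> w r \<in> {1..n} - Ir r \<and> Ir r' = insert (w r) (Ir r - {r})"
proof -
  note S = cyc_pos_Suc[OF r, folded r'_def]
  have mem: "w y \<in> Ir r' \<longleftrightarrow> (if y = r \<and> w y \<noteq> r then True else if w y = r \<and> y \<noteq> r then False else w y \<in> Ir r)"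
    if y: "y \<in> {1..n}" for y
  proof -
    have wy: "w y \<in> {1..n}" using w_mem[OF y] .
    have C: "y \<in> C \<Longrightarrow> w y = y" using loops by auto
    have lt: "cyc_pos n r' z < n - 1" if "z \<in> {1..n}" "z \<noteq> r" for z
      using cyc_pos_less[OF r that(1)] S(3)[OF that] by simp
    show ?thesis
      unfolding w_mem_Ir_iff[OF y] decreasing_def
      using S(2) S(3)[OF y] S(3)[OF wy] lt[OF y] lt[OF wy] C cyc_pos_self[of r]
      by (cases "y = r"; cases "w y = r") auto
  qed
  have heads: "\<exists>y\<in>{1..n}. x = w y" if "x \<in> {1..n}" for x using that permutes_image[OF perm] by blast
  show "Ir r' = Ir r" if "w r = r"
  proof -
    have "x \<in> Ir r' \<longleftrightarrow> x \<in> Ir r" if x: "x \<in> {1..n}" for x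
    proof -
      obtain y where y: "y \<in> {1..n}" "x = w y" using heads[OF x] by blast
      show ?thesis using mem[OF y(1)] y(2) \<open>w r = r\<close> w_eq[of y r] by auto
    qed
    then show ?thesis using Ir_subset[of r] Ir_subset[of r'] by blast
  qed
  show "r \<in> Ir r \<and> w r \<in> {1..n} - Ir r \<and> Ir r' = insert (w r) (Ir r - {r})" if wr: "w r \<noteq> r"
  proof -
    have wrn: "w r \<in> {1..n}" using w_mem[OF r] .
    have rC: "r \<notin> C" using loops wr by auto
    have out: "w r \<notin> Ir r" unfolding w_mem_Ir_iff[OF r] decreasing_def using cyc_pos_self[of r] rC by simp
    obtain z where z: "z \<in> {1..n}" "r = w z" using heads[OF r] by blast
    have "z \<noteq> r" using z wr by auto
    then have "0 < cyc_pos n r z" using cyc_pos_inj[OF r z(1) r] cyc_pos_self[of r] by auto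
    then have "w z \<in> Ir r" unfolding w_mem_Ir_iff[OF z(1)] decreasing_def using z(2) cyc_pos_self[of r] by simp
    then have rin: "r \<in> Ir r" using z(2) by simp
    have "x \<in> Ir r' \<longleftrightarrow> x \<in> insert (w r) (Ir r - {r})" if x: "x \<in> {1..n}" for x
    proof -
      obtain y where y: "y \<in> {1..n}" "x = w y" using heads[OF x] by blast
      show ?thesis using mem[OF y(1)] y(2) wr w_eq[of y r] w_eq[of y z] z(2) by auto
    qed
    then have "Ir r' = insert (w r) (Ir r - {r})" using Ir_subset[of r] Ir_subset[of r'] wrn by blast
    then show ?thesis using rin out wrn by blast
  qed
qed

context
  assumes dbl: "\<And>J i i' j j'. J \<in> M \<Longrightarrow> i \<noteq> i' \<Longrightarrow> j \<noteq> j' \<Longrightarrow> (i, j) \<in> exchange_edges n M J \<Longrightarrow>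
      (i', j') \<in> exchange_edges n M J \<Longrightarrow> insert j (insert j' (J - {i, i'})) \<in> M"
    and n1: "1 \<le> n"
begin

interpretation D: double_exchange n k M
  by unfold_locales (use M_subset dbl in auto)

lemma one_mem: "1 \<in> {1..n}" using n1 by simp

definition component_rel :: "(nat \<times> nat) set" where "component_rel = D.rel (Ir 1) \<inter> {1..n} \<times> {1..n}"

definition blocks :: "nat set set" where "blocks = {1..n} // component_rel"

definition block_rank :: "nat set \<Rightarrow> nat" where "block_rank B = card (Ir 1 \<inter> B)"

lemma equiv_R: "equiv {1..n} component_rel"
proof (rule equivI)
  show "component_rel \<subseteq> {1..n} \<times> {1..n}" by (auto simp: component_rel_def)
  show "refl_on {1..n} component_rel" by (auto simp: refl_on_def component_rel_def exchange_rel_def)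
  show "sym component_rel" using sym_exchange_rel by (auto simp: sym_def component_rel_def)
  show "trans component_rel" using trans_exchange_rel by (auto simp: trans_def component_rel_def)
qed

lemma part_blocks: "partition_on {1..n} blocks"
  unfolding blocks_def by (rule partition_on_quotient[OF equiv_R])

lemma edge_Ir: "r \<in> {1..n} \<Longrightarrow> w r \<noteq> r \<Longrightarrow> (r, w r) \<in> D.E (Ir r)"
proof (rule exchange_edgesI)
  assume r: "r \<in> {1..n}" "w r \<noteq> r"
  note N = Ir_next(2)[OF r]
  show "r \<in> Ir r" "w r \<in> {1..n} - Ir r" using N by auto
  show "insert (w r) (Ir r - {r}) \<in> M" using N Ir_in_M[OF cyc_pos_Suc(1)[OF r(1)]] by simp
qed

lemma rel_Ir:
  assumes "r \<in> {1..n}" shows "D.rel (Ir r) = D.rel (Ir 1)"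
  using assms
proof (induction r)
  case (Suc r)
  show ?case
  proof (cases "r = 0")
    case False
    then have r: "r \<in> {1..n}" "r \<noteq> n" using Suc.prems by auto
    show ?thesis
    proof (cases "w r = r")
      case True
      then show ?thesis using Ir_next(1)[OF r(1) True] r Suc.IH by simp
    next
      case neq: False
      then have "Ir (Suc r) = insert (w r) (Ir r - {r})" using Ir_next(2)[OF r(1) neq] r(2) by simp
      then show ?thesis using D.rel_exchange[OF Ir_in_M[OF r(1)] edge_Ir[OF r(1) neq]] Suc.IH r(1) by simp
    qed
  qed simp
qed simp

lemma same_block_R: "B \<in> blocks \<Longrightarrow> x \<in> B \<Longrightarrow> y \<in> B \<Longrightarrow> (x, y) \<in> component_rel"
  unfolding blocks_def using equiv_R by (metis quotient_eq_iff)

lemma block_closed_R: "B \<in> blocks \<Longrightarrow> x \<in> B \<Longrightarrow> (x, y) \<in> component_rel \<Longrightarrow> y \<in> B"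
  unfolding blocks_def using equiv_R in_quotient_imp_closed by metis

lemma R_w: "x \<in> {1..n} \<Longrightarrow> (x, w x) \<in> component_rel"
proof (cases "w x = x")
  case False
  assume x: "x \<in> {1..n}"
  then have "(x, w x) \<in> D.rel (Ir 1)" using edge_in_exchange_rel[OF edge_Ir[OF x False]] rel_Ir[OF x] by simp
  then show ?thesis using x w_mem[OF x] by (simp add: component_rel_def)
qed (auto simp: component_rel_def exchange_rel_def)

lemma blocks_subset: "B \<in> blocks \<Longrightarrow> B \<subseteq> {1..n}"
  using part_blocks by (auto simp: partition_on_def)

lemma blocks_inv:
  assumes B: "B \<in> blocks" shows "w ` B = B"
proof (rule card_subset_eq)
  show "finite B" using blocks_subset[OF B] by (rule finite_subset) simp
  show "w ` B \<subseteq> B" using block_closed_R[OF B _ R_w] blocks_subset[OF B] by blast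
  show "card (w ` B) = card B" using w_eq by (intro card_image) (auto simp: inj_on_def)
qed

lemma card_Ir_blocks:
  assumes "r \<in> {1..n}" and B: "B \<in> blocks" shows "card (Ir r \<inter> B) = block_rank B"
  using assms(1)
proof (induction r)
  case (Suc r)
  show ?case
  proof (cases "r = 0")
    case False
    then have r: "r \<in> {1..n}" "r \<noteq> n" using Suc.prems by auto
    show ?thesis
    proof (cases "w r = r")
      case True
      then show ?thesis using Ir_next(1)[OF r(1) True] r Suc.IH by simp
    next
      case neq: False
      then have N: "r \<in> Ir r" "w r \<notin> Ir r" "Ir (Suc r) = insert (w r) (Ir r - {r})"
        using Ir_next(2)[OF r(1) neq] r(2) by auto
      have fin: "finite (Ir r)" using Ir_subset by (rule finite_subset) simp
      have rw: "r \<in> B \<longleftrightarrow> w r \<in> B"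
      proof
        show "r \<in> B \<Longrightarrow> w r \<in> B" using block_closed_R[OF B _ R_w[OF r(1)]] .
        assume "w r \<in> B"
        then have "w r \<in> w ` B" using blocks_inv[OF B] by simp
        then show "r \<in> B" using w_eq by auto
      qed
      show ?thesis
      proof (cases "r \<in> B")
        case True
        then have eq: "Ir (Suc r) \<inter> B = insert (w r) (Ir r \<inter> B - {r})" using N rw by auto
        have "card (insert (w r) (Ir r \<inter> B - {r})) = Suc (card (Ir r \<inter> B - {r}))"
          using fin N by (intro card_insert_disjoint) auto
        also have "\<dots> = card (Ir r \<inter> B)" using fin N True by (intro card_Suc_Diff1) auto
        finally show ?thesis using Suc.IH r eq by simp
      next
        case False
        then have "Ir (Suc r) \<inter> B = Ir r \<inter> B" using N rw by auto
        then show ?thesis using Suc.IH r by simp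
      qed
    qed
  qed (simp add: block_rank_def)
qed simp

lemma Ir_initial:
  assumes r: "r \<in> {1..n}" and B: "B \<in> blocks" and x: "x \<in> B" "x \<in> Ir r" and y: "y \<in> B"
    and lt: "cyc_pos n r y < cyc_pos n r x"
  shows "y \<in> Ir r"
proof (rule ccontr)
  assume yI: "y \<notin> Ir r"
  let ?I = "insert y (Ir r - {x})" and ?b = "cyc_pos n r y"
  have "(x, y) \<in> D.rel (Ir r)" using same_block_R[OF B x(1) y] rel_Ir[OF r] by (simp add: component_rel_def)
  then have "(x, y) \<in> D.E (Ir r)" using D.edge_if_rel[OF Ir_in_M[OF r]] x(2) yI by blast
  then have I: "?I \<in> M" by (rule exchange_edgesD(3))
  have yn: "y \<in> {1..n}" using blocks_subset[OF B] y by blast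
  have "{z \<in> {1..n}. cyc_pos n r z \<le> ?b \<and> z \<notin> ?I} = {z \<in> {1..n}. cyc_pos n r z \<le> ?b \<and> z \<notin> Ir r} - {y}"
    using lt by auto
  then have "card {z \<in> {1..n}. cyc_pos n r z \<le> ?b \<and> z \<notin> ?I} < card {z \<in> {1..n}. cyc_pos n r z \<le> ?b \<and> z \<notin> Ir r}"
    using yn yI by (simp add: card_Diff1_less del: card_Diff_insert card_Diff_singleton)
  then show False using I r unfolding positroid_iff by (meson not_le)
qed

lemma block_positroid_blocks: "block_positroid n w C k blocks block_rank"
proof
  show "partition_on {1..n} blocks" by (rule part_blocks)
  show "w ` B = B" if "B \<in> blocks" for B by (rule blocks_inv[OF that])
  show "block_rank B \<le> card B" if "B \<in> blocks" for B
    unfolding block_rank_def using finite_subset[OF blocks_subset[OF that]] by (intro card_mono) auto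
  show "x \<in> Ir r \<longleftrightarrow> cyc_rank n r B x < block_rank B" if r: "r \<in> {1..n}" and B: "B \<in> blocks" and x: "x \<in> B" for r B x
  proof -
    have fin: "finite B" using finite_subset[OF blocks_subset[OF B]] by simp
    show ?thesis
    proof
      assume xI: "x \<in> Ir r"
      have "{y \<in> B. cyc_pos n r y < cyc_pos n r x} \<subset> Ir r \<inter> B" using Ir_initial[OF r B x xI] x xI by auto
      then show "cyc_rank n r B x < block_rank B"
        unfolding cyc_rank_def card_Ir_blocks[OF r B, symmetric] using fin by (intro psubset_card_mono) auto
    next
      assume lt: "cyc_rank n r B x < block_rank B"
      show "x \<in> Ir r"
      proof (rule ccontr)
        assume xI: "x \<notin> Ir r"
        have "Ir r \<inter> B \<subseteq> {y \<in> B. cyc_pos n r y < cyc_pos n r x}"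
        proof
          fix y assume y: "y \<in> Ir r \<inter> B"
          have "\<not> cyc_pos n r x < cyc_pos n r y" using Ir_initial[OF r B, of y x] y x xI by blast
          moreover have "cyc_pos n r x \<noteq> cyc_pos n r y"
          proof -
            have "x \<in> {1..n}" "y \<in> {1..n}" "x \<noteq> y" using blocks_subset[OF B] x y xI by blast+
            then show ?thesis using cyc_pos_inj[OF r, of x y] by simp
          qed
          ultimately show "y \<in> {y \<in> B. cyc_pos n r y < cyc_pos n r x}" using y by simp
        qed
        then have "card (Ir r \<inter> B) \<le> cyc_rank n r B x" unfolding cyc_rank_def using fin by (intro card_mono) auto
        then show False using lt card_Ir_blocks[OF r B] by simp
      qed
    qed
  qed
qed

interpretation BP: block_positroid n w C k blocks block_rank by (rule block_positroid_blocks)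

lemma proper_block:
  assumes B: "B \<in> blocks" and xy: "x \<in> B" "y \<in> B" "x \<noteq> y"
  shows "0 < block_rank B" "block_rank B < card B"
proof -
  have fin: "finite B" by (rule BP.block_finite[OF B])
  have "(x, y) \<in> (D.E (Ir 1) \<union> (D.E (Ir 1))\<inverse>)\<^sup>*"
    using same_block_R[OF B xy(1,2)] by (simp add: component_rel_def exchange_rel_def)
  then obtain z where z: "(x, z) \<in> D.E (Ir 1) \<union> (D.E (Ir 1))\<inverse>" using xy(3) by (meson converse_rtranclE)
  have "(x, z) \<in> D.rel (Ir 1)" using z by (auto intro: edge_in_exchange_rel sym_exchange_rel)
  moreover have z': "x \<in> {1..n} \<and> z \<in> {1..n} \<and> (x \<in> Ir 1 \<and> z \<notin> Ir 1 \<or> z \<in> Ir 1 \<and> x \<notin> Ir 1)"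
    using z
  proof
    assume "(x, z) \<in> D.E (Ir 1)"
    from exchange_edgesD[OF this] show ?thesis using Ir_subset[of 1] by blast
  next
    assume "(x, z) \<in> (D.E (Ir 1))\<inverse>"
    then have "(z, x) \<in> D.E (Ir 1)" by simp
    from exchange_edgesD[OF this] show ?thesis using Ir_subset[of 1] by blast
  qed
  ultimately have zB: "z \<in> B" using block_closed_R[OF B xy(1)] by (simp add: component_rel_def)
  have "\<exists>i\<in>B. \<exists>j\<in>B. i \<in> Ir 1 \<and> j \<notin> Ir 1" using z' zB xy(1) by blast
  then obtain i j where ij: "i \<in> B" "j \<in> B" "i \<in> Ir 1" "j \<notin> Ir 1" by blast
  then have "Ir 1 \<inter> B \<noteq> {}" "Ir 1 \<inter> B \<subset> B" by auto
  then show "0 < block_rank B" "block_rank B < card B"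
    unfolding block_rank_def using fin by (auto simp: card_gt_0_iff intro: psubset_card_mono)
qed

lemma spirograph_block:
  assumes B: "B \<in> blocks" shows "spirograph_on w B"
proof (cases "card B = 1")
  case True
  then obtain s where "B = {s}" by (auto simp: card_1_singleton_iff)
  then show ?thesis using blocks_inv[OF B] by (simp add: spirograph_on_def)
next
  case False
  have fin: "finite B" by (rule BP.block_finite[OF B])
  have "B \<noteq> {}" using part_blocks B by (auto simp: partition_on_def)
  then obtain s where s: "s \<in> B" by blast
  have "B \<noteq> {s}" using False by auto
  then obtain s' where "s' \<in> B" "s' \<noteq> s" using s by blast
  then have \<kappa>: "0 < block_rank B" "block_rank B < card B" using proper_block[OF B s] by auto
  let ?m = "card B"
  have rank: "cyc_rank n r B x = (if rk B r \<le> rk B x then rk B x - rk B r else rk B x + ?m - rk B r)"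
    if "r \<in> B" "x \<in> B" for r x
  proof -
    have "r \<in> {1..n}" using blocks_subset[OF B] that by blast
    moreover have "rk B r \<le> rk B x \<longleftrightarrow> r \<le> x" using rk_less_iff[OF fin that(2,1)] by (simp add: not_less[symmetric])
    ultimately show ?thesis using cyc_rank_eq[OF _ blocks_subset[OF B] that(2)] by (simp add: rk_def)
  qed
  have "rk B (w x) = (rk B x + block_rank B) mod ?m" if x: "x \<in> B" for x
  proof -
    have y: "w x \<in> B" using blocks_inv[OF B] x by blast
    have mem: "w x \<in> Ir r \<longleftrightarrow> cyc_rank n r B (w x) < block_rank B" "w x \<in> Ir r \<longleftrightarrow> cyc_rank n r B (w x) < cyc_rank n r B x \<or> x \<in> C"
      if "r \<in> B" for r
    proof -
      have r: "r \<in> {1..n}" "x \<in> {1..n}" using blocks_subset[OF B] that x by blast+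
      show "w x \<in> Ir r \<longleftrightarrow> cyc_rank n r B (w x) < block_rank B" by (rule BP.initial[OF r(1) B y])
      show "w x \<in> Ir r \<longleftrightarrow> cyc_rank n r B (w x) < cyc_rank n r B x \<or> x \<in> C"
        unfolding w_mem_Ir_iff[OF r(2)] decreasing_def cyc_rank_less_iff[OF fin y x] by simp
    qed
    define r1 where "r1 = sorted_list_of_set B ! (if Suc (rk B x) = ?m then 0 else Suc (rk B x))"
    have lt: "rk B x < ?m" "rk B (w x) < ?m" using rk_less_card[OF fin] x y by auto
    have r1: "r1 \<in> B" "rk B r1 = (if Suc (rk B x) = ?m then 0 else Suc (rk B x))"
      unfolding r1_def using lt \<kappa> by (auto intro!: sorted_list_of_set_nth_in fin rk_nth)
    have r1x: "cyc_rank n r1 B x = ?m - 1" using rank[OF r1(1) x] r1(2) lt by auto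
    have xx: "cyc_rank n x B x = 0" using rank[OF x x] by simp
    have xC: "x \<notin> C"
    proof
      assume "x \<in> C"
      then have "w x = x" "w x \<in> Ir r1" using loops mem(2)[OF r1(1)] by auto
      then show False using mem(1)[OF r1(1)] r1x \<kappa> by simp
    qed
    have ge: "block_rank B \<le> cyc_rank n x B (w x)" using mem[OF x] xx xC by simp
    have ne: "w x \<noteq> x" using ge xx \<kappa> by auto
    have "rk B (w x) \<noteq> rk B x" using rk_eq_iff[OF fin y x] ne by simp
    then have dec: "cyc_rank n x B (w x) = Suc (cyc_rank n r1 B (w x))" "cyc_rank n r1 B (w x) < ?m - 1"
      using rank[OF x y] rank[OF r1(1) y] r1(2) lt by (auto split: if_splits)
    then have "cyc_rank n r1 B (w x) < block_rank B" using mem[OF r1(1)] r1x by simp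
    then have eq: "cyc_rank n x B (w x) = block_rank B" using ge dec by simp
    show ?thesis
    proof (cases "rk B x \<le> rk B (w x)")
      case True
      then have "rk B x + block_rank B = rk B (w x)" using eq rank[OF x y] by simp
      then show ?thesis using lt by simp
    next
      case False
      then have "rk B x + block_rank B = rk B (w x) + ?m" using eq rank[OF x y] lt by simp
      then show ?thesis using lt by simp
    qed
  qed
  then show ?thesis unfolding spirograph_on_iff[OF fin blocks_inv[OF B]] using \<kappa> by (intro bexI[of _ "block_rank B"]) auto
qed

lemma rel_if_block_cards:
  assumes "J \<in> ksubsets n k" "\<And>B. B \<in> blocks \<Longrightarrow> card (J \<inter> B) = block_rank B"
  shows "D.rel J = D.rel (Ir 1)"
  using assms
proof (induction "card (J - Ir 1)" arbitrary: J rule: less_induct)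
  case less
  have fin: "finite J" "finite (Ir 1)" using less.prems(1) Ir_subset[of 1] by (auto simp: ksubsets_def intro: finite_subset)
  have Jn: "J \<subseteq> {1..n}" using less.prems(1) by (simp add: ksubsets_def)
  show ?case
  proof (cases "J \<subseteq> Ir 1")
    case True
    have "card (Ir 1) = k" using card_Ir[OF one_mem] card_anti_exceedances by simp
    then have "J = Ir 1" using True less.prems(1) card_subset_eq[OF fin(2) True] by (simp add: ksubsets_def)
    then show ?thesis by simp
  next
    case False
    then obtain x where x: "x \<in> J" "x \<notin> Ir 1" by blast
    then have "x \<in> {1..n}" using Jn by blast
    then obtain B where B: "B \<in> blocks" "x \<in> B" by (rule BP.block_obtain)
    have "\<not> Ir 1 \<inter> B \<subseteq> J"
    proof
      assume "Ir 1 \<inter> B \<subseteq> J"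
      then have "Ir 1 \<inter> B \<subset> J \<inter> B" using x B by auto
      then have "card (Ir 1 \<inter> B) < card (J \<inter> B)" using fin by (intro psubset_card_mono) auto
      then show False using less.prems(2)[OF B(1)] card_Ir_blocks[OF one_mem B(1)] by simp
    qed
    then obtain y where y: "y \<in> Ir 1" "y \<in> B" "y \<notin> J" by blast
    let ?J = "insert y (J - {x})"
    have yn: "y \<in> {1..n} - J" using y Ir_subset by blast
    have Jk: "?J \<in> ksubsets n k" by (rule exchange_in_ksubsets[OF less.prems(1) x(1) yn])
    have cards: "card (?J \<inter> A) = block_rank A" if A: "A \<in> blocks" for A
    proof (cases "A = B")
      case True
      then have eq: "?J \<inter> A = insert y (J \<inter> A - {x})" using y by auto
      have "card (insert y (J \<inter> A - {x})) = Suc (card (J \<inter> A - {x}))"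
        using fin y by (intro card_insert_disjoint) auto
      also have "\<dots> = card (J \<inter> A)" using fin x B True by (intro card_Suc_Diff1) auto
      finally show ?thesis using less.prems(2)[OF A] eq by simp
    next
      case False
      then have "x \<notin> A" "y \<notin> A" using BP.block_eq[OF A B(1)] B(2) y(2) by blast+
      then have "?J \<inter> A = J \<inter> A" by auto
      then show ?thesis using less.prems(2)[OF A] by simp
    qed
    have "?J - Ir 1 = (J - Ir 1) - {x}" using y by auto
    then have "card (?J - Ir 1) < card (J - Ir 1)" using x fin by (simp add: card_Diff1_less del: card_Diff_insert card_Diff_singleton)
    then have IH: "D.rel ?J = D.rel (Ir 1)" using less.hyps Jk cards by blast
    have "J \<in> M" by (rule BP.in_M_if_block_cards[OF less.prems])
    moreover have "(x, y) \<in> D.E J"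
      using x(1) yn BP.in_M_if_block_cards[OF Jk cards] by (intro exchange_edgesI) auto
    ultimately show ?thesis using D.rel_exchange IH by blast
  qed
qed

lemma subset_of_block:
  assumes "finite A" "a \<in> A" "c \<in> A" "a \<noteq> c" "0 < l" "l < card A"
  shows "\<exists>S. S \<subseteq> A \<and> card S = l \<and> a \<in> S \<and> c \<notin> S"
proof -
  have "card (A - {a, c}) = card A - 2" using assms by (simp add: card_Diff_subset)
  then have "l - 1 \<le> card (A - {a, c})" using assms by simp
  then obtain T where T: "T \<subseteq> A - {a, c}" "card T = l - 1" "finite T" by (rule obtain_subset_with_card_n)
  have "card (insert a T) = l" using T assms(5) by (subst card_insert_disjoint) auto
  then show ?thesis using T assms by (intro exI[of _ "insert a T"]) auto
qed

lemma noncrossing_blocks: "noncrossing blocks"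
  unfolding noncrossing_def
proof (intro ballI impI notI)
  fix A B assume AB: "A \<in> blocks" "B \<in> blocks" "A \<noteq> B"
    "\<exists>a b c d. a < b \<and> b < c \<and> c < d \<and> a \<in> A \<and> c \<in> A \<and> b \<in> B \<and> d \<in> B"
  then obtain a b c d where q: "a < b" "b < c" "c < d" "a \<in> A" "c \<in> A" "b \<in> B" "d \<in> B" by blast
  have finAB: "finite A" "finite B" using BP.block_finite AB by auto
  have ac: "a \<noteq> c" "d \<noteq> b" using q by auto
  have disj: "x \<in> A \<Longrightarrow> x \<notin> B" for x using BP.block_eq[OF AB(1,2)] AB(3) by blast
  obtain SA where SA: "SA \<subseteq> A" "card SA = block_rank A" "a \<in> SA" "c \<notin> SA"
    using subset_of_block[OF finAB(1) q(4,5) ac(1) proper_block[OF AB(1) q(4,5) ac(1)]] by blast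
  obtain SB where SB: "SB \<subseteq> B" "card SB = block_rank B" "d \<in> SB" "b \<notin> SB"
    using subset_of_block[OF finAB(2) q(7,6) ac(2) proper_block[OF AB(2) q(7,6) ac(2)]] by blast
  define J where "J = SA \<union> SB \<union> (Ir 1 - A - B)"
  have JA: "J \<inter> A = SA" and JB: "J \<inter> B = SB" using SA SB disj by (auto simp: J_def)
  have JD: "J \<inter> D = Ir 1 \<inter> D" if "D \<in> blocks" "D \<noteq> A" "D \<noteq> B" for D
  proof -
    have "x \<notin> A" "x \<notin> B" if "x \<in> D" for x
      using BP.block_eq[OF \<open>D \<in> blocks\<close> AB(1) that] BP.block_eq[OF \<open>D \<in> blocks\<close> AB(2) that] \<open>D \<noteq> A\<close> \<open>D \<noteq> B\<close> by blast+
    then show ?thesis using SA(1) SB(1) by (auto simp: J_def)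
  qed
  have Jcards: "card (J \<inter> D) = block_rank D" if "D \<in> blocks" for D
    using JA JB JD[OF that] SA(2) SB(2) card_Ir_blocks[OF one_mem that] by (cases "D = A"; cases "D = B") auto
  have Jn: "J \<subseteq> {1..n}" using SA(1) SB(1) blocks_subset[OF AB(1)] blocks_subset[OF AB(2)] Ir_subset[of 1]
    by (auto simp: J_def)
  have "card J = (\<Sum>D\<in>blocks. block_rank D)" unfolding BP.card_blocks[OF Jn] by (intro sum.cong refl Jcards)
  also have "\<dots> = card (Ir 1)" unfolding BP.card_blocks[OF Ir_subset[of 1]]
    by (intro sum.cong refl card_Ir_blocks[OF one_mem, symmetric])
  finally have Jk: "J \<in> ksubsets n k" using Jn card_Ir[OF one_mem] card_anti_exceedances by (simp add: ksubsets_def)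
  have JM: "J \<in> M" by (rule BP.in_M_if_block_cards[OF Jk Jcards])
  have aJ: "a \<in> J" using JA SA(3) by blast
  have bJ: "b \<in> {1..n} - J" using JB SB(4) q(6) blocks_subset[OF AB(2)] by blast
  have cJ: "c \<notin> J" using JA SA(4) q(5) by blast
  let ?I = "insert b (J - {a})"
  have Ik: "?I \<in> ksubsets n k" by (rule exchange_in_ksubsets[OF Jk aJ bJ])
  then have In: "?I \<subseteq> {1..n}" by (simp add: ksubsets_def)
  have "?I \<in> M"
    unfolding BP.mem_M_iff_prefix
  proof (intro conjI Ik ballI allI)
    fix r \<beta> assume r: "r \<in> {1..n}"
    let ?X = "\<lambda>K. {x \<in> K. cyc_pos n r x \<le> \<beta>}"
    have sub: "?X ?I \<subseteq> {1..n}" "?X (Ir r) \<subseteq> {1..n}" using In Ir_subset[of r] by auto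
    have pre: "card (?X J \<inter> D) \<le> card (?X (Ir r) \<inter> D)" if "D \<in> blocks" for D
      by (rule BP.card_prefix_Ir_block[OF r that Jcards[OF that]])
    have finX: "finite (?X K \<inter> D)" if "D \<in> blocks" for K D using BP.block_finite[OF that] by auto
    have two: "card (?X ?I \<inter> A) + card (?X ?I \<inter> B) \<le> card (?X (Ir r) \<inter> A) + card (?X (Ir r) \<inter> B)"
    proof (cases "?I \<inter> B \<subseteq> ?X ?I")
      case False
      have IA: "card (?X ?I \<inter> A) \<le> card (?X J \<inter> A)" using disj[of b] q finX[OF AB(1)] by (intro card_mono) auto
      have IB: "card (?X ?I \<inter> B) \<le> card (?X (Ir r) \<inter> B)"
      proof (cases "?X UNIV \<inter> B \<subseteq> Ir r")
        case True
        then have "?X ?I \<inter> B \<subseteq> ?X (Ir r) \<inter> B" by auto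
        then show ?thesis using finX[OF AB(2)] by (intro card_mono) auto
      next
        case nsub: False
        then obtain z where z: "z \<in> B" "cyc_pos n r z \<le> \<beta>" "z \<notin> Ir r" by auto
        have "Ir r \<inter> B \<subseteq> ?X (Ir r) \<inter> B"
        proof
          fix y assume y: "y \<in> Ir r \<inter> B"
          have "\<not> cyc_pos n r z < cyc_pos n r y" using Ir_initial[OF r AB(2), of y z] y z by blast
          then show "y \<in> ?X (Ir r) \<inter> B" using y z by auto
        qed
        then have "block_rank B \<le> card (?X (Ir r) \<inter> B)"
          unfolding card_Ir_blocks[OF r AB(2), symmetric] using finX[OF AB(2)] by (intro card_mono) auto
        moreover have "card (?X ?I \<inter> B) < card (?I \<inter> B)"
          using False finAB(2) by (intro psubset_card_mono) auto
        moreover have "card (?I \<inter> B) = Suc (block_rank B)"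
        proof -
          have "?I \<inter> B = insert b SB" using JB q disj[OF q(4)] SB by auto
          then show ?thesis using SB finAB(2) finite_subset[OF SB(1)] by simp
        qed
        ultimately show ?thesis by simp
      qed
      show ?thesis using IA IB pre[OF AB(1)] by linarith
    next
      case True
      have IBe: "?I \<inter> B = insert b SB" using JB q disj[OF q(4)] SB by auto
      have IB: "card (?X ?I \<inter> B) = Suc (block_rank B)"
      proof -
        have "?X ?I \<inter> B = ?I \<inter> B" using True by auto
        then show ?thesis using IBe SB finAB(2) finite_subset[OF SB(1)] by simp
      qed
      have bd: "cyc_pos n r b \<le> \<beta>" "cyc_pos n r d \<le> \<beta>" using True IBe SB by auto
      have mem: "a \<in> {1..n}" "b \<in> {1..n}" "c \<in> {1..n}" "d \<in> {1..n}"
        using q blocks_subset[OF AB(1)] blocks_subset[OF AB(2)] by blast+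
      have "cyc_pos n r a \<le> \<beta> \<or> cyc_pos n r c \<le> \<beta>"
        using bd q(1-3) r cyc_pos_eq[OF r mem(1)] cyc_pos_eq[OF r mem(2)] cyc_pos_eq[OF r mem(3)] cyc_pos_eq[OF r mem(4)]
          mem by (auto split: if_splits)
      then obtain e where e: "e \<in> A" "e \<notin> ?I" "cyc_pos n r e \<le> \<beta>"
        using q(4,5) cJ disj[OF q(4)] disj[OF q(5)] q(6) by (metis Diff_iff insertE insertI1)
      have IA: "Suc (card (?X ?I \<inter> A)) \<le> card (?X (Ir r) \<inter> A)"
      proof (cases "?X UNIV \<inter> A \<subseteq> Ir r")
        case True
        then have "?X ?I \<inter> A \<subset> ?X (Ir r) \<inter> A" using e by auto
        then show ?thesis using psubset_card_mono[OF finX[OF AB(1)]] by (simp add: Suc_le_eq)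
      next
        case nsub: False
        then obtain z where z: "z \<in> A" "cyc_pos n r z \<le> \<beta>" "z \<notin> Ir r" by auto
        have "Ir r \<inter> A \<subseteq> ?X (Ir r) \<inter> A"
        proof
          fix y assume y: "y \<in> Ir r \<inter> A"
          have "\<not> cyc_pos n r z < cyc_pos n r y" using Ir_initial[OF r AB(1), of y z] y z by blast
          then show "y \<in> ?X (Ir r) \<inter> A" using y z by auto
        qed
        then have "block_rank A \<le> card (?X (Ir r) \<inter> A)"
          unfolding card_Ir_blocks[OF r AB(1), symmetric] using finX[OF AB(1)] by (intro card_mono) auto
        moreover have "card (?X ?I \<inter> A) < block_rank A"
        proof -
          have "b \<notin> A" using disj q(6) by blast
          then have "?X ?I \<inter> A \<subseteq> J \<inter> A - {a}" by blast
          then have "?X ?I \<inter> A \<subset> SA" unfolding JA using SA(3) by blast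
          then show ?thesis unfolding SA(2)[symmetric] using finite_subset[OF SA(1) finAB(1)] by (intro psubset_card_mono) auto
        qed
        ultimately show ?thesis by simp
      qed
      have "block_rank B \<le> card (?X (Ir r) \<inter> B)"
      proof -
        have "card (?X J \<inter> B) = block_rank B"
        proof -
          have "a \<notin> B" using disj q(4) by blast
          then have "J \<inter> B \<subseteq> ?X J" using True by blast
          then have "?X J \<inter> B = J \<inter> B" by blast
          then have "?X J \<inter> B = SB" using JB by simp
          then show ?thesis using SB(2) by simp
        qed
        then show ?thesis using pre[OF AB(2)] by simp
      qed
      then show ?thesis using IA IB by linarith
    qed
    have rest: "card (?X ?I \<inter> D) \<le> card (?X (Ir r) \<inter> D)" if D: "D \<in> blocks - {A, B}" for D
    proof -
      have "a \<notin> D" "b \<notin> D" using BP.block_eq[of D A a] BP.block_eq[of D B b] D AB q by blast+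
      then have "?X ?I \<inter> D = ?X J \<inter> D" by auto
      then show ?thesis using pre D by simp
    qed
    have split: "(\<Sum>D\<in>blocks. f D) = f A + f B + (\<Sum>D\<in>blocks - {A, B}. f D)" for f :: "nat set \<Rightarrow> nat"
    proof -
      have "(\<Sum>D\<in>blocks. f D) = (\<Sum>D\<in>blocks - {A, B}. f D) + (\<Sum>D\<in>{A, B}. f D)"
        using AB BP.blocks_finite by (intro sum.subset_diff) auto
      then show ?thesis using AB(3) by simp
    qed
    show "card (?X ?I) \<le> card (?X (Ir r))"
      unfolding BP.card_blocks[OF sub(1)] BP.card_blocks[OF sub(2)] split
      by (rule add_mono[OF two sum_mono[OF rest]])
  qed
  then have "(a, b) \<in> D.E J" using aJ bJ by (intro exchange_edgesI)
  then have "(a, b) \<in> D.rel (Ir 1)" using edge_in_exchange_rel rel_if_block_cards[OF Jk Jcards] by blast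
  then have "(a, b) \<in> component_rel" using aJ bJ Jn by (auto simp: component_rel_def)
  then have "b \<in> A" using block_closed_R[OF AB(1) q(4)] by blast
  then show False using disj q(6) by blast
qed

lemma union_of_spirographs_blocks: "union_of_spirographs n w"
  unfolding union_of_spirographs_def
  using part_blocks noncrossing_blocks blocks_inv spirograph_block by (intro exI[of _ blocks]) auto

end

lemma union_of_spirographs_if_smooth:
  assumes "smooth_in_grassmannian n k (positroid_variety n k M)"
  shows "union_of_spirographs n w"
proof (cases "1 \<le> n")
  case True
  show ?thesis
  proof (rule union_of_spirographs_blocks[OF _ True])
    fix J i i' j j'
    assume a: "J \<in> M" "i \<noteq> i'" "j \<noteq> j'" "(i, j) \<in> exchange_edges n M J" "(i', j') \<in> exchange_edges n M J"
    show "insert j (insert j' (J - {i, i'})) \<in> M"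
      by (rule double_exchange_if_smooth[OF M_subset assms a(1) _ _ a(2-5)])
        (use exchange_edgesD(1)[OF a(4)] exchange_edgesD(1)[OF a(5)] in auto)
  qed
next
  case False
  then have "n = 0" by simp
  then show ?thesis unfolding union_of_spirographs_def
    by (intro exI[of _ "{}"]) (auto simp: partition_on_def noncrossing_def)
qed

end

section \<open>The equivalence\<close>

lemma degree_johnson_graph:
  assumes "J \<in> M"
  shows "degree_in (johnson_graph k M) J = card {I \<in> M. card (I \<inter> J) + 1 = k}"
proof -
  let ?N = "{I \<in> M. card (I \<inter> J) + 1 = k}"
  have "{e \<in> snd (johnson_graph k M). J \<in> e} = (\<lambda>I. {I, J}) ` ?N"
  proof (rule Set.set_eqI, rule iffI)
    fix e assume "e \<in> {e \<in> snd (johnson_graph k M). J \<in> e}"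
    then obtain I I' where e: "e = {I, I'}" "I \<in> M" "I' \<in> M" "card (I \<inter> I') + 1 = k" "J = I \<or> J = I'"
      by (auto simp: johnson_graph_def)
    from e(5) show "e \<in> (\<lambda>I. {I, J}) ` ?N"
    proof
      assume "J = I"
      then show ?thesis using e by (intro image_eqI[of _ _ I']) (auto simp: Int_commute)
    next
      assume "J = I'"
      then show ?thesis using e by (intro image_eqI[of _ _ I]) auto
    qed
  next
    fix e assume "e \<in> (\<lambda>I. {I, J}) ` ?N"
    then show "e \<in> {e \<in> snd (johnson_graph k M). J \<in> e}" using assms by (auto simp: johnson_graph_def)
  qed
  moreover have "inj_on (\<lambda>I. {I, J}) ?N" by (auto simp: inj_on_def doubleton_eq_iff)
  ultimately show ?thesis by (simp only: degree_in_def card_image)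
qed

lemma regular_johnson_graph_iff:
  "(\<forall>J\<in>M. int (card {I \<in> M. card (I \<inter> J) + 1 = k}) = N) \<longleftrightarrow>
   regular_graph (johnson_graph k M) \<and>
   (\<forall>J\<in>fst (johnson_graph k M). int (degree_in (johnson_graph k M) J) = N)"
proof -
  have fst: "fst (johnson_graph k M) = M" by (simp add: johnson_graph_def)
  have "regular_graph (johnson_graph k M)" if "\<forall>J\<in>M. int (degree_in (johnson_graph k M) J) = N"
    unfolding regular_graph_def fst using that by (intro exI[of _ "nat N"]) auto
  moreover have "(\<forall>J\<in>M. int (card {I \<in> M. card (I \<inter> J) + 1 = k}) = N) \<longleftrightarrow>
      (\<forall>J\<in>M. int (degree_in (johnson_graph k M) J) = N)"
    by (intro ball_cong refl) (simp only: degree_johnson_graph)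
  ultimately show ?thesis unfolding fst by blast
qed

context positroid_data
begin

lemma smooth_and_degree_if_no_crossed_alignment:
  assumes nc: "\<not> (\<exists>i\<in>{1..n}. \<exists>j\<in>{1..n}. crossed_alignment n w C i j)"
  shows "smooth_in_grassmannian n k (positroid_variety n k M)"
    and "J \<in> M \<Longrightarrow> card {I \<in> M. card (I \<inter> J) + 1 = k} + card (alignments n w C) = k * (n - k)"
proof -
  obtain P where P: "partition_on {1..n} P" "noncrossing P"
      "\<forall>B\<in>P. w ` B = B \<and> spirograph_on w B \<and> (card B = 1 \<or> (\<forall>x\<in>B. w x \<noteq> x))"
    using ex_spirograph_partition[OF order_refl permutes_image[OF perm] nc] by (elim exE conjE) (rule that)
  have sub: "B \<subseteq> {1..n}" if "B \<in> P" for B using P(1) that by (auto simp: partition_on_def)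
  have "\<forall>B\<in>P. \<exists>c. c \<le> card B \<and> (\<forall>r\<in>{1..n}. \<forall>x\<in>B. x \<in> Ir r \<longleftrightarrow> cyc_rank n r B x < c)"
    using block_initial_segments sub P(3) by simp
  from bchoice[OF this] obtain \<kappa> where \<kappa>: "\<forall>B\<in>P. \<kappa> B \<le> card B \<and>
      (\<forall>r\<in>{1..n}. \<forall>x\<in>B. x \<in> Ir r \<longleftrightarrow> cyc_rank n r B x < \<kappa> B)" by (elim exE) (rule that)
  interpret noncrossing_block_positroid n w C k P \<kappa>
  proof
    show "x \<in> Ir r \<longleftrightarrow> cyc_rank n r B x < \<kappa> B" if "r \<in> {1..n}" "B \<in> P" "x \<in> B" for r B x
      using bspec[OF \<kappa> that(2)] that(1,3) by blast
  qed (use P \<kappa> in simp_all)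
  show "smooth_in_grassmannian n k (positroid_variety n k M)" by (rule smooth)
  show "card {I \<in> M. card (I \<inter> J) + 1 = k} + card (alignments n w C) = k * (n - k)" if J: "J \<in> M"
  proof (rule card_alignments_blocks[OF _ J])
    fix B i j assume B: "B \<in> P" and ij: "i \<in> B" "j \<in> B"
    have Bw: "w ` B = B" "spirograph_on w B" "card B = 1 \<or> (\<forall>x\<in>B. w x \<noteq> x)" using P(3) B by auto
    show "\<not> alignment w C i j"
    proof (cases "card B = 1")
      case True
      then have "i = j" using ij by (auto simp: card_1_singleton_iff)
      then show ?thesis by (simp add: alignment_def)
    next
      case False
      then have "w i \<noteq> i" "w j \<noteq> j" using Bw(3) ij by auto
      then show ?thesis by (rule no_alignment_in_spirograph[OF sub[OF B] Bw(1,2) ij])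
    qed
  qed
qed

end

theorem theorem1p6:
  fixes n k :: nat and w :: "nat \<Rightarrow> nat" and C :: "nat set" and M :: "nat set set"
  assumes "k \<le> n"
    and "(w, C) \<in> decorated_perms n k"
    and "M = positroid n k w C"
  shows
    "(smooth_in_grassmannian n k (positroid_variety n k M) \<longleftrightarrow>
      (\<forall>J\<in>M. int (card {I \<in> M. card (I \<inter> J) + 1 = k}) =
              int k * (int n - int k) - int (card (alignments n w C)))) \<and>
     ((\<forall>J\<in>M. int (card {I \<in> M. card (I \<inter> J) + 1 = k}) =
              int k * (int n - int k) - int (card (alignments n w C))) \<longleftrightarrow>
      (regular_graph (johnson_graph k M) \<and>
       (\<forall>J\<in>fst (johnson_graph k M). int (degree_in (johnson_graph k M) J) =
              int k * (int n - int k) - int (card (alignments n w C))))) \<and>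
     ((regular_graph (johnson_graph k M) \<and>
       (\<forall>J\<in>fst (johnson_graph k M). int (degree_in (johnson_graph k M) J) =
              int k * (int n - int k) - int (card (alignments n w C)))) \<longleftrightarrow>
      \<not> (\<exists>i\<in>{1..n}. \<exists>j\<in>{1..n}. crossed_alignment n w C i j)) \<and>
     (\<not> (\<exists>i\<in>{1..n}. \<exists>j\<in>{1..n}. crossed_alignment n w C i j) \<longleftrightarrow>
      union_of_spirographs n w)"
    (is "(?smooth \<longleftrightarrow> ?degree) \<and> (?degree \<longleftrightarrow> ?regular) \<and> (?regular \<longleftrightarrow> ?uncrossed) \<and> (?uncrossed \<longleftrightarrow> ?spiro)")
proof -
  interpret positroid_data n w C k
    using assms(2) by unfold_locales (auto simp: decorated_perms_def)
  have reg: "?degree \<longleftrightarrow> ?regular" by (rule regular_johnson_graph_iff)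
  have deg_unc: "?degree \<Longrightarrow> ?uncrossed" unfolding assms(3) by (rule no_crossed_alignment_if_degree)
  have unc_spiro: "?uncrossed \<longleftrightarrow> ?spiro"
    using union_of_spirographs_if_no_crossed_alignment no_crossed_alignment_if_union_of_spirographs by blast
  have smooth_spiro: "?smooth \<Longrightarrow> ?spiro" unfolding assms(3) by (rule union_of_spirographs_if_smooth)
  have unc_smooth: "?uncrossed \<Longrightarrow> ?smooth"
    unfolding assms(3) by (rule smooth_and_degree_if_no_crossed_alignment(1))
  have unc_deg: "?degree" if ?uncrossed
  proof
    fix J assume "J \<in> M"
    then have "card {I \<in> M. card (I \<inter> J) + 1 = k} + card (alignments n w C) = k * (n - k)"
      using smooth_and_degree_if_no_crossed_alignment(2)[OF that] unfolding assms(3) by blast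
    moreover have "int (k * (n - k)) = int k * (int n - int k)" using assms(1) by (simp add: of_nat_diff)
    ultimately show "int (card {I \<in> M. card (I \<inter> J) + 1 = k}) =
        int k * (int n - int k) - int (card (alignments n w C))" by linarith
  qed
  show ?thesis using reg deg_unc unc_spiro smooth_spiro unc_smooth unc_deg by argo
qed

end
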